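(* Let $\theta^*=(Q^*,f^* )$ and suppose the probability measures $f_1^*\lambda,\dots,f_k^*\lambda$ are linearly independent and $Q^*$ has full rank. Let $\underline q>0$, assume $\mu_i\ge\underline q$ for all $i$, that the support of the prior $\pi$ is included in $\Theta(\underline q)$, and that (A1) and (A2) hold (for some integer $l\ge3$). Then for every neighborhood $U_{Q^*}$ of $Q^*$ (for the norm $\|\cdot\|$) and every family of neighborhoods $U_{f_i^*}$ of $f_i^*\lambda$ in the weak topology on probability measures on $\mathbb R^d$, $1\le i\le k$, $$\mathbb P^{\theta^*}\Big(\lim_{n\to\infty}\pi\big(\{(Q,f):\exists\sigma\in\mathcal S_k,\ \sigma Q\in U_{Q^*},\ f_{\sigma(i)}\lambda\in U_{f_i^*}\ \forall\, 1\le i\le k\}\ \big|\ Y_{1:n}\big)=1\Big)=1,$$ where $\mathcal S_k$ is the symmetric group on $\{1,\dots,k\}$ and $(\sigma Q)_{i,j}=Q_{\sigma(i),\sigma(j)}$.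
   Context: Fix integers $k\ge1$, $d\ge1$. $\lambda$ is a $\sigma$-finite reference measure on $\mathbb R^d$ (Borel $\sigma$-field) and $\mathcal F$ is the set of probability densities with respect to $\lambda$. $\Delta_k=\{x\in[0,\infty)^k:\sum_i x_i=1\}$; a transition matrix is an element $Q\in\Delta_k^k$ (each row lies in $\Delta_k$). For $\underline q\ge0$, $\Delta^k(\underline q)=\{Q\in\Delta_k^k:\min_{i,j}Q_{i,j}\ge\underline q\}$, $\Theta=\Delta_k^k\times\mathcal F^k$ and $\Theta(\underline q)=\Delta^k(\underline q)\times\mathcal F^k$. For $\underline q>0$ and $Q\in\Delta^k(\underline q)$, $\mu^Q$ denotes the unique stationary distribution of $Q$. For $\theta=(Q,f)$, $f=(f_1,\dots,f_k)\in\mathcal F^k$, and an initial distribution $\nu\in\Delta_k$, $\mathbb P^{\theta,\nu}$ is the law of the hidden Markov model $(X_t,Y_t)_{t\ge1}$: $(X_t)$ is a Markov chain on $\{1,\dots,k\}$ with initial law $\nu$ and transition matrix $Q$, and conditionally on $(X_t)_t$ the variables $Y_t\in\mathbb R^d$ are independent, $Y_t$ having density $f_{X_t}$ with respect to $\lambda$. $\mathbb P^\theta:=\mathbb P^{\theta,\mu^Q}$. The density of $Y_{1:l}$ with respect to $\lambda^{\otimes l}$ is $p_l^{\theta,\nu}(y_{1:l})=\sum_{x_1,\dots,x_l=1}^k\nu_{x_1}Q_{x_1,x_2}\cdots Q_{x_{l-1},x_l}f_{x_1}(y_1)\cdots f_{x_l}(y_l)$; $p_l^\theta:=p_l^{\theta,\mu^Q}$.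 The prior is $\pi=\pi_Q\otimes\pi_f$ on $\Theta$ together with a fixed initial distribution $\mu\in\Delta_k$; the posterior is $\pi(A\mid Y_{1:n})=\int_A p_n^{\theta,\mu}(Y_{1:n})\pi(d\theta)\big/\int_\Theta p_n^{\theta,\mu}(Y_{1:n})\pi(d\theta)$. The observations are distributed according to $\mathbb P^{\theta^*}$. Notation: $\|M\|=\max_{i,j}|M_{i,j}|$; $d(g,\tilde g)=\max_j\|g_j-\tilde g_j\|_{L_1(\lambda)}$; $N(\delta,A,D)$ is the minimal number of $D$-balls of radius $\delta$ centered at points needed to cover $A$. Assumption (A1) (for given $\underline q>0$): there is $\epsilon_0>0$ such that for every $\epsilon\in(0,\epsilon_0)$ there is a set $\Theta_\epsilon\subset\Theta(\underline q)$ with $\pi(\Theta_\epsilon)>0$ such that every $\theta=(Q,f)\in\Theta_\epsilon$ satisfies: (A1a) $\|Q-Q^*\|<\epsilon$; (A1b) $\max_{1\le i\le k}\int f_i^*(y)\max_{1\le j\le k}\log\big(f_j^*(y)/f_j(y)\big)\lambda(dy)<\epsilon$; (A1c) for all $y$ with $\sum_i f_i^*(y)>0$, $\sum_j f_j(y)>0$; (A1d) $\sup_{y:\sum_i f_i^*(y)>0}\max_j f_j(y)<\infty$; (A1e) $\sum_{i=1}^k\int f_i^*(y)\,\big|\log\big(\sum_{j=1}^k f_j(y)\big)\big|\lambda(dy)<\infty$. Assumption (A2) (for given $\underline q>0$ and $l$): for every $\delta>0$ there exist sets $\mathcal F_n\subset\mathcal F^k$ ($n\ge1$) and constants $r_1>0$,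 $C>0$ such that $\pi_f(\mathcal F^k\setminus\mathcal F_n)\le Ce^{-nr_1}$ for all $n$ and $\sum_{n\ge1}N\big(\tfrac{\delta}{36l},\mathcal F_n,d\big)\exp\big(-\tfrac{n\delta^2k^2\underline q^2}{32l}\big)<\infty$. *)

theory Defs
  imports "HOL-Probability.Probability"
begin

text \<open>Hidden states: a finite type 'k (so k = CARD('k) \<ge> 1).
  Observations: real^'d (so d = CARD('d) \<ge> 1).
  Transition matrices: real^'k^'k, Q$i$j is the (i,j) entry.
  Emission tuples f: 'k \<Rightarrow> real^'d \<Rightarrow> real.\<close>

definition prob_vec :: "('k::finite \<Rightarrow> real) \<Rightarrow> bool" where
  "prob_vec \<nu> \<longleftrightarrow> (\<forall>i. \<nu> i \<ge> 0) \<and> (\<Sum>i\<in>UNIV. \<nu> i) = 1"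

definition trans_mat :: "real^'k::finite^'k \<Rightarrow> bool" where
  "trans_mat Q \<longleftrightarrow> (\<forall>i. prob_vec (\<lambda>j. Q$i$j))"

definition trans_mat_lb :: "real \<Rightarrow> real^'k::finite^'k \<Rightarrow> bool" where
  "trans_mat_lb q Q \<longleftrightarrow> trans_mat Q \<and> (\<forall>i j. Q$i$j \<ge> q)"

definition stat_dist :: "real^'k::finite^'k \<Rightarrow> ('k \<Rightarrow> real)" where
  "stat_dist Q = (THE \<nu>. prob_vec \<nu> \<and> (\<forall>j. (\<Sum>i\<in>UNIV. \<nu> i * Q$i$j) = \<nu> j))"

definition is_density :: "'y measure \<Rightarrow> ('y \<Rightarrow> real) \<Rightarrow> bool" where
  "is_density lam g \<longleftrightarrow> g \<in> borel_measurable lam \<and> (\<forall>y. g y \<ge> 0)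
      \<and> (\<integral>\<^sup>+ y. ennreal (g y) \<partial>lam) = 1"

definition dens_tuples :: "'y measure \<Rightarrow> ('k \<Rightarrow> 'y \<Rightarrow> real) set" where
  "dens_tuples lam = {f. \<forall>j. is_density lam (f j)}"

definition Theta_lb :: "'y measure \<Rightarrow> real \<Rightarrow> ((real^'k::finite^'k) \<times> ('k \<Rightarrow> 'y \<Rightarrow> real)) set" where
  "Theta_lb lam q = {(Q, f). trans_mat_lb q Q \<and> f \<in> dens_tuples lam}"

text \<open>density p_n^{theta,nu}(y_1..y_n) of Y_{1:n}; observations indexed 0..n-1\<close>
definition lik :: "nat \<Rightarrow> real^'k::finite^'k \<Rightarrow> ('k \<Rightarrow> 'y \<Rightarrow> real) \<Rightarrow> ('k \<Rightarrow> real)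
     \<Rightarrow> (nat \<Rightarrow> 'y) \<Rightarrow> real" where
  "lik n Q f \<nu> ys = (\<Sum>x\<in>PiE {..<n} (\<lambda>_. UNIV).
       (if n = 0 then 1 else \<nu> (x 0)) * (\<Prod>t\<in>{1..<n}. Q$(x (t - 1))$(x t))
       * (\<Prod>t\<in>{..<n}. f (x t) (ys t)))"

definition mat_maxnorm :: "real^'k::finite^'k \<Rightarrow> real" where
  "mat_maxnorm M = Max (range (\<lambda>(i,j). \<bar>M$i$j\<bar>))"

definition dens_dist :: "'y measure \<Rightarrow> ('k::finite \<Rightarrow> 'y \<Rightarrow> real) \<Rightarrow> ('k \<Rightarrow> 'y \<Rightarrow> real) \<Rightarrow> real" where
  "dens_dist lam g h = Max (range (\<lambda>j. \<integral> y. \<bar>g j y - h j y\<bar> \<partial>lam))"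

text \<open>N(delta, A, D): minimal number of D-balls of radius delta, centred at points
  of the ambient space X, covering A (infinity if no finite cover exists)\<close>
definition covering_number :: "real \<Rightarrow> 'a set \<Rightarrow> 'a set \<Rightarrow> ('a \<Rightarrow> 'a \<Rightarrow> real) \<Rightarrow> ennreal" where
  "covering_number \<delta> A X D = Inf {ennreal (real (card C)) | C. finite C \<and> C \<subseteq> X \<and>
       A \<subseteq> (\<Union>c\<in>C. {x. D c x < \<delta>})}"

definition log_ratio :: "real \<Rightarrow> real \<Rightarrow> ereal" where
  "log_ratio a b = (if a = 0 then -\<infinity> else if b = 0 then \<infinity> else ereal (ln (a / b)))"

definition ext_integral :: "'y measure \<Rightarrow> ('y \<Rightarrow> ereal) \<Rightarrow> ereal" where
  "ext_integral lam g = enn2ereal (\<integral>\<^sup>+ y. e2ennreal (g y) \<partial>lam)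
                      - enn2ereal (\<integral>\<^sup>+ y. e2ennreal (- g y) \<partial>lam)"

definition A1_cond :: "'y measure \<Rightarrow> real \<Rightarrow> real^'k::finite^'k \<Rightarrow> ('k \<Rightarrow> 'y \<Rightarrow> real)
    \<Rightarrow> real \<Rightarrow> real^'k^'k \<Rightarrow> ('k \<Rightarrow> 'y \<Rightarrow> real) \<Rightarrow> bool" where
  "A1_cond lam q Qs fs \<epsilon> Q f \<longleftrightarrow>
     mat_maxnorm (Q - Qs) < \<epsilon>
   \<and> (\<forall>i. ext_integral lam (\<lambda>y. ereal (fs i y) *
              Max (range (\<lambda>j. log_ratio (fs j y) (f j y)))) < ereal \<epsilon>)
   \<and> (\<forall>y. (\<Sum>i\<in>UNIV. fs i y) > 0 \<longrightarrow> (\<Sum>j\<in>UNIV. f j y) > 0)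
   \<and> (\<exists>B. \<forall>y. (\<Sum>i\<in>UNIV. fs i y) > 0 \<longrightarrow> (\<forall>j. f j y \<le> B))
   \<and> (\<Sum>i\<in>UNIV. \<integral>\<^sup>+ y. ennreal (fs i y * \<bar>ln (\<Sum>j\<in>UNIV. f j y)\<bar>) \<partial>lam) < \<infinity>"

definition assumption_A1 :: "'y measure \<Rightarrow> ((real^'k::finite^'k) \<times> ('k \<Rightarrow> 'y \<Rightarrow> real)) measure
    \<Rightarrow> real \<Rightarrow> real^'k^'k \<Rightarrow> ('k \<Rightarrow> 'y \<Rightarrow> real) \<Rightarrow> bool" where
  "assumption_A1 lam prior q Qs fs \<longleftrightarrow>
     (\<exists>\<epsilon>0>0. \<forall>\<epsilon>. 0 < \<epsilon> \<and> \<epsilon> < \<epsilon>0 \<longrightarrow>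
        (\<exists>Th. Th \<in> sets prior \<and> Th \<subseteq> Theta_lb lam q \<and> emeasure prior Th > 0 \<and>
              (\<forall>(Q, f)\<in>Th. A1_cond lam q Qs fs \<epsilon> Q f)))"

definition assumption_A2 :: "'y measure \<Rightarrow> ('k::finite \<Rightarrow> 'y \<Rightarrow> real) measure \<Rightarrow> real \<Rightarrow> nat \<Rightarrow> bool" where
  "assumption_A2 lam pif q l \<longleftrightarrow>
     (\<forall>\<delta>>0. \<exists>F :: nat \<Rightarrow> ('k \<Rightarrow> 'y \<Rightarrow> real) set. \<exists>r1>0. \<exists>C>0.
        (\<forall>n\<ge>1. F n \<subseteq> dens_tuples lam) \<and>
        (\<forall>n\<ge>1. \<exists>N\<in>sets pif. (dens_tuples lam - F n) \<inter> space pif \<subseteq> N \<and>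
                  emeasure pif N \<le> ennreal (C * exp (- real n * r1))) \<and>
        (\<Sum>n. covering_number (\<delta> / (36 * real l)) (F (Suc n)) (dens_tuples lam) (dens_dist lam)
              * ennreal (exp (- real (Suc n) * \<delta>\<^sup>2 * (real CARD('k))\<^sup>2 * q\<^sup>2 / (32 * real l))))
          < \<infinity>)"

definition norm_nhd :: "real^'k::finite^'k \<Rightarrow> (real^'k^'k) set \<Rightarrow> bool" where
  "norm_nhd M U \<longleftrightarrow> (\<exists>e>0. \<forall>Q. mat_maxnorm (Q - M) < e \<longrightarrow> Q \<in> U)"

definition weak_nhd :: "'y::topological_space measure \<Rightarrow> 'y measure set \<Rightarrow> bool" where
  "weak_nhd P U \<longleftrightarrow> (\<exists>G e. finite G \<and> e > 0 \<and>
      (\<forall>g\<in>G. continuous_on UNIV g \<and> bounded (range (g :: 'y \<Rightarrow> real))) \<and>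
      (\<forall>R. prob_space R \<and> sets R = sets borel \<and>
            (\<forall>g\<in>G. \<bar>(\<integral>y. g y \<partial>R) - (\<integral>y. g y \<partial>P)\<bar> < e) \<longrightarrow> R \<in> U))"

text \<open>posterior mass of a set A given y_1..y_n (lower integral if A is not measurable)\<close>
definition posterior :: "((real^'k::finite^'k) \<times> ('k \<Rightarrow> 'y \<Rightarrow> real)) measure \<Rightarrow> ('k \<Rightarrow> real)
    \<Rightarrow> nat \<Rightarrow> (nat \<Rightarrow> 'y) \<Rightarrow> ((real^'k^'k) \<times> ('k \<Rightarrow> 'y \<Rightarrow> real)) set \<Rightarrow> real" where
  "posterior prior \<mu> n ys A =
     enn2real ((\<integral>\<^sup>+ \<theta>. ennreal (lik n (fst \<theta>) (snd \<theta>) \<mu> ys) * indicator A \<theta> \<partial>prior)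
             / (\<integral>\<^sup>+ \<theta>. ennreal (lik n (fst \<theta>) (snd \<theta>) \<mu> ys) \<partial>prior))"

end

theory Submission
  imports Defs
begin

text \<open>
  Schwartz's argument. The evidence is bounded below through the Kullback--Leibler condition: for
  a parameter (Q, f) close to the truth one has, termwise in the sum over hidden paths,
  lik n Q f \<open>\<mu>\<close> \<open>\<ge>\<close> q (1 - \<open>\<epsilon>\<close>/q)^n exp (- \<open>\<Sum>\<close> g (Y t)) lik n Qs fs, where g is the positive part of
  the maximal log ratio, whose mean is small in every hidden state; a one-sided law of large
  numbers for \<open>\<Sum>\<close> g (Y t) then gives a lower bound exp (- \<open>\<beta>\<close> n) for every \<open>\<beta>\<close> > 0.

  The evidence of the complement is exponentially small because weak neighbourhoods can be tested
  uniformly over all transition matrices with entries at least q: a block of three consecutive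
  observations is independent of the past up to a geometrically small error once a gap of m steps
  has passed, so averages of products h1 (Y) h2 (Y') h3 (Y'') over separated blocks concentrate
  at an exponential rate around their means.

  Finally, finitely many such means determine the parameter up to relabelling. With
  O = (\<open>\<integral>\<close> \<open>\<phi>\<close> a f i) and A = O diag(\<open>\<nu>\<close>) Q, the three-block means of \<open>\<phi>\<close> a, h, \<open>\<phi>\<close> b form the matrix
  A diag(\<open>\<integral>\<close> h f) Q O^T, and comparing h with the constant function yields matrices similar to
  diag(\<open>\<integral>\<close> h f) by a conjugation that does not depend on h. Compactness of the finite-dimensional
  set of means turns this into a uniform separation.
\<close>

section \<open>Stationary law and forward recursion\<close>

text \<open>Three obstacles shape the details. The Kullback-Leibler condition bounds a signed
  integral, which can be small through cancellation, whereas termwise domination needs its positive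
  part; a Pinsker-type inequality (\<open>KL_pointwise\<close>) bounds the negative part and thereby
  the positive one. The log-likelihood of a hidden Markov model is not additive, but termwise
  domination leaves only the additive sum of g (Y t), of which just an upper bound of small slope is
  required; dyadic truncation and second moments give it for dependent data. Finally, truth and
  candidate start from different laws and the state before a block is unknown: the gap makes the law
  at the block almost independent of that state, and the separation argument treats the two block
  laws as free unknowns bounded below by q. The hidden chain is not built as a process. Expectations
  are \<open>ennreal\<close> integrals against likelihoods, so that a difference of expectations is
  always a cancellation backed by a finiteness argument.\<close>

lemma trans_mat_l1_contraction:
  fixes Q :: "real^'k::finite^'k"
  assumes Q: "trans_mat_lb q Q" and sw: "(\<Sum>i\<in>UNIV. w i) = 0"
  shows "(\<Sum>j\<in>UNIV. \<bar>\<Sum>i\<in>UNIV. w i * Q$i$j\<bar>) \<le> (1 - real CARD('k) * q) * (\<Sum>i\<in>UNIV. \<bar>w i\<bar>)"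
proof -
  have row: "(\<Sum>j\<in>UNIV. Q$i$j) = 1" for i
    using Q by (simp add: trans_mat_lb_def trans_mat_def prob_vec_def)
  \<comment> \<open>As w has total mass zero, subtracting q from every entry of column j leaves the
    sum unchanged; the remaining entries are nonnegative and each row of them sums to 1 - k q, the
    contraction factor.\<close>
  have "\<bar>\<Sum>i\<in>UNIV. w i * Q$i$j\<bar> \<le> (\<Sum>i\<in>UNIV. \<bar>w i\<bar> * (Q$i$j - q))" for j
  proof -
    have "(\<Sum>i\<in>UNIV. w i * (Q$i$j - q)) = (\<Sum>i\<in>UNIV. w i * Q$i$j) - q * (\<Sum>i\<in>UNIV. w i)"
      by (simp add: algebra_simps sum_subtractf sum_distrib_left)
    then have "(\<Sum>i\<in>UNIV. w i * Q$i$j) = (\<Sum>i\<in>UNIV. w i * (Q$i$j - q))" by (simp add: sw)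
    also have "\<bar>\<dots>\<bar> \<le> (\<Sum>i\<in>UNIV. \<bar>w i * (Q$i$j - q)\<bar>)" by (rule sum_abs)
    also have "\<dots> = (\<Sum>i\<in>UNIV. \<bar>w i\<bar> * (Q$i$j - q))"
      using Q by (intro sum.cong) (auto simp: abs_mult trans_mat_lb_def)
    finally show ?thesis .
  qed
  then have "(\<Sum>j\<in>UNIV. \<bar>\<Sum>i\<in>UNIV. w i * Q$i$j\<bar>) \<le> (\<Sum>j\<in>UNIV. \<Sum>i\<in>UNIV. \<bar>w i\<bar> * (Q$i$j - q))"
    by (intro sum_mono) auto
  also have "\<dots> = (\<Sum>i\<in>UNIV. \<bar>w i\<bar> * (1 - real CARD('k) * q))"
    by (subst sum.swap) (simp add: sum_distrib_left[symmetric] sum_subtractf row)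
  finally show ?thesis by (simp add: sum_distrib_right[symmetric] mult.commute)
qed

text \<open>The difference of two stationary laws has mass zero and is fixed by Q, which a strict
  contraction permits only for the zero vector.\<close>

lemma stationary_unique:
  fixes Q :: "real^'k::finite^'k"
  assumes Q: "trans_mat_lb q Q" and q: "q > 0"
    and a: "prob_vec a" "\<And>j. (\<Sum>i\<in>UNIV. a i * Q$i$j) = a j"
    and b: "prob_vec b" "\<And>j. (\<Sum>i\<in>UNIV. b i * Q$i$j) = b j"
  shows "a = b"
proof -
  define w where "w i = a i - b i" for i
  have "(\<Sum>i\<in>UNIV. w i) = 0"
    using a(1) b(1) by (simp add: w_def prob_vec_def sum_subtractf)
  moreover have "(\<Sum>i\<in>UNIV. w i * Q$i$j) = w j" for j
    by (simp add: w_def left_diff_distrib sum_subtractf a b)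
  ultimately have "(\<Sum>j\<in>UNIV. \<bar>w j\<bar>) \<le> (1 - real CARD('k) * q) * (\<Sum>j\<in>UNIV. \<bar>w j\<bar>)"
    using trans_mat_l1_contraction[OF Q, of w] by simp
  then have "real CARD('k) * q * (\<Sum>j\<in>UNIV. \<bar>w j\<bar>) \<le> 0" by (simp add: algebra_simps)
  moreover have "real CARD('k) * q > 0" using q by simp
  ultimately have "(\<Sum>j\<in>UNIV. \<bar>w j\<bar>) \<le> 0"
    using q by (auto simp: mult_le_0_iff)
  then have "(\<Sum>j\<in>UNIV. \<bar>w j\<bar>) = 0"
    by (meson abs_ge_zero antisym sum_nonneg)
  then have "\<forall>j. w j = 0" by (subst (asm) sum_nonneg_eq_0_iff) auto
  then show ?thesis by (auto simp: w_def)
qed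

text \<open>Brouwer's theorem on the probability simplex, which the continuous map v -> v Q sends
  into itself.\<close>

lemma stationary_exists:
  fixes Q :: "real^'k::finite^'k"
  assumes Q: "trans_mat Q"
  shows "\<exists>\<nu>. prob_vec \<nu> \<and> (\<forall>j. (\<Sum>i\<in>UNIV. \<nu> i * Q$i$j) = \<nu> j)"
proof -
  define S where "S = {v::real^'k. (\<forall>i. 0 \<le> v$i) \<and> (\<Sum>i\<in>UNIV. v$i) = 1}"
  define F where "F v = (\<chi> j. \<Sum>i\<in>UNIV. v$i * Q$i$j)" for v :: "real^'k"
  have Q0: "0 \<le> Q$i$j" and row: "(\<Sum>j\<in>UNIV. Q$i$j) = 1" for i j
    using Q by (auto simp: trans_mat_def prob_vec_def)
  have "closed S"
    unfolding S_def
    by (intro closed_Collect_conj closed_Collect_all closed_Collect_le closed_Collect_eq continuous_intros)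
  moreover have "v$i \<le> 1" if "v \<in> S" for v i
  proof -
    have "v$i \<le> (\<Sum>i\<in>UNIV. v$i)"
      using that by (intro member_le_sum) (auto simp: S_def)
    then show ?thesis using that by (simp add: S_def)
  qed
  then have "S \<subseteq> cbox 0 1"
    by (auto simp: mem_box_cart S_def)
  then have "bounded S" using bounded_cbox bounded_subset by blast
  ultimately have "compact S" by (simp add: compact_eq_bounded_closed)
  moreover have "convex S"
    unfolding convex_def S_def
    by (auto simp: sum.distrib sum_distrib_left[symmetric])
  moreover have "axis i 1 \<in> S" for i :: 'k
    by (auto simp: S_def axis_def)
  then have "S \<noteq> {}" by blast
  moreover have "continuous_on S F"
    unfolding F_def by (intro continuous_intros continuous_on_vec_lambda)
  moreover have "F \<in> S \<rightarrow> S"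
  proof
    fix v assume v: "v \<in> S"
    have "(\<Sum>j\<in>UNIV. \<Sum>i\<in>UNIV. v$i * Q$i$j) = 1"
      using v by (subst sum.swap) (simp add: sum_distrib_left[symmetric] row S_def)
    then show "F v \<in> S"
      using v by (auto simp: S_def F_def Q0 intro!: sum_nonneg mult_nonneg_nonneg)
  qed
  ultimately obtain v where v: "v \<in> S" "F v = v"
    using brouwer by metis
  have "(\<Sum>i\<in>UNIV. v$i * Q$i$j) = v$j" for j
    using v(2) by (metis F_def vec_lambda_beta)
  then show ?thesis
    using v(1) by (intro exI[of _ "\<lambda>i. v$i"]) (auto simp: prob_vec_def S_def)
qed

lemma prob_vec_stat_dist:
  fixes Q :: "real^'k::finite^'k"
  assumes "trans_mat_lb q Q" "q > 0"
  shows "prob_vec (stat_dist Q)"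
proof -
  let ?P = "\<lambda>\<nu>. prob_vec \<nu> \<and> (\<forall>j. (\<Sum>i\<in>UNIV. \<nu> i * Q$i$j) = \<nu> j)"
  have "\<exists>!\<nu>. ?P \<nu>"
    using stationary_exists[of Q] stationary_unique[OF assms] assms(1)
    unfolding trans_mat_lb_def by blast
  from theI'[OF this] show ?thesis unfolding stat_dist_def by blast
qed

text \<open>Joint density of the observations 0, ..., n - 1 and the \<^emph>\<open>next\<close> hidden state, at time n.\<close>
fun fwd :: "real^'k::finite^'k \<Rightarrow> ('k \<Rightarrow> 'y \<Rightarrow> real) \<Rightarrow> ('k \<Rightarrow> real) \<Rightarrow> nat \<Rightarrow> 'k \<Rightarrow> (nat \<Rightarrow> 'y) \<Rightarrow> real" where
  "fwd Q f \<nu> 0 x ys = \<nu> x"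
| "fwd Q f \<nu> (Suc n) x ys = (\<Sum>z\<in>UNIV. fwd Q f \<nu> n z ys * f z (ys n) * Q$z$x)"

text \<open>Induction on the last time: a path up to time m + 1 is a path up to time m extended by
  one state, and \<open>fwd\<close> peels off exactly this state. The form with \<open>Suc m\<close>
  avoids the separate treatment of the empty path in \<open>lik\<close>.\<close>

lemma fwd_Suc_eq_path_sum:
  "fwd Q f \<nu> (Suc m) z ys = (\<Sum>x\<in>PiE {..<Suc m} (\<lambda>_. UNIV).
       \<nu> (x 0) * (\<Prod>t\<in>{1..<Suc m}. Q$(x (t - 1))$(x t)) * (\<Prod>t<Suc m. f (x t) (ys t)) * Q$(x m)$z)"
proof (induction m arbitrary: z)
  case 0
  have 1: "PiE {..<Suc 0} (\<lambda>_. UNIV) = (\<lambda>a. (\<lambda>_. undefined)(0 := a)) ` (UNIV :: 'a set)"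
    by (auto simp: PiE_def extensional_def image_iff fun_eq_iff)
  have 2: "inj (\<lambda>a::'a. (\<lambda>_::nat. undefined)(0 := a))"
    by (auto simp: inj_def fun_eq_iff)
  show ?case unfolding 1 by (subst sum.reindex[OF 2]) simp
next
  case (Suc m)
  let ?W = "\<lambda>n x. \<nu> (x 0) * (\<Prod>t\<in>{1..<Suc n}. Q$(x (t - 1))$(x t)) * (\<Prod>t<Suc n. f (x t) (ys t))"
  have 1: "PiE {..<Suc (Suc m)} (\<lambda>_. UNIV) = (\<lambda>(a, x). x(Suc m := a)) ` (UNIV \<times> PiE {..<Suc m} (\<lambda>_. UNIV :: 'a set))"
    unfolding lessThan_Suc[of "Suc m"] by (rule PiE_insert_eq)
  have 2: "inj_on (\<lambda>(a, x). x(Suc m := a)) (UNIV \<times> PiE {..<Suc m} (\<lambda>_. UNIV :: 'a set))"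
    using inj_combinator[of "Suc m" "{..<Suc m}" "\<lambda>_. UNIV :: 'a set"] by simp
  have W: "?W (Suc m) (x(Suc m := a)) = ?W m x * Q$(x m)$a * f a (ys (Suc m))" for x a
  proof -
    have "(\<Prod>t\<in>{1..<Suc m}. Q$((x(Suc m := a)) (t - 1))$((x(Suc m := a)) t)) = (\<Prod>t\<in>{1..<Suc m}. Q$(x (t - 1))$(x t))"
      by (intro prod.cong) auto
    moreover have "(\<Prod>t<Suc m. f ((x(Suc m := a)) t) (ys t)) = (\<Prod>t<Suc m. f (x t) (ys t))"
      by (intro prod.cong) auto
    ultimately show ?thesis
      by (simp add: prod.atLeastLessThan_Suc lessThan_Suc mult_ac del: prod.lessThan_Suc)
  qed
  have "(\<Sum>x\<in>PiE {..<Suc (Suc m)} (\<lambda>_. UNIV). ?W (Suc m) x * Q$(x (Suc m))$z) =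
        (\<Sum>a\<in>UNIV. \<Sum>x\<in>PiE {..<Suc m} (\<lambda>_. UNIV). ?W m x * Q$(x m)$a * f a (ys (Suc m)) * Q$a$z)"
    unfolding 1 sum.reindex[OF 2] sum.cartesian_product
  proof (rule sum.cong[OF refl])
    fix p :: "'a \<times> (nat \<Rightarrow> 'a)"
    obtain a x where p: "p = (a, x)" by fastforce
    show "((\<lambda>x. ?W (Suc m) x * Q$(x (Suc m))$z) \<circ> (\<lambda>(a, x). x(Suc m := a))) p =
       (case p of (a, x) \<Rightarrow> ?W m x * Q$(x m)$a * f a (ys (Suc m)) * Q$a$z)"
      unfolding p o_def split W fun_upd_same ..
  qed
  also have "\<dots> = (\<Sum>a\<in>UNIV. fwd Q f \<nu> (Suc m) a ys * f a (ys (Suc m)) * Q$a$z)"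
    by (simp only: Suc.IH sum_distrib_right mult.assoc)
  finally show ?case by simp
qed

text \<open>\<open>fwd\<close> already contains the transition out of the last observed state, so
  summing over the next state only contributes row sums equal to 1. For n = 0 the identity is the
  total mass of \<nu>.\<close>

lemma lik_eq_sum_fwd:
  assumes "trans_mat Q" "prob_vec \<nu>"
  shows "lik n Q f \<nu> ys = (\<Sum>x\<in>UNIV. fwd Q f \<nu> n x ys)"
proof (cases n)
  case 0
  then show ?thesis using assms by (simp add: lik_def prob_vec_def)
next
  case (Suc m)
  have row: "(\<Sum>z\<in>UNIV. Q$i$z) = 1" for i
    using assms by (simp add: trans_mat_def prob_vec_def)
  show ?thesis
    unfolding Suc fwd_Suc_eq_path_sum
    by (subst sum.swap) (simp add: sum_distrib_left[symmetric] row lik_def del: prod.lessThan_Suc)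
qed

lemma fwd_nonneg:
  assumes "\<And>x. 0 \<le> \<nu> x" "\<And>i j. 0 \<le> Q$i$j" "\<And>i y. 0 \<le> f i y"
  shows "0 \<le> fwd Q f \<nu> n x ys"
  by (induction n arbitrary: x) (auto intro!: sum_nonneg mult_nonneg_nonneg assms)

lemma fwd_fun_upd: "m \<le> n \<Longrightarrow> fwd Q f \<nu> m x (ys(n := y)) = fwd Q f \<nu> m x ys"
  by (induction m arbitrary: x) auto

text \<open>All factors are nonnegative, so lower bounds for initial law, transitions and emissions
  multiply along each hidden path and survive the summation; no logarithm of a sum appears. The
  primed model is the one from which the bound is inherited: it will be the truth, with c = q and r
  = 1 - \<epsilon> / q.\<close>

lemma fwd_lower_bound:
  assumes nn: "\<And>x. 0 \<le> \<nu>' x" "\<And>i j. 0 \<le> Q'$i$j" "\<And>i y. 0 \<le> f' i y" "0 \<le> c" "0 \<le> r"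
    and \<nu>: "\<And>x. c * \<nu>' x \<le> \<nu> x" and Q: "\<And>i j. r * Q'$i$j \<le> Q$i$j"
    and f: "\<And>i t. t < n \<Longrightarrow> exp (- g (ys t)) * f' i (ys t) \<le> f i (ys t)"
  shows "c * r ^ n * exp (- (\<Sum>t<n. g (ys t))) * fwd Q' f' \<nu>' n x ys \<le> fwd Q f \<nu> n x ys"
  using f
proof (induction n arbitrary: x)
  case 0
  then show ?case using \<nu> by simp
next
  case (Suc n)
  let ?C = "c * r ^ n * exp (- (\<Sum>t<n. g (ys t)))"
  have nf: "0 \<le> fwd Q' f' \<nu>' n z ys" for z by (rule fwd_nonneg) (use nn in auto)
  have e: "exp (- (\<Sum>t<Suc n. g (ys t))) = exp (- (\<Sum>t<n. g (ys t))) * exp (- g (ys n))"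
    by (simp add: exp_add[symmetric])
  have "c * r ^ Suc n * exp (- (\<Sum>t<Suc n. g (ys t))) * fwd Q' f' \<nu>' (Suc n) x ys
      = (\<Sum>z\<in>UNIV. (?C * fwd Q' f' \<nu>' n z ys) * (exp (- g (ys n)) * f' z (ys n)) * (r * Q'$z$x))"
    by (simp add: e sum_distrib_left mult_ac del: sum.lessThan_Suc)
  also have "\<dots> \<le> (\<Sum>z\<in>UNIV. fwd Q f \<nu> n z ys * f z (ys n) * Q$z$x)"
  proof (intro sum_mono mult_mono)
    fix z
    show 1: "?C * fwd Q' f' \<nu>' n z ys \<le> fwd Q f \<nu> n z ys" by (rule Suc.IH) (use Suc.prems in auto)
    show 2: "exp (- g (ys n)) * f' z (ys n) \<le> f z (ys n)" by (rule Suc.prems) auto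
    show "r * Q'$z$x \<le> Q$z$x" by (rule Q)
    have 3: "0 \<le> ?C * fwd Q' f' \<nu>' n z ys" using nf nn by simp
    with 1 show "0 \<le> fwd Q f \<nu> n z ys" by linarith
    have 4: "0 \<le> exp (- g (ys n)) * f' z (ys n)" using nn by simp
    then show "0 \<le> exp (- g (ys n)) * f' z (ys n)" .
    from \<open>0 \<le> fwd Q f \<nu> n z ys\<close> 2 4 show "0 \<le> fwd Q f \<nu> n z ys * f z (ys n)" by simp
    show "0 \<le> r * Q'$z$x" using nn by simp
  qed
  finally show ?case by simp
qed

section \<open>Expectations under a hidden Markov model\<close>

text \<open>The m-step transition probabilities, written as a function of two states so that the row
  \<open>mpow Q m i\<close> can be used directly as an initial law.\<close>

fun mpow :: "real^'k::finite^'k \<Rightarrow> nat \<Rightarrow> 'k \<Rightarrow> 'k \<Rightarrow> real" where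
  "mpow Q 0 i j = (if i = j then 1 else 0)"
| "mpow Q (Suc m) i j = (\<Sum>z\<in>UNIV. mpow Q m i z * Q$z$j)"

lemma mpow_nonneg: "trans_mat Q \<Longrightarrow> 0 \<le> mpow Q m i j"
  by (induction m arbitrary: j) (auto simp: trans_mat_def prob_vec_def intro!: sum_nonneg)

lemma mpow_row_sum: "trans_mat Q \<Longrightarrow> (\<Sum>j\<in>UNIV. mpow Q m i j) = 1"
proof (induction m)
  case 0
  then show ?case by simp
next
  case (Suc m)
  have "(\<Sum>j\<in>UNIV. mpow Q (Suc m) i j) = (\<Sum>z\<in>UNIV. mpow Q m i z * (\<Sum>j\<in>UNIV. Q$z$j))"
    by (simp add: sum_distrib_left) (rule sum.swap)
  then show ?case using Suc by (simp add: trans_mat_def prob_vec_def)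
qed

lemma mpow_le_1: assumes "trans_mat Q" shows "mpow Q m i j \<le> 1"
proof -
  have "mpow Q m i j \<le> (\<Sum>j\<in>UNIV. mpow Q m i j)"
    by (intro member_le_sum) (auto simp: mpow_nonneg assms)
  then show ?thesis by (simp add: mpow_row_sum assms)
qed

text \<open>Whatever the state after m steps, one more step reaches j with probability at least q.
  Zero steps give no such bound, hence the \<open>Suc\<close>.\<close>

lemma mpow_lower_bound:
  assumes "trans_mat_lb q Q" shows "q \<le> mpow Q (Suc m) i j"
proof -
  have tm: "trans_mat Q" using assms by (simp add: trans_mat_lb_def)
  have "q = (\<Sum>z\<in>UNIV. mpow Q m i z * q)"
    by (simp add: sum_distrib_right[symmetric] mpow_row_sum tm)
  also have "\<dots> \<le> mpow Q (Suc m) i j"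
    unfolding mpow.simps
    by (intro sum_mono mult_left_mono mpow_nonneg tm) (use assms in \<open>simp add: trans_mat_lb_def\<close>)
  finally show ?thesis .
qed

lemma card_times_lb_le_1:
  fixes Q :: "real^'k::finite^'k"
  assumes "trans_mat_lb q Q" shows "real CARD('k) * q \<le> 1"
proof -
  fix i :: 'k
  have "real CARD('k) * q = (\<Sum>j\<in>(UNIV::'k set). q)" by simp
  also have "\<dots> \<le> (\<Sum>j\<in>UNIV. Q$i$j)"
    by (intro sum_mono) (use assms in \<open>simp add: trans_mat_lb_def\<close>)
  finally show ?thesis using assms by (simp add: trans_mat_lb_def trans_mat_def prob_vec_def)
qed

text \<open>Two rows of a stochastic matrix differ by a vector of mass zero, so each further step
  contracts their distance; the factor 2 bounds the distance of two point masses.\<close>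

lemma mpow_mixing:
  fixes Q :: "real^'k::finite^'k"
  assumes "trans_mat_lb q Q"
  shows "(\<Sum>j\<in>UNIV. \<bar>mpow Q m i j - mpow Q m i' j\<bar>) \<le> 2 * (1 - real CARD('k) * q) ^ m"
proof (induction m)
  case 0
  have "(\<Sum>j\<in>UNIV. \<bar>mpow Q 0 i j - mpow Q 0 i' j\<bar>) \<le> (\<Sum>j\<in>UNIV. \<bar>mpow Q 0 i j\<bar> + \<bar>mpow Q 0 i' j\<bar>)"
    by (intro sum_mono) linarith
  also have "\<dots> = 2" by (simp add: sum.distrib)
  finally show ?case by simp
next
  case (Suc m)
  have tm: "trans_mat Q" using assms by (simp add: trans_mat_lb_def)
  let ?w = "\<lambda>j. mpow Q m i j - mpow Q m i' j"
  have "(\<Sum>j\<in>UNIV. \<bar>mpow Q (Suc m) i j - mpow Q (Suc m) i' j\<bar>) = (\<Sum>j\<in>UNIV. \<bar>\<Sum>z\<in>UNIV. ?w z * Q$z$j\<bar>)"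
    by (simp add: left_diff_distrib sum_subtractf)
  also have "\<dots> \<le> (1 - real CARD('k) * q) * (\<Sum>j\<in>UNIV. \<bar>?w j\<bar>)"
    by (rule trans_mat_l1_contraction[OF assms]) (simp add: sum_subtractf mpow_row_sum tm)
  also have "\<dots> \<le> (1 - real CARD('k) * q) * (2 * (1 - real CARD('k) * q) ^ m)"
    using card_times_lb_le_1[OF assms] by (intro mult_left_mono Suc) auto
  finally show ?case by (simp add: mult_ac)
qed

text \<open>Points of the finite product spaces are extensional functions, while data are full
  sequences. This predicate lets one and the same functional be read on both, and on every longer
  observation window.\<close>

definition depends_below :: "nat \<Rightarrow> ((nat \<Rightarrow> 'y) \<Rightarrow> 'b) \<Rightarrow> bool" where
  "depends_below n F \<longleftrightarrow> (\<forall>ys ys'. (\<forall>t<n. ys t = ys' t) \<longrightarrow> F ys = F ys')"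

lemma depends_below_fun_upd: "depends_below n F \<Longrightarrow> n \<le> m \<Longrightarrow> F (ys(m := y)) = F ys"
  by (auto simp: depends_below_def)

lemma depends_below_restrict: "depends_below n F \<Longrightarrow> n \<le> m \<Longrightarrow> F (restrict ys {..<m}) = F ys"
  by (auto simp: depends_below_def)

lemma depends_below_measurable:
  assumes "depends_below n F" "F \<in> borel_measurable (PiM {..<n} (\<lambda>_. lam))" "n \<le> m"
  shows "F \<in> borel_measurable (PiM {..<m} (\<lambda>_. lam))"
proof -
  have "(\<lambda>ys. F (restrict ys {..<n})) \<in> borel_measurable (PiM {..<m} (\<lambda>_. lam))"
    using assms by (intro measurable_compose[OF measurable_restrict_subset]) auto
  then show ?thesis using assms(1) by (simp add: depends_below_restrict)
qed

text \<open>One locale serves both sides: the truth with its stationary law as \<nu>, and each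
  parameter in the support of the prior with the fixed initial law \<mu>.\<close>

locale hmm_model =
  fixes lam :: "'y measure" and Q :: "real^'k::finite^'k" and f :: "'k \<Rightarrow> 'y \<Rightarrow> real" and \<nu> :: "'k \<Rightarrow> real"
  assumes sigma_finite: "sigma_finite_measure lam" and trans_mat: "trans_mat Q"
    and dens: "f \<in> dens_tuples lam" and init: "prob_vec \<nu>"
begin

abbreviation obs :: "nat \<Rightarrow> (nat \<Rightarrow> 'y) measure" where
  "obs n \<equiv> PiM {..<n} (\<lambda>_. lam)"

lemma f_measurable [measurable]: "f i \<in> borel_measurable lam"
  and f_nonneg: "0 \<le> f i y"
  and f_integral: "(\<integral>\<^sup>+ y. ennreal (f i y) \<partial>lam) = 1"
  using dens by (auto simp: dens_tuples_def is_density_def)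

lemma Q_nonneg: "0 \<le> Q$i$j" and Q_row: "(\<Sum>j\<in>UNIV. Q$i$j) = 1"
  using trans_mat by (auto simp: trans_mat_def prob_vec_def)

lemma init_nonneg: "0 \<le> \<nu> i" and init_sum: "(\<Sum>i\<in>UNIV. \<nu> i) = 1"
  using init by (auto simp: prob_vec_def)

lemma fwd_nn: "0 \<le> fwd Q f \<nu> n x ys"
  by (rule fwd_nonneg) (auto simp: Q_nonneg f_nonneg init_nonneg)

lemma fwd_measurable: "n \<le> m \<Longrightarrow> fwd Q f \<nu> n x \<in> borel_measurable (obs m)"
proof (induction n arbitrary: x)
  case 0
  have "fwd Q f \<nu> 0 x = (\<lambda>_. \<nu> x)" by auto
  then show ?case by simp
next
  case (Suc n)
  have [measurable]: "fwd Q f \<nu> n z \<in> borel_measurable (obs m)" for z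
    using Suc by simp
  have [measurable]: "(\<lambda>ys. ys n) \<in> measurable (obs m) lam"
    using Suc by (intro measurable_component_singleton) auto
  have "fwd Q f \<nu> (Suc n) x = (\<lambda>ys. \<Sum>z\<in>UNIV. fwd Q f \<nu> n z ys * f z (ys n) * Q$z$x)" by auto
  then show ?case by (simp only:) measurable
qed

definition emis :: "'k \<Rightarrow> ('y \<Rightarrow> ennreal) \<Rightarrow> ennreal" where
  "emis x w = (\<integral>\<^sup>+ y. ennreal (f x y) * w y \<partial>lam)"

text \<open>With \<open>fwd\<close> as density this is the expectation of F (Y) on the event that
  the hidden state at time n is x. The Markov property enters only through recursions for these
  integrals.\<close>

definition fwd_exp :: "nat \<Rightarrow> 'k \<Rightarrow> ((nat \<Rightarrow> 'y) \<Rightarrow> ennreal) \<Rightarrow> ennreal" where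
  "fwd_exp n x F = (\<integral>\<^sup>+ ys. ennreal (fwd Q f \<nu> n x ys) * F ys \<partial>obs n)"

definition lik_exp :: "nat \<Rightarrow> ((nat \<Rightarrow> 'y) \<Rightarrow> ennreal) \<Rightarrow> ennreal" where
  "lik_exp n F = (\<integral>\<^sup>+ ys. ennreal (lik n Q f \<nu> ys) * F ys \<partial>obs n)"

lemma emis_1: "emis x (\<lambda>_. 1) = 1"
  by (simp add: emis_def f_integral)

lemma lik_eq: "lik n Q f \<nu> ys = (\<Sum>x\<in>UNIV. fwd Q f \<nu> n x ys)"
  by (rule lik_eq_sum_fwd[OF trans_mat init])

lemma lik_nonneg: "0 \<le> lik n Q f \<nu> ys"
  by (auto simp: lik_eq intro!: sum_nonneg fwd_nn)

lemma lik_measurable [measurable]: "lik n Q f \<nu> \<in> borel_measurable (obs n)"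
proof -
  have "lik n Q f \<nu> = (\<lambda>ys. \<Sum>x\<in>UNIV. fwd Q f \<nu> n x ys)" by (auto simp: lik_eq)
  moreover note fwd_measurable[of n n, measurable]
  ultimately show ?thesis by (simp only:) measurable
qed

lemma lik_exp_eq:
  assumes [measurable]: "F \<in> borel_measurable (obs n)"
  shows "lik_exp n F = (\<Sum>x\<in>UNIV. fwd_exp n x F)"
proof -
  note fwd_measurable[of n n, measurable]
  show ?thesis
    unfolding lik_exp_def fwd_exp_def
    by (subst nn_integral_sum[symmetric])
       (auto simp: lik_eq fwd_nn sum_distrib_right[symmetric])
qed

text \<open>The Markov property in integrated form: Fubini in the last coordinate turns the weight
  of observation n into its state-wise mean, and the recursion for \<open>fwd\<close> supplies the
  transition to the next state.\<close>

lemma fwd_exp_Suc: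
  assumes F: "depends_below n F" and Fm: "F \<in> borel_measurable (obs n)"
    and w [measurable]: "w \<in> borel_measurable lam"
  shows "fwd_exp (Suc n) x (\<lambda>ys. F ys * w (ys n)) = (\<Sum>z\<in>UNIV. fwd_exp n z F * emis z w * ennreal (Q$z$x))"
proof -
  interpret sigma_finite_measure lam by (rule sigma_finite)
  interpret product_sigma_finite "\<lambda>_::nat. lam" by unfold_locales
  note [measurable] = Fm depends_below_measurable[OF F Fm, of "Suc n", simplified]
    fwd_measurable[of n n, simplified] fwd_measurable[of n "Suc n", simplified]
    fwd_measurable[of "Suc n" "Suc n", simplified]
  have [measurable]: "(\<lambda>ys. ys n) \<in> measurable (obs (Suc n)) lam"
    by (intro measurable_component_singleton) auto
  let ?G = "\<lambda>ys. ennreal (fwd Q f \<nu> (Suc n) x ys) * (F ys * w (ys n))"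
  \<comment> \<open>Neither F nor \<open>fwd\<close> at time n sees coordinate n, so after
    substituting y the integrand is a finite sum of products with separated variables.\<close>
  have G: "?G (ys(n := y)) = (\<Sum>z\<in>UNIV. (ennreal (fwd Q f \<nu> n z ys) * F ys * ennreal (Q$z$x)) * (ennreal (f z y) * w y))" for ys y
    by (simp add: fwd_fun_upd depends_below_fun_upd[OF F] sum_ennreal[symmetric] ennreal_mult fwd_nn
        f_nonneg Q_nonneg sum_distrib_left mult_ac del: sum_ennreal)
  have "fwd_exp (Suc n) x (\<lambda>ys. F ys * w (ys n)) = (\<integral>\<^sup>+ ys. ?G ys \<partial>PiM (insert n {..<n}) (\<lambda>_. lam))"
    by (simp add: fwd_exp_def lessThan_Suc)
  also have "\<dots> = (\<integral>\<^sup>+ ys. (\<integral>\<^sup>+ y. ?G (ys(n := y)) \<partial>lam) \<partial>obs n)"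
  proof (rule product_nn_integral_insert)
    show "?G \<in> borel_measurable (PiM (insert n {..<n}) (\<lambda>_. lam))"
      unfolding lessThan_Suc[symmetric] by measurable
  qed auto
  also have "\<dots> = (\<integral>\<^sup>+ ys. (\<Sum>z\<in>UNIV. (ennreal (fwd Q f \<nu> n z ys) * F ys) * (emis z w * ennreal (Q$z$x))) \<partial>obs n)"
  proof (intro nn_integral_cong)
    fix ys
    show "(\<integral>\<^sup>+ y. ?G (ys(n := y)) \<partial>lam) = (\<Sum>z\<in>UNIV. (ennreal (fwd Q f \<nu> n z ys) * F ys) * (emis z w * ennreal (Q$z$x)))"
      unfolding G emis_def
      by (subst nn_integral_sum, measurable, subst nn_integral_cmult, measurable, simp add: mult_ac)
  qed
  also have "\<dots> = (\<Sum>z\<in>UNIV. fwd_exp n z F * emis z w * ennreal (Q$z$x))"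
    unfolding fwd_exp_def mult.assoc
    by (subst nn_integral_sum, measurable, subst nn_integral_multc[symmetric], measurable, simp add: mult_ac)
  finally show ?thesis .
qed

lemma lik_exp_Suc:
  assumes F: "depends_below n F" and Fm [measurable]: "F \<in> borel_measurable (obs n)"
    and w [measurable]: "w \<in> borel_measurable lam"
  shows "lik_exp (Suc n) (\<lambda>ys. F ys * w (ys n)) = (\<Sum>z\<in>UNIV. fwd_exp n z F * emis z w)"
proof -
  note [measurable] = depends_below_measurable[OF F Fm, of "Suc n", simplified]
  have [measurable]: "(\<lambda>ys. ys n) \<in> measurable (obs (Suc n)) lam"
    by (intro measurable_component_singleton) auto
  have "lik_exp (Suc n) (\<lambda>ys. F ys * w (ys n)) = (\<Sum>x\<in>UNIV. \<Sum>z\<in>UNIV. fwd_exp n z F * emis z w * ennreal (Q$z$x))"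
    by (subst lik_exp_eq) (auto simp: fwd_exp_Suc[OF F Fm w])
  also have "\<dots> = (\<Sum>z\<in>UNIV. fwd_exp n z F * emis z w * (\<Sum>x\<in>UNIV. ennreal (Q$z$x)))"
    by (subst sum.swap) (simp add: sum_distrib_left)
  finally show ?thesis by (simp add: sum_ennreal Q_nonneg Q_row)
qed

lemma fwd_exp_gap:
  assumes F: "depends_below n F" and Fm: "F \<in> borel_measurable (obs n)"
  shows "fwd_exp (n + m) x F = (\<Sum>z\<in>UNIV. fwd_exp n z F * ennreal (mpow Q m z x))"
proof (induction m arbitrary: x)
  case 0
  have "(\<Sum>z\<in>UNIV. fwd_exp n z F * ennreal (mpow Q 0 z x)) = (\<Sum>z\<in>UNIV. if z = x then fwd_exp n z F else 0)"
    by (intro sum.cong) auto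
  then show ?case by simp
next
  case (Suc m)
  have F': "depends_below (n + m) F" using F by (auto simp: depends_below_def)
  have "fwd_exp (n + Suc m) x F = (\<Sum>y\<in>UNIV. fwd_exp (n + m) y F * ennreal (Q$y$x))"
    using fwd_exp_Suc[OF F' depends_below_measurable[OF F Fm], of "\<lambda>_. 1" x] by (simp add: emis_1)
  also have "\<dots> = (\<Sum>y\<in>UNIV. \<Sum>z\<in>UNIV. fwd_exp n z F * (ennreal (mpow Q m z y) * ennreal (Q$y$x)))"
    by (simp add: Suc sum_distrib_right mult.assoc)
  also have "\<dots> = (\<Sum>z\<in>UNIV. fwd_exp n z F * (\<Sum>y\<in>UNIV. ennreal (mpow Q m z y) * ennreal (Q$y$x)))"
    by (subst sum.swap) (simp add: sum_distrib_left)
  also have "(\<lambda>z. \<Sum>y\<in>UNIV. ennreal (mpow Q m z y) * ennreal (Q$y$x)) = (\<lambda>z. ennreal (mpow Q (Suc m) z x))"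
    by (simp add: ennreal_mult[symmetric] mpow_nonneg trans_mat Q_nonneg sum_ennreal)
  finally show ?case .
qed

lemma lik_exp_gap:
  assumes F: "depends_below n F" and Fm: "F \<in> borel_measurable (obs n)" and "n \<le> m"
  shows "lik_exp m F = lik_exp n F"
proof -
  from \<open>n \<le> m\<close> obtain k where m: "m = n + k" using le_Suc_ex by blast
  note [measurable] = Fm depends_below_measurable[OF F Fm \<open>n \<le> m\<close>]
  have "lik_exp m F = (\<Sum>x\<in>UNIV. \<Sum>z\<in>UNIV. fwd_exp n z F * ennreal (mpow Q k z x))"
    using fwd_exp_gap[OF F Fm, of k] by (simp add: lik_exp_eq m[symmetric])
  also have "\<dots> = (\<Sum>z\<in>UNIV. fwd_exp n z F * (\<Sum>x\<in>UNIV. ennreal (mpow Q k z x)))"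
    by (subst sum.swap) (simp add: sum_distrib_left)
  also have "\<dots> = lik_exp n F"
    by (subst lik_exp_eq) (auto simp: sum_ennreal mpow_nonneg trans_mat mpow_row_sum)
  finally show ?thesis .
qed

lemma lik_exp_const: "lik_exp n (\<lambda>_. 1) = 1"
proof -
  interpret sigma_finite_measure lam by (rule sigma_finite)
  interpret product_sigma_finite "\<lambda>_::nat. lam" by unfold_locales
  have "lik_exp n (\<lambda>_. 1) = lik_exp 0 (\<lambda>_. 1)"
    by (rule lik_exp_gap) (auto simp: depends_below_def)
  then show ?thesis
    by (simp add: lik_exp_def lik_eq init_sum PiM_empty nn_integral_count_space_finite)
qed

end

section \<open>Concentration of block averages\<close>

text \<open>From ln (1 + x) \<ge> x - x^2 on [0, 1]. It allows the exponential moment in a Chernoff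
  bound to be replaced by a product of factors 1 + s h; these are affine, so conditional first
  moments suffice.\<close>

lemma exp_minus_square_le_one_plus:
  fixes s h :: real
  assumes "0 \<le> s" "s \<le> 1" "0 \<le> h" "h \<le> 1"
  shows "exp (s * h - s\<^sup>2) \<le> 1 + s * h"
proof -
  have sh: "0 \<le> s * h" "s * h \<le> 1" using assms by (auto simp: mult_le_one)
  have "(s * h)\<^sup>2 \<le> s\<^sup>2"
    using assms by (intro power_mono) (auto simp: mult_left_le)
  then have "s * h - s\<^sup>2 \<le> s * h - (s * h)\<^sup>2" by simp
  also have "\<dots> \<le> ln (1 + s * h)" using sh by (intro ln_one_plus_pos_lower_bound)
  finally have "exp (s * h - s\<^sup>2) \<le> exp (ln (1 + s * h))" by simp
  then show ?thesis using sh by simp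
qed

text \<open>A Chernoff bound for dependent variables. The hypothesis \<open>cond\<close> bounds the
  mean of H j under the weight built from the earlier variables by \<tau>, which is exactly what the
  induction over the product consumes.\<close>

lemma emeasure_sum_ge_exp_bound:
  fixes P :: "'a measure" and H :: "nat \<Rightarrow> 'a \<Rightarrow> real"
  assumes P: "emeasure P (space P) \<le> 1"
    and H [measurable]: "\<And>j. j < N \<Longrightarrow> H j \<in> borel_measurable P"
    and H01: "\<And>j x. 0 \<le> H j x" "\<And>j x. H j x \<le> 1"
    and \<eta>: "0 < \<eta>" "\<eta> \<le> 1" and \<tau>: "0 \<le> \<tau>"
    and cond: "\<And>j. j < N \<Longrightarrow>
       (\<integral>\<^sup>+ x. ennreal (\<Prod>i<j. 1 + \<eta> / 2 * H i x) * ennreal (H j x) \<partial>P) \<le> ennreal \<tau> * (\<integral>\<^sup>+ x. ennreal (\<Prod>i<j. 1 + \<eta> / 2 * H i x) \<partial>P)"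
  shows "emeasure P {x\<in>space P. real N * (\<tau> + \<eta>) \<le> (\<Sum>j<N. H j x)} \<le> ennreal (exp (- real N * \<eta>\<^sup>2 / 4))"
proof -
  \<comment> \<open>This s minimises - s \<eta> + s^2, whose value - \<eta>^2 / 4 is the exponent
    per summand.\<close>
  define s where "s = \<eta> / 2"
  have s: "0 \<le> s" "s \<le> 1" using \<eta> by (auto simp: s_def)
  let ?F = "\<lambda>j x. \<Prod>i<j. 1 + s * H i x"
  have F0: "0 \<le> ?F j x" for j x
    by (intro prod_nonneg) (auto simp: s H01)
  have meas: "?F j \<in> borel_measurable P" if "j \<le> N" for j
    using that
    by (intro borel_measurable_prod borel_measurable_add borel_measurable_times borel_measurable_const H) auto
  have EF: "(\<integral>\<^sup>+ x. ennreal (?F j x) \<partial>P) \<le> ennreal (exp (s * \<tau>) ^ j)" if "j \<le> N" for j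
    using that
  proof (induction j)
    case 0
    then show ?case using P by simp
  next
    case (Suc j)
    note [measurable] = meas[of j] H[of j]
    have "(\<integral>\<^sup>+ x. ennreal (?F (Suc j) x) \<partial>P) = (\<integral>\<^sup>+ x. ennreal (?F j x) + ennreal s * (ennreal (?F j x) * ennreal (H j x)) \<partial>P)"
      by (intro nn_integral_cong)
         (simp add: ennreal_mult[symmetric] ennreal_plus[symmetric] F0 H01 s algebra_simps del: ennreal_plus)
    also have "\<dots> = (\<integral>\<^sup>+ x. ennreal (?F j x) \<partial>P) + ennreal s * (\<integral>\<^sup>+ x. ennreal (?F j x) * ennreal (H j x) \<partial>P)"
      using Suc.prems by (subst nn_integral_add) (auto simp: nn_integral_cmult)
    also have "\<dots> \<le> (\<integral>\<^sup>+ x. ennreal (?F j x) \<partial>P) + ennreal s * (ennreal \<tau> * (\<integral>\<^sup>+ x. ennreal (?F j x) \<partial>P))"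
      using cond[of j] Suc.prems by (intro add_left_mono mult_left_mono) (auto simp: s_def)
    also have "\<dots> = ennreal (1 + s * \<tau>) * (\<integral>\<^sup>+ x. ennreal (?F j x) \<partial>P)"
      using s \<tau> by (simp add: ennreal_mult ennreal_plus distrib_right mult.assoc)
    also have "\<dots> \<le> ennreal (exp (s * \<tau>)) * ennreal (exp (s * \<tau>) ^ j)"
      using Suc by (intro mult_mono ennreal_leI) (auto simp: exp_ge_add_one_self)
    finally show ?case by (simp add: ennreal_mult[symmetric])
  qed
  note [measurable] = meas[of N, simplified]
  \<comment> \<open>Markov's inequality: on the event in question \<open>?c\<close> times the
    product is at least 1.\<close>
  let ?c = "exp (- (s * (real N * (\<tau> + \<eta>))) + real N * s\<^sup>2)"
  have "emeasure P {x\<in>space P. real N * (\<tau> + \<eta>) \<le> (\<Sum>j<N. H j x)} = (\<integral>\<^sup>+ x. indicator {x\<in>space P. real N * (\<tau> + \<eta>) \<le> (\<Sum>j<N. H j x)} x \<partial>P)"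
    by (intro nn_integral_indicator[symmetric]) measurable
  also have "\<dots> \<le> (\<integral>\<^sup>+ x. ennreal ?c * ennreal (?F N x) \<partial>P)"
  proof (intro nn_integral_mono)
    fix x
    have "exp (\<Sum>j<N. s * H j x - s\<^sup>2) \<le> ?F N x"
      unfolding exp_sum[OF finite_lessThan]
      by (intro prod_mono) (auto intro!: exp_minus_square_le_one_plus s H01)
    then have *: "exp (s * (\<Sum>j<N. H j x) - real N * s\<^sup>2) \<le> ?F N x"
      by (simp add: sum_subtractf sum_distrib_left)
    have "1 \<le> ?c * ?F N x" if "real N * (\<tau> + \<eta>) \<le> (\<Sum>j<N. H j x)"
    proof -
      have "s * (real N * (\<tau> + \<eta>)) \<le> s * (\<Sum>j<N. H j x)" using that s by (intro mult_left_mono)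
      then have "1 \<le> ?c * exp (s * (\<Sum>j<N. H j x) - real N * s\<^sup>2)"
        by (simp add: exp_add[symmetric])
      also have "\<dots> \<le> ?c * ?F N x" using * by (intro mult_left_mono) auto
      finally show ?thesis .
    qed
    then show "indicator {x\<in>space P. real N * (\<tau> + \<eta>) \<le> (\<Sum>j<N. H j x)} x \<le> ennreal ?c * ennreal (?F N x)"
      by (auto simp: indicator_def ennreal_mult[symmetric] F0)
  qed
  also have "\<dots> = ennreal ?c * (\<integral>\<^sup>+ x. ennreal (?F N x) \<partial>P)" by (subst nn_integral_cmult) auto
  also have "\<dots> \<le> ennreal ?c * ennreal (exp (s * \<tau>) ^ N)" by (intro mult_left_mono EF) auto
  also have "\<dots> = ennreal (exp (- real N * \<eta>\<^sup>2 / 4))"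
    by (simp add: ennreal_mult[symmetric] exp_of_nat_mult[symmetric] exp_add[symmetric] s_def power2_eq_square field_simps)
  finally show ?thesis .
qed

section \<open>State-wise means and blocks of three observations\<close>

definition emis_mean :: "'y measure \<Rightarrow> ('k \<Rightarrow> 'y \<Rightarrow> real) \<Rightarrow> ('y \<Rightarrow> real) \<Rightarrow> 'k \<Rightarrow> real" where
  "emis_mean lam f h x = enn2real (\<integral>\<^sup>+ y. ennreal (f x y) * ennreal (h y) \<partial>lam)"

text \<open>Expectation of h1 (Y 1) * h2 (Y 2) * h3 (Y 3) for the initial law \<open>\<nu>\<close>, with the emission
  densities entering only through the state-wise means v1, v2, v3 of h1, h2, h3.\<close>
definition tri_mean :: "real^'k::finite^'k \<Rightarrow> ('k \<Rightarrow> real) \<Rightarrow> ('k \<Rightarrow> real) \<Rightarrow> ('k \<Rightarrow> real) \<Rightarrow> ('k \<Rightarrow> real) \<Rightarrow> real" where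
  "tri_mean Q \<nu> v1 v2 v3 = (\<Sum>x\<in>UNIV. \<nu> x * (v1 x * (\<Sum>y\<in>UNIV. Q$x$y * (v2 y * (\<Sum>z\<in>UNIV. Q$y$z * v3 z)))))"

text \<open>The j-th block has length m + 3: a gap of m unused observations precedes the three that enter.\<close>
definition blk :: "nat \<Rightarrow> ('y \<Rightarrow> real) \<Rightarrow> ('y \<Rightarrow> real) \<Rightarrow> ('y \<Rightarrow> real) \<Rightarrow> nat \<Rightarrow> (nat \<Rightarrow> 'y) \<Rightarrow> real" where
  "blk m h1 h2 h3 j ys = h1 (ys (j * (m + 3) + m)) * h2 (ys (j * (m + 3) + m + 1)) * h3 (ys (j * (m + 3) + m + 2))"

lemma average_in_unit_interval:
  fixes p v :: "'k::finite \<Rightarrow> real"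
  assumes "prob_vec p" "\<And>x. 0 \<le> v x" "\<And>x. v x \<le> 1"
  shows "0 \<le> (\<Sum>x\<in>UNIV. p x * v x)" "(\<Sum>x\<in>UNIV. p x * v x) \<le> 1"
proof -
  show "0 \<le> (\<Sum>x\<in>UNIV. p x * v x)" using assms by (intro sum_nonneg) (auto simp: prob_vec_def)
  have "(\<Sum>x\<in>UNIV. p x * v x) \<le> (\<Sum>x\<in>UNIV. p x * 1)"
    using assms by (intro sum_mono mult_left_mono) (auto simp: prob_vec_def)
  then show "(\<Sum>x\<in>UNIV. p x * v x) \<le> 1" using assms by (simp add: prob_vec_def)
qed

lemma tri_kernel_unit:
  assumes "trans_mat Q" and v: "\<And>x. 0 \<le> v1 x" "\<And>x. v1 x \<le> 1" "\<And>x. 0 \<le> v2 x" "\<And>x. v2 x \<le> 1"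
    "\<And>x. 0 \<le> v3 x" "\<And>x. v3 x \<le> 1"
  shows "0 \<le> v1 x * (\<Sum>y\<in>UNIV. Q$x$y * (v2 y * (\<Sum>z\<in>UNIV. Q$y$z * v3 z)))"
    "v1 x * (\<Sum>y\<in>UNIV. Q$x$y * (v2 y * (\<Sum>z\<in>UNIV. Q$y$z * v3 z))) \<le> 1"
proof -
  have pv: "prob_vec (\<lambda>y. Q$x$y)" for x using assms(1) by (simp add: trans_mat_def)
  note a = average_in_unit_interval[OF pv]
  have 3: "0 \<le> (\<Sum>z\<in>UNIV. Q$y$z * v3 z)" "(\<Sum>z\<in>UNIV. Q$y$z * v3 z) \<le> 1" for y by (rule a; rule v)+
  have 4: "0 \<le> v2 y * (\<Sum>z\<in>UNIV. Q$y$z * v3 z)" "v2 y * (\<Sum>z\<in>UNIV. Q$y$z * v3 z) \<le> 1" for y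
    using 3 v by (auto intro: mult_le_one)
  have 2: "0 \<le> (\<Sum>y\<in>UNIV. Q$x$y * (v2 y * (\<Sum>z\<in>UNIV. Q$y$z * v3 z)))"
    "(\<Sum>y\<in>UNIV. Q$x$y * (v2 y * (\<Sum>z\<in>UNIV. Q$y$z * v3 z))) \<le> 1"
    by (rule a; rule 4)+
  show "0 \<le> v1 x * (\<Sum>y\<in>UNIV. Q$x$y * (v2 y * (\<Sum>z\<in>UNIV. Q$y$z * v3 z)))"
    "v1 x * (\<Sum>y\<in>UNIV. Q$x$y * (v2 y * (\<Sum>z\<in>UNIV. Q$y$z * v3 z))) \<le> 1"
    using 2 v by (auto intro: mult_le_one)
qed

text \<open>As a function of the initial law the block mean is linear with coefficients in [0, 1],
  so it varies by at most the l1 distance of the two rows.\<close>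

lemma tri_mean_mixing:
  fixes Q :: "real^'k::finite^'k"
  assumes lb: "trans_mat_lb q Q" and v: "\<And>x. 0 \<le> v1 x" "\<And>x. v1 x \<le> 1" "\<And>x. 0 \<le> v2 x" "\<And>x. v2 x \<le> 1"
    "\<And>x. 0 \<le> v3 x" "\<And>x. v3 x \<le> 1"
  shows "\<bar>tri_mean Q (mpow Q m i) v1 v2 v3 - tri_mean Q (mpow Q m i') v1 v2 v3\<bar> \<le> 2 * (1 - real CARD('k) * q) ^ m"
proof -
  let ?k = "\<lambda>x. v1 x * (\<Sum>y\<in>UNIV. Q$x$y * (v2 y * (\<Sum>z\<in>UNIV. Q$y$z * v3 z)))"
  have tm: "trans_mat Q" using lb by (simp add: trans_mat_lb_def)
  have k: "0 \<le> ?k x" "?k x \<le> 1" for x by (rule tri_kernel_unit[OF tm]; rule v)+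
  have "tri_mean Q (mpow Q m i) v1 v2 v3 - tri_mean Q (mpow Q m i') v1 v2 v3 = (\<Sum>x\<in>UNIV. (mpow Q m i x - mpow Q m i' x) * ?k x)"
    by (simp add: tri_mean_def sum_subtractf left_diff_distrib)
  also have "\<bar>\<dots>\<bar> \<le> (\<Sum>x\<in>UNIV. \<bar>(mpow Q m i x - mpow Q m i' x) * ?k x\<bar>)" by (rule sum_abs)
  also have "\<dots> \<le> (\<Sum>x\<in>UNIV. \<bar>mpow Q m i x - mpow Q m i' x\<bar>)"
  proof (rule sum_mono)
    fix x
    have "\<bar>(mpow Q m i x - mpow Q m i' x) * ?k x\<bar> = \<bar>mpow Q m i x - mpow Q m i' x\<bar> * ?k x"
      unfolding abs_mult[of _ "?k x"] using k(1)[of x] by (simp only: abs_of_nonneg)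
    also have "\<dots> \<le> \<bar>mpow Q m i x - mpow Q m i' x\<bar>" by (rule mult_left_le) (use k in auto)
    finally show "\<bar>(mpow Q m i x - mpow Q m i' x) * ?k x\<bar> \<le> \<bar>mpow Q m i x - mpow Q m i' x\<bar>" .
  qed
  also have "\<dots> \<le> 2 * (1 - real CARD('k) * q) ^ m" by (rule mpow_mixing[OF lb])
  finally show ?thesis .
qed

lemma blk_unit:
  assumes "\<And>y. 0 \<le> h1 y" "\<And>y. h1 y \<le> 1" "\<And>y. 0 \<le> h2 y" "\<And>y. h2 y \<le> 1" "\<And>y. 0 \<le> h3 y" "\<And>y. h3 y \<le> 1"
  shows "0 \<le> blk m h1 h2 h3 j ys" "blk m h1 h2 h3 j ys \<le> 1"
  unfolding blk_def using assms by (auto intro!: mult_le_one)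

lemma blk_measurable:
  assumes [measurable]: "h1 \<in> borel_measurable lam" "h2 \<in> borel_measurable lam" "h3 \<in> borel_measurable lam"
    and "Suc j * (m + 3) \<le> n"
  shows "blk m h1 h2 h3 j \<in> borel_measurable (PiM {..<n} (\<lambda>_. lam))"
proof -
  have [measurable]: "(\<lambda>ys. ys (j * (m + 3) + m)) \<in> measurable (PiM {..<n} (\<lambda>_. lam)) lam"
    "(\<lambda>ys. ys (j * (m + 3) + m + 1)) \<in> measurable (PiM {..<n} (\<lambda>_. lam)) lam"
    "(\<lambda>ys. ys (j * (m + 3) + m + 2)) \<in> measurable (PiM {..<n} (\<lambda>_. lam)) lam"
    by (rule measurable_component_singleton; use assms(4) in simp)+
  show ?thesis unfolding blk_def by measurable
qed

lemma blk_depends_below: "Suc j * (m + 3) \<le> n \<Longrightarrow> depends_below n (blk m h1 h2 h3 j)"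
  by (auto simp: depends_below_def blk_def)

context hmm_model
begin

lemma emis_mean:
  assumes "\<And>y. h y \<le> 1"
  shows "emis x (\<lambda>y. ennreal (h y)) = ennreal (emis_mean lam f h x)" "0 \<le> emis_mean lam f h x" "emis_mean lam f h x \<le> 1"
proof -
  have "emis x (\<lambda>y. ennreal (h y)) \<le> (\<integral>\<^sup>+ y. ennreal (f x y) * 1 \<partial>lam)"
    unfolding emis_def using assms by (intro nn_integral_mono mult_left_mono) (auto simp: ennreal_le_1)
  then have le: "emis x (\<lambda>y. ennreal (h y)) \<le> 1" by (simp add: f_integral)
  then have "emis x (\<lambda>y. ennreal (h y)) < top" using ennreal_one_less_top le_less_trans by blast
  then show eq: "emis x (\<lambda>y. ennreal (h y)) = ennreal (emis_mean lam f h x)"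
    by (simp add: emis_mean_def emis_def)
  show "0 \<le> emis_mean lam f h x" by (simp add: emis_mean_def)
  show "emis_mean lam f h x \<le> 1" using le unfolding eq by simp
qed

lemma lik_exp_blk_eq:
  assumes F: "depends_below (j * (m + 3)) F" and Fm [measurable]: "F \<in> borel_measurable (obs (j * (m + 3)))"
    and h [measurable]: "h1 \<in> borel_measurable lam" "h2 \<in> borel_measurable lam" "h3 \<in> borel_measurable lam"
    and h01: "\<And>y. 0 \<le> h1 y" "\<And>y. h1 y \<le> 1" "\<And>y. 0 \<le> h2 y" "\<And>y. h2 y \<le> 1" "\<And>y. 0 \<le> h3 y" "\<And>y. h3 y \<le> 1"
    and n: "Suc j * (m + 3) \<le> n"
  shows "lik_exp n (\<lambda>ys. F ys * ennreal (blk m h1 h2 h3 j ys)) =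
    (\<Sum>z\<in>UNIV. fwd_exp (j * (m + 3)) z F *
       ennreal (tri_mean Q (mpow Q m z) (emis_mean lam f h1) (emis_mean lam f h2) (emis_mean lam f h3)))"
proof -
  define b where "b = j * (m + 3)"
  define p where "p = b + m"
  let ?v1 = "emis_mean lam f h1" and ?v2 = "emis_mean lam f h2" and ?v3 = "emis_mean lam f h3"
  let ?t = "\<lambda>x y z. fwd_exp (j * (m + 3) + m) x F * (ennreal (?v1 x) * (ennreal (Q$x$y) * (ennreal (?v2 y) * (ennreal (Q$y$z) * ennreal (?v3 z)))))"
  note e1 = emis_mean[of h1, OF h01(2)] and e2 = emis_mean[of h2, OF h01(4)] and e3 = emis_mean[of h3, OF h01(6)]
  \<comment> \<open>Each of these functionals adds one observation, so that the latest one can be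
    integrated out, from right to left.\<close>
  define F1 where "F1 ys = F ys * ennreal (h1 (ys p))" for ys
  define F2 where "F2 ys = F1 ys * ennreal (h2 (ys (Suc p)))" for ys
  define F3 where "F3 ys = F2 ys * ennreal (h3 (ys (Suc (Suc p))))" for ys
  have d0: "depends_below p F" using F by (auto simp: depends_below_def p_def b_def)
  have d1: "depends_below (Suc p) F1" using d0 unfolding depends_below_def F1_def by (metis less_Suc_eq)
  have d2: "depends_below (Suc (Suc p)) F2" using d1 unfolding depends_below_def F2_def by (metis less_Suc_eq)
  have d3: "depends_below (Suc (Suc (Suc p))) F3" using d2 unfolding depends_below_def F3_def by (metis less_Suc_eq)
  have comp [measurable]: "(\<lambda>ys. ys t) \<in> measurable (obs u) lam" if "t < u" for t u :: nat
    using that by (intro measurable_component_singleton) auto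
  have m0: "F \<in> borel_measurable (obs u)" if "b \<le> u" for u
    by (rule depends_below_measurable[OF F[folded b_def] Fm[folded b_def] that])
  have m1: "F1 \<in> borel_measurable (obs u)" if "p < u" for u
    unfolding F1_def using that m0[of u] by (auto simp: p_def)
  have m2: "F2 \<in> borel_measurable (obs u)" if "Suc p < u" for u
    unfolding F2_def using that m1[of u] by auto
  have m3: "F3 \<in> borel_measurable (obs u)" if "Suc (Suc p) < u" for u
    unfolding F3_def using that m2[of u] by auto
  have "(\<lambda>ys. F ys * ennreal (blk m h1 h2 h3 j ys)) = F3"
    by (rule ext) (simp add: F3_def F2_def F1_def blk_def p_def b_def ennreal_mult h01 mult.assoc numeral_2_eq_2)
  then have "lik_exp n (\<lambda>ys. F ys * ennreal (blk m h1 h2 h3 j ys)) = lik_exp n F3" by simp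
  also have "\<dots> = lik_exp (Suc (Suc (Suc p))) F3"
    by (rule lik_exp_gap[OF d3 m3]) (use n in \<open>auto simp: p_def b_def\<close>)
  also have "\<dots> = (\<Sum>z\<in>UNIV. fwd_exp (Suc (Suc p)) z F2 * ennreal (?v3 z))"
    unfolding F3_def by (subst lik_exp_Suc[OF d2 m2]) (auto simp: e3)
  also have "\<dots> = (\<Sum>z\<in>UNIV. (\<Sum>y\<in>UNIV. fwd_exp (Suc p) y F1 * ennreal (?v2 y) * ennreal (Q$y$z)) * ennreal (?v3 z))"
    unfolding F2_def by (subst fwd_exp_Suc[OF d1 m1]) (auto simp: e2)
  also have "\<dots> = (\<Sum>z\<in>UNIV. (\<Sum>y\<in>UNIV. (\<Sum>x\<in>UNIV. fwd_exp p x F * ennreal (?v1 x) * ennreal (Q$x$y)) * ennreal (?v2 y) * ennreal (Q$y$z)) * ennreal (?v3 z))"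
    unfolding F1_def by (subst fwd_exp_Suc[OF d0 m0]) (auto simp: e1 p_def)
  also have "\<dots> = (\<Sum>z\<in>UNIV. \<Sum>y\<in>UNIV. \<Sum>x\<in>UNIV. ?t x y z)"
    by (simp add: sum_distrib_right mult.assoc p_def b_def)
  \<comment> \<open>Peeling has produced the states in the order z, y, x; \<open>tri_mean\<close>
    nests them in the order of time.\<close>
  also have "\<dots> = (\<Sum>y\<in>UNIV. \<Sum>z\<in>UNIV. \<Sum>x\<in>UNIV. ?t x y z)"
    by (rule sum.swap)
  also have "\<dots> = (\<Sum>y\<in>UNIV. \<Sum>x\<in>UNIV. \<Sum>z\<in>UNIV. ?t x y z)"
    by (intro sum.cong refl sum.swap)
  also have "\<dots> = (\<Sum>x\<in>UNIV. \<Sum>y\<in>UNIV. \<Sum>z\<in>UNIV. ?t x y z)"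
    by (rule sum.swap)
  also have "\<dots> = (\<Sum>x\<in>UNIV. fwd_exp p x F * (ennreal (?v1 x) * (\<Sum>y\<in>UNIV. ennreal (Q$x$y) * (ennreal (?v2 y) * (\<Sum>z\<in>UNIV. ennreal (Q$y$z) * ennreal (?v3 z))))))"
    by (simp add: sum_distrib_left p_def b_def)
  also have "\<dots> = (\<Sum>x\<in>UNIV. fwd_exp p x F * ennreal (?v1 x * (\<Sum>y\<in>UNIV. Q$x$y * (?v2 y * (\<Sum>z\<in>UNIV. Q$y$z * ?v3 z)))))" (is "_ = (\<Sum>x\<in>UNIV. _ * ennreal (?k x))")
    by (simp add: ennreal_mult[symmetric] Q_nonneg e1 e2 e3 sum_nonneg)
  also have "\<dots> = (\<Sum>x\<in>UNIV. \<Sum>z\<in>UNIV. fwd_exp b z F * (ennreal (mpow Q m z x) * ennreal (?k x)))"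
    unfolding p_def by (subst fwd_exp_gap[OF F[folded b_def] Fm[folded b_def]]) (simp add: sum_distrib_right mult.assoc)
  also have "\<dots> = (\<Sum>z\<in>UNIV. fwd_exp b z F * (\<Sum>x\<in>UNIV. ennreal (mpow Q m z x) * ennreal (?k x)))"
    by (subst sum.swap) (simp add: sum_distrib_left)
  also have "\<dots> = (\<Sum>z\<in>UNIV. fwd_exp b z F * ennreal (tri_mean Q (mpow Q m z) ?v1 ?v2 ?v3))"
    by (simp add: ennreal_mult[symmetric] Q_nonneg e1 e2 e3 sum_nonneg mpow_nonneg trans_mat tri_mean_def)
  finally show ?thesis by (simp add: b_def)
qed

text \<open>By mixing, the block mean for any start state z is within \<epsilon> of the one for the
  fixed state i, which can then be pulled out of the sum over z. If T < \<epsilon>,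
  \<open>ennreal (T - \<epsilon>)\<close> is 0 and the lower bound is trivial.\<close>

lemma lik_exp_blk_bounds:
  assumes F: "depends_below (j * (m + 3)) F" and Fm [measurable]: "F \<in> borel_measurable (obs (j * (m + 3)))"
    and h [measurable]: "h1 \<in> borel_measurable lam" "h2 \<in> borel_measurable lam" "h3 \<in> borel_measurable lam"
    and h01: "\<And>y. 0 \<le> h1 y" "\<And>y. h1 y \<le> 1" "\<And>y. 0 \<le> h2 y" "\<And>y. h2 y \<le> 1" "\<And>y. 0 \<le> h3 y" "\<And>y. h3 y \<le> 1"
    and n: "Suc j * (m + 3) \<le> n" and lb: "trans_mat_lb q Q"
    and T: "T = tri_mean Q (mpow Q m i) (emis_mean lam f h1) (emis_mean lam f h2) (emis_mean lam f h3)"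
    and \<epsilon>: "2 * (1 - real CARD('k) * q) ^ m \<le> \<epsilon>"
  shows "lik_exp n (\<lambda>ys. F ys * ennreal (blk m h1 h2 h3 j ys)) \<le> ennreal (T + \<epsilon>) * lik_exp n F"
    "ennreal (T - \<epsilon>) * lik_exp n F \<le> lik_exp n (\<lambda>ys. F ys * ennreal (blk m h1 h2 h3 j ys))"
proof -
  let ?T = "\<lambda>z. tri_mean Q (mpow Q m z) (emis_mean lam f h1) (emis_mean lam f h2) (emis_mean lam f h3)"
  have "lik_exp n F = lik_exp (j * (m + 3)) F"
    by (rule lik_exp_gap[OF F Fm]) (use n in simp)
  also have "\<dots> = (\<Sum>z\<in>UNIV. fwd_exp (j * (m + 3)) z F)" by (rule lik_exp_eq[OF Fm])
  finally have eq: "lik_exp n F = (\<Sum>z\<in>UNIV. fwd_exp (j * (m + 3)) z F)" .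
  have "\<bar>?T z - T\<bar> \<le> \<epsilon>" for z
    unfolding T by (rule order_trans[OF tri_mean_mixing[OF lb] \<epsilon>]; intro emis_mean h01)
  then have b: "T - \<epsilon> \<le> ?T z" "?T z \<le> T + \<epsilon>" for z
    by (metis abs_diff_le_iff)+
  note e = lik_exp_blk_eq[OF F Fm h h01 n]
  show "lik_exp n (\<lambda>ys. F ys * ennreal (blk m h1 h2 h3 j ys)) \<le> ennreal (T + \<epsilon>) * lik_exp n F"
    unfolding e eq sum_distrib_left
    by (subst mult.commute, intro sum_mono mult_right_mono ennreal_leI b) auto
  show "ennreal (T - \<epsilon>) * lik_exp n F \<le> lik_exp n (\<lambda>ys. F ys * ennreal (blk m h1 h2 h3 j ys))"
    unfolding e eq sum_distrib_left
    by (subst (2) mult.commute, intro sum_mono mult_right_mono ennreal_leI b) auto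
qed

definition law :: "nat \<Rightarrow> (nat \<Rightarrow> 'y) measure" where
  "law n = density (obs n) (\<lambda>ys. ennreal (lik n Q f \<nu> ys))"

lemma sets_law [measurable_cong]: "sets (law n) = sets (obs n)"
  and space_law: "space (law n) = space (obs n)"
  by (auto simp: law_def)

lemma nn_integral_law:
  "F \<in> borel_measurable (obs n) \<Longrightarrow> (\<integral>\<^sup>+ ys. F ys \<partial>law n) = lik_exp n F"
  unfolding law_def lik_exp_def by (subst nn_integral_density) auto

lemma emeasure_law_space: "emeasure (law n) (space (law n)) = 1"
  using nn_integral_law[of "\<lambda>_. 1" n] lik_exp_const[of n] by simp

text \<open>Of the margin 2 \<eta>, one \<eta> pays for the mixing error and the other is the slack
  of the Chernoff bound. The lower tail is the upper tail of 1 - \<open>blk\<close>.\<close>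

lemma blk_sum_deviation:
  assumes h [measurable]: "h1 \<in> borel_measurable lam" "h2 \<in> borel_measurable lam" "h3 \<in> borel_measurable lam"
    and h01: "\<And>y. 0 \<le> h1 y" "\<And>y. h1 y \<le> 1" "\<And>y. 0 \<le> h2 y" "\<And>y. h2 y \<le> 1" "\<And>y. 0 \<le> h3 y" "\<And>y. h3 y \<le> 1"
    and n: "N * (m + 3) \<le> n" and lb: "trans_mat_lb q Q"
    and T: "T = tri_mean Q (mpow Q m i) (emis_mean lam f h1) (emis_mean lam f h2) (emis_mean lam f h3)"
    and \<eta>: "0 < \<eta>" "\<eta> \<le> 1" and \<epsilon>: "2 * (1 - real CARD('k) * q) ^ m \<le> \<eta>"
  shows "emeasure (law n) {ys\<in>space (law n). real N * (T + 2 * \<eta>) \<le> (\<Sum>j<N. blk m h1 h2 h3 j ys)} \<le> ennreal (exp (- real N * \<eta>\<^sup>2 / 4))"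
    "emeasure (law n) {ys\<in>space (law n). (\<Sum>j<N. blk m h1 h2 h3 j ys) \<le> real N * (T - 2 * \<eta>)} \<le> ennreal (exp (- real N * \<eta>\<^sup>2 / 4))"
proof -
  let ?H = "blk m h1 h2 h3"
  have H01: "0 \<le> ?H j ys" "?H j ys \<le> 1" for j ys by (rule blk_unit; rule h01)+
  have le: "Suc j * (m + 3) \<le> n" if "j < N" for j
  proof -
    have "Suc j * (m + 3) \<le> N * (m + 3)" using that by (intro mult_le_mono1) simp
    then show ?thesis using n by simp
  qed
  have Hm: "?H j \<in> borel_measurable (obs n)" if "j < N" for j
    by (rule blk_measurable[OF h le[OF that]])
  have H'm: "?H j \<in> borel_measurable (PiM {..<N'} (\<lambda>_. lam))" if "Suc j * (m + 3) \<le> N'" for j N'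
    by (rule blk_measurable[OF h that])
  have T01: "0 \<le> T" "T \<le> 1"
  proof -
    have pv: "prob_vec (mpow Q m i)" by (simp add: prob_vec_def mpow_nonneg mpow_row_sum trans_mat)
    show "0 \<le> T" "T \<le> 1"
      unfolding T tri_mean_def
      by (rule average_in_unit_interval[OF pv]; rule tri_kernel_unit[OF trans_mat]; intro emis_mean h01)+
  qed
  \<comment> \<open>The weights for both tails are products over a transformed block variable: u is
    the identity for the upper tail and 1 - x for the lower one.\<close>
  have u0: "(\<lambda>x::real. x) \<in> borel_measurable borel" and u1: "(\<lambda>x::real. 1 - x) \<in> borel_measurable borel"
    by simp_all
  have dep: "depends_below (j * (m + 3)) (\<lambda>ys. ennreal (\<Prod>i<j. 1 + \<eta> / 2 * u (?H i ys)))" for u j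
    using blk_depends_below[of _ m "j * (m + 3)" h1 h2 h3]
    unfolding depends_below_def
    by (intro allI impI arg_cong[of _ _ ennreal] prod.cong refl)
       (metis Suc_leI lessThan_iff mult_le_mono1)
  have meas: "(\<lambda>ys. ennreal (\<Prod>i<j. 1 + \<eta> / 2 * u (?H i ys))) \<in> borel_measurable (obs (j * (m + 3)))"
    if [measurable]: "u \<in> borel_measurable borel" for u j
    by (intro measurable_compose[OF _ measurable_ennreal] borel_measurable_prod borel_measurable_add
        borel_measurable_times borel_measurable_const measurable_compose[OF H'm that] mult_le_mono1) auto
  show "emeasure (law n) {ys\<in>space (law n). real N * (T + 2 * \<eta>) \<le> (\<Sum>j<N. ?H j ys)} \<le> ennreal (exp (- real N * \<eta>\<^sup>2 / 4))"
  proof -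
    have "emeasure (law n) {ys\<in>space (law n). real N * ((T + \<eta>) + \<eta>) \<le> (\<Sum>j<N. ?H j ys)} \<le> ennreal (exp (- real N * \<eta>\<^sup>2 / 4))"
    proof (rule emeasure_sum_ge_exp_bound)
      fix j assume j: "j < N"
      have jn: "j * (m + 3) \<le> n" using le[OF j] by simp
      note [measurable] = depends_below_measurable[OF dep[of j "\<lambda>x. x"] meas[OF u0, of j] jn] Hm[OF j]
      show "(\<integral>\<^sup>+ ys. ennreal (\<Prod>i<j. 1 + \<eta> / 2 * ?H i ys) * ennreal (?H j ys) \<partial>law n)
        \<le> ennreal (T + \<eta>) * (\<integral>\<^sup>+ ys. ennreal (\<Prod>i<j. 1 + \<eta> / 2 * ?H i ys) \<partial>law n)"
      proof -
        have e: "(\<integral>\<^sup>+ ys. ennreal (\<Prod>i<j. 1 + \<eta> / 2 * ?H i ys) * ennreal (?H j ys) \<partial>law n)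
            = lik_exp n (\<lambda>ys. ennreal (\<Prod>i<j. 1 + \<eta> / 2 * ?H i ys) * ennreal (?H j ys))"
          "(\<integral>\<^sup>+ ys. ennreal (\<Prod>i<j. 1 + \<eta> / 2 * ?H i ys) \<partial>law n) = lik_exp n (\<lambda>ys. ennreal (\<Prod>i<j. 1 + \<eta> / 2 * ?H i ys))"
          by (rule nn_integral_law, measurable)+
        show ?thesis
          unfolding e by (rule lik_exp_blk_bounds(1)[OF dep[of j "\<lambda>x. x"] meas[OF u0, of j] h h01 le[OF j] lb T \<epsilon>])
      qed
    qed (use \<eta> T01 H01 Hm in \<open>auto simp: emeasure_law_space cong: measurable_cong_sets[OF sets_law refl]\<close>)
    then show ?thesis by (simp add: algebra_simps)
  qed
  show "emeasure (law n) {ys\<in>space (law n). (\<Sum>j<N. ?H j ys) \<le> real N * (T - 2 * \<eta>)} \<le> ennreal (exp (- real N * \<eta>\<^sup>2 / 4))"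
  proof -
    have "emeasure (law n) {ys\<in>space (law n). real N * ((1 - T + \<eta>) + \<eta>) \<le> (\<Sum>j<N. 1 - ?H j ys)} \<le> ennreal (exp (- real N * \<eta>\<^sup>2 / 4))"
    proof (rule emeasure_sum_ge_exp_bound)
      fix j assume j: "j < N"
      let ?F = "\<lambda>ys. ennreal (\<Prod>i<j. 1 + \<eta> / 2 * (1 - ?H i ys))"
      note d = dep[of j "\<lambda>x. 1 - x"] and m0 = meas[OF u1, of j]
      have jn: "j * (m + 3) \<le> n" using le[OF j] by simp
      note [measurable] = depends_below_measurable[OF d m0 jn] Hm[OF j]
      \<comment> \<open>A crude bound that yields a finite integral: the mean of F (1 - H j) is
        obtained below by cancelling in an \<open>ennreal\<close> inequality.\<close>
      have "?F ys \<le> ennreal (\<Prod>i<j. 2)" for ys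
      proof (intro ennreal_leI prod_mono conjI)
        fix i
        have "0 \<le> \<eta> / 2 * (1 - ?H i ys)" "\<eta> / 2 * (1 - ?H i ys) \<le> 1"
          using \<eta> H01[of i ys] mult_le_one[of "\<eta> / 2" "1 - ?H i ys"] by auto
        then show "0 \<le> 1 + \<eta> / 2 * (1 - ?H i ys)" "1 + \<eta> / 2 * (1 - ?H i ys) \<le> 2" by linarith+
      qed
      then have "lik_exp n ?F \<le> lik_exp n (\<lambda>_. ennreal (2 ^ j) * 1)"
        unfolding lik_exp_def by (intro nn_integral_mono mult_left_mono) auto
      also have "\<dots> = ennreal (2 ^ j) * lik_exp n (\<lambda>_. 1)"
        unfolding lik_exp_def by (subst nn_integral_cmult[symmetric]) (auto simp: mult_ac)
      also have "\<dots> < top" by (simp add: lik_exp_const)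
      finally have fin: "lik_exp n ?F < top" .
      have split: "lik_exp n (\<lambda>ys. ?F ys * ennreal (1 - ?H j ys)) + lik_exp n (\<lambda>ys. ?F ys * ennreal (?H j ys)) = lik_exp n ?F"
        unfolding lik_exp_def
      proof (subst nn_integral_add[symmetric], measurable, measurable, rule nn_integral_cong)
        fix ys
        have "ennreal (1 - ?H j ys) + ennreal (?H j ys) = 1"
          using H01 by (simp add: ennreal_plus[symmetric] del: ennreal_plus)
        then show "ennreal (lik n Q f \<nu> ys) * (?F ys * ennreal (1 - ?H j ys)) + ennreal (lik n Q f \<nu> ys) * (?F ys * ennreal (?H j ys))
            = ennreal (lik n Q f \<nu> ys) * ?F ys"
          by (simp only: distrib_left[symmetric] mult_1_right)
      qed
      have "ennreal (T - \<eta>) * lik_exp n ?F \<le> lik_exp n (\<lambda>ys. ?F ys * ennreal (?H j ys))"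
        by (rule lik_exp_blk_bounds(2)[OF d m0 h h01 le[OF j] lb T \<epsilon>])
      from add_left_mono[OF this, of "lik_exp n (\<lambda>ys. ?F ys * ennreal (1 - ?H j ys))"]
      have *: "lik_exp n (\<lambda>ys. ?F ys * ennreal (1 - ?H j ys)) + ennreal (T - \<eta>) * lik_exp n ?F \<le> lik_exp n ?F"
        unfolding split .
      obtain r where r: "lik_exp n ?F = ennreal r" "0 \<le> r" using fin by (cases "lik_exp n ?F") auto
      have "lik_exp n (\<lambda>ys. ?F ys * ennreal (1 - ?H j ys)) \<le> lik_exp n ?F"
        by (rule order_trans[OF _ *]) (rule add_increasing2, auto)
      then have "lik_exp n (\<lambda>ys. ?F ys * ennreal (1 - ?H j ys)) < top"
        using fin by (rule order.strict_trans1)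
      then obtain r' where r': "lik_exp n (\<lambda>ys. ?F ys * ennreal (1 - ?H j ys)) = ennreal r'" "0 \<le> r'"
        by (cases "lik_exp n (\<lambda>ys. ?F ys * ennreal (1 - ?H j ys))") auto
      \<comment> \<open>For T < \<eta> the truncated \<open>ennreal (T - \<eta>)\<close> gives no
        information, but then 1 - T + \<eta> exceeds 1 and r' \<le> r is enough.\<close>
      have "r' \<le> (1 - T + \<eta>) * r"
      proof (cases "T - \<eta> \<ge> 0")
        case True
        then have "r' + (T - \<eta>) * r \<le> r"
          using * r r' by (simp add: ennreal_mult[symmetric] ennreal_plus[symmetric] del: ennreal_plus)
        then show ?thesis by (simp add: algebra_simps)
      next
        case False
        then have "r' \<le> r" using * r r' by (simp add: ennreal_neg)
        also have "1 * r \<le> (1 - T + \<eta>) * r" using False r by (intro mult_right_mono) auto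
        then have "r \<le> (1 - T + \<eta>) * r" by simp
        finally show ?thesis .
      qed
      moreover have g: "0 \<le> 1 - T + \<eta>" using T01 \<eta> by simp
      moreover have e: "(\<integral>\<^sup>+ ys. ?F ys * ennreal (1 - ?H j ys) \<partial>law n) = lik_exp n (\<lambda>ys. ?F ys * ennreal (1 - ?H j ys))"
        "(\<integral>\<^sup>+ ys. ?F ys \<partial>law n) = lik_exp n ?F"
        by (rule nn_integral_law, measurable)+
      ultimately show "(\<integral>\<^sup>+ ys. ?F ys * ennreal (1 - ?H j ys) \<partial>law n) \<le> ennreal (1 - T + \<eta>) * (\<integral>\<^sup>+ ys. ?F ys \<partial>law n)"
        unfolding e r(1) r'(1) ennreal_mult[OF g r(2), symmetric] by (intro ennreal_leI)
    qed (use \<eta> T01 H01 Hm in \<open>auto simp: emeasure_law_space cong: measurable_cong_sets[OF sets_law refl]\<close>)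
    also have "{ys\<in>space (law n). real N * ((1 - T + \<eta>) + \<eta>) \<le> (\<Sum>j<N. 1 - ?H j ys)} = {ys\<in>space (law n). (\<Sum>j<N. ?H j ys) \<le> real N * (T - 2 * \<eta>)}"
      by (auto simp: sum_subtractf algebra_simps)
    finally show ?thesis .
  qed
qed

end

section \<open>Identifiability from three consecutive observations\<close>

definition diag_mat :: "('k::finite \<Rightarrow> real) \<Rightarrow> real^'k^'k" where
  "diag_mat w = (\<chi> i j. if i = j then w i else 0)"

lemma mult_diag_mat: "(B ** diag_mat w)$i$j = B$i$j * w j"
proof -
  have "(B ** diag_mat w)$i$j = (\<Sum>k\<in>UNIV. B$i$k * (if k = j then w k else 0))"
    by (simp add: matrix_matrix_mult_def diag_mat_def)
  also have "\<dots> = (\<Sum>k\<in>UNIV. if k = j then B$i$j * w j else 0)" by (intro sum.cong) auto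
  finally show ?thesis by simp
qed

lemma diag_mat_mult: "(diag_mat w ** B)$i$j = w i * B$i$j"
proof -
  have "(diag_mat w ** B)$i$j = (\<Sum>k\<in>UNIV. (if i = k then w i else 0) * B$k$j)"
    by (simp add: matrix_matrix_mult_def diag_mat_def)
  also have "\<dots> = (\<Sum>k\<in>UNIV. if i = k then w i * B$i$j else 0)" by (intro sum.cong) auto
  finally show ?thesis by simp
qed

lemma diag_mat_invertible:
  assumes "\<And>i. w i \<noteq> 0" shows "invertible (diag_mat w)"
  unfolding invertible_def
  by (rule exI[of _ "diag_mat (\<lambda>i. 1 / w i)"])
     (use assms in \<open>auto simp: vec_eq_iff diag_mat_mult mat_def\<close>, auto simp: diag_mat_def)

lemma invertible_inverse_obtain:
  fixes A :: "real^'k^'k"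
  assumes "invertible A" obtains A' where "A ** A' = mat 1" "A' ** A = mat 1"
  using assms unfolding invertible_def by blast

text \<open>Only the reference pair is assumed invertible. The identity A C = As Cs transfers this
  to A and expresses C through A, after which both families are diagonal matrices conjugated by A
  and As respectively; the witness B is the inverse of As times A, the same for all h.\<close>

lemma simultaneous_diagonalization:
  fixes A C As Cs :: "real^'k^'k" and W Ws :: "'h \<Rightarrow> 'k \<Rightarrow> real"
  assumes inv: "invertible As" "invertible Cs" and AC: "A ** C = As ** Cs"
    and H: "\<And>h. h \<in> H \<Longrightarrow> A ** diag_mat (W h) ** C = As ** diag_mat (Ws h) ** Cs"
  shows "\<exists>B. invertible B \<and> (\<forall>h\<in>H. \<forall>i j. B$i$j * W h j = Ws h i * B$i$j)"
proof -
  obtain As' where As: "As ** As' = mat 1" "As' ** As = mat 1" using inv invertible_inverse_obtain by blast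
  obtain Cs' where Cs: "Cs ** Cs' = mat 1" "Cs' ** Cs = mat 1" using inv invertible_inverse_obtain by blast
  have "A ** (C ** (Cs' ** As')) = As ** (Cs ** Cs') ** As'"
    using AC by (simp add: matrix_mul_assoc)
  then have "A ** (C ** (Cs' ** As')) = mat 1" by (simp add: As Cs)
  then have iA: "invertible A" by (meson invertible_right_inverse)
  then obtain A' where A: "A ** A' = mat 1" "A' ** A = mat 1" using invertible_inverse_obtain by blast
  have C: "C = A' ** As ** Cs"
    using AC by (metis A(2) matrix_mul_assoc matrix_mul_lid)
  let ?B = "As' ** A"
  have iAs': "invertible As'" using As unfolding invertible_def by blast
  have "invertible ?B" by (rule invertible_mult[OF iAs' iA])
  moreover have "?B ** diag_mat (W h) = diag_mat (Ws h) ** ?B" if "h \<in> H" for h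
  proof -
    have "A ** diag_mat (W h) ** (A' ** As ** Cs) = As ** diag_mat (Ws h) ** Cs"
      using H[OF that] unfolding C .
    then have "A ** diag_mat (W h) ** (A' ** As ** Cs) ** Cs' = As ** diag_mat (Ws h) ** Cs ** Cs'" by simp
    then have "A ** diag_mat (W h) ** A' ** As ** (Cs ** Cs') = As ** diag_mat (Ws h) ** (Cs ** Cs')"
      by (simp add: matrix_mul_assoc)
    then have 1: "A ** diag_mat (W h) ** A' ** As = As ** diag_mat (Ws h)" by (simp add: Cs)
    have "As' ** (A ** diag_mat (W h) ** A' ** As) ** (As' ** A) = As' ** (As ** diag_mat (Ws h)) ** (As' ** A)"
      by (simp only: 1)
    then have "As' ** A ** diag_mat (W h) ** (A' ** (As ** As') ** A) = (As' ** As) ** diag_mat (Ws h) ** (As' ** A)"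
      by (simp add: matrix_mul_assoc)
    then show ?thesis by (simp add: As A)
  qed
  then have "?B$i$j * W h j = Ws h i * ?B$i$j" if "h \<in> H" for h i j
    by (metis that mult_diag_mat diag_mat_mult)
  ultimately show ?thesis by blast
qed

text \<open>Test functions enter only through their state-wise means, indexed by an abstract type,
  with e standing for the constant function 1; this form permits the later compactness argument. The
  two initial laws are unrelated: their agreement up to relabelling is derived along the
  way.\<close>

lemma tri_mean_identifiable:
  fixes Q Qs :: "real^'k::finite^'k" and v vs :: "'h \<Rightarrow> 'k \<Rightarrow> real" and e :: 'h and \<phi> :: "'k \<Rightarrow> 'h"
  assumes eq: "\<And>h1 h2 h3. \<lbrakk>h1 \<in> H; h2 \<in> H; h3 \<in> H\<rbrakk> \<Longrightarrow>
      tri_mean Q \<nu> (v h1) (v h2) (v h3) = tri_mean Qs \<nu>s (vs h1) (vs h2) (vs h3)"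
    and e: "e \<in> H" "\<And>x. v e x = 1" "\<And>x. vs e x = 1"
    and \<phi>: "\<And>a. \<phi> a \<in> H" and Os: "invertible (\<chi> a i. vs (\<phi> a) i)"
    and Qs: "invertible Qs" "trans_mat Qs" and Q: "trans_mat Q" and \<nu>s: "\<And>i. \<nu>s i > 0"
  shows "\<exists>\<sigma>. \<sigma> permutes UNIV \<and> (\<forall>i j. Q$(\<sigma> i)$(\<sigma> j) = Qs$i$j) \<and> (\<forall>h\<in>H. \<forall>i. v h (\<sigma> i) = vs h i)"
proof -
  define Oms where "Oms = (\<chi> a i. vs (\<phi> a) i)"
  define Om where "Om = (\<chi> a i. v (\<phi> a) i)"
  let ?A = "Om ** diag_mat \<nu> ** Q" and ?C = "Q ** transpose Om"
  let ?As = "Oms ** diag_mat \<nu>s ** Qs" and ?Cs = "Qs ** transpose Oms"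
  have row: "(\<Sum>z\<in>UNIV. Q$y$z) = 1" and rows: "(\<Sum>z\<in>UNIV. Qs$y$z) = 1" for y
    using Q Qs by (auto simp: trans_mat_def prob_vec_def)
  have tri: "((\<chi> a i. w (\<phi> a) i) ** diag_mat p ** R ** diag_mat (w h) ** (R ** transpose (\<chi> a i. w (\<phi> a) i)))$a$b
      = tri_mean R p (w (\<phi> a)) (w h) (w (\<phi> b))"
    for w :: "'h \<Rightarrow> 'k \<Rightarrow> real" and R p h a b
  proof -
    let ?O = "(\<chi> a i. w (\<phi> a) i) :: real^'k^'k"
    have "(?O ** diag_mat p ** R ** diag_mat (w h) ** (R ** transpose ?O))$a$b
       = (\<Sum>y\<in>UNIV. (\<Sum>x\<in>UNIV. w (\<phi> a) x * p x * R$x$y) * w h y * (\<Sum>z\<in>UNIV. R$y$z * w (\<phi> b) z))"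
      by (subst (1) matrix_matrix_mult_def)
         (simp add: mult_diag_mat, simp add: matrix_matrix_mult_def[of _ R] mult_diag_mat
           matrix_matrix_mult_def[of R] transpose_def)
    also have "\<dots> = (\<Sum>y\<in>UNIV. \<Sum>x\<in>UNIV. p x * (w (\<phi> a) x * (R$x$y * (w h y * (\<Sum>z\<in>UNIV. R$y$z * w (\<phi> b) z)))))"
      unfolding sum_distrib_right by (intro sum.cong refl) (simp add: mult_ac)
    also have "\<dots> = tri_mean R p (w (\<phi> a)) (w h) (w (\<phi> b))"
      unfolding tri_mean_def by (subst sum.swap) (simp only: sum_distrib_left)
    finally show ?thesis .
  qed
  have M: "?A ** diag_mat (v h) ** ?C = ?As ** diag_mat (vs h) ** ?Cs" if "h \<in> H" for h
    unfolding vec_eq_iff Om_def Oms_def tri using eq[OF \<phi> that \<phi>] by auto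
  have de: "diag_mat (v e) = mat 1" "diag_mat (vs e) = mat 1"
    by (auto simp: diag_mat_def mat_def e vec_eq_iff)
  have AC: "?A ** ?C = ?As ** ?Cs" using M[OF e(1)] by (simp add: de)
  have iO: "invertible Oms" using Os by (simp add: Oms_def)
  have iOt: "invertible (transpose Oms)" using iO by (rule transpose_invertible)
  have "invertible (diag_mat \<nu>s)" using \<nu>s by (intro diag_mat_invertible) (metis less_irrefl)
  then have iA: "invertible ?As" using iO Qs by (intro invertible_mult) auto
  have iC: "invertible ?Cs" using iOt Qs by (intro invertible_mult) auto
  obtain B where B: "invertible B" "\<And>h i j. h \<in> H \<Longrightarrow> B$i$j * v h j = vs h i * B$i$j"
    using simultaneous_diagonalization[where H = H and W = v and Ws = vs, OF iA iC AC M] by blast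
  obtain B' where B': "B ** B' = mat 1" using B(1) invertible_inverse_obtain by blast
  \<comment> \<open>Where the entry (i, j) of B is nonzero, its relation reads v h j = vs h i for
    all h in H at once. An invertible B has such a j in each row, and this defines the
    relabelling.\<close>
  have "\<exists>j. B$i$j \<noteq> 0" for i
  proof (rule ccontr)
    assume "\<nexists>j. B$i$j \<noteq> 0"
    then have "(B ** B')$i$i = 0" by (simp add: matrix_matrix_mult_def)
    then show False by (simp add: B' mat_def)
  qed
  then obtain \<sigma> where \<sigma>: "\<And>i. B$i$(\<sigma> i) \<noteq> 0" by metis
  have v\<sigma>: "v h (\<sigma> i) = vs h i" if "h \<in> H" for h i
    using B(2)[OF that, of i "\<sigma> i"] \<sigma>[of i] by simp
  \<comment> \<open>Two states with the same image would have the same values \<open>vs\<close> on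
    H, that is, equal columns in the invertible matrix \<open>Oms\<close>.\<close>
  have "inj \<sigma>"
  proof (rule injI, rule ccontr)
    fix i i' assume "\<sigma> i = \<sigma> i'" "i \<noteq> i'"
    then have same: "vs h i = vs h i'" if "h \<in> H" for h using v\<sigma>[OF that] by metis
    obtain O' where O': "O' ** Oms = mat 1" using iO invertible_inverse_obtain by blast
    have "(O' ** Oms)$i$i = (O' ** Oms)$i$i'"
      using same[OF \<phi>] by (simp add: matrix_matrix_mult_def Oms_def)
    then show False using \<open>i \<noteq> i'\<close> by (simp add: O' mat_def)
  qed
  then have bij: "bij \<sigma>" by (simp add: finite_UNIV_inj_surj bij_def)
  have perm: "\<sigma> permutes UNIV" by (rule bij_imp_permutes[OF bij]) simp
  \<comment> \<open>With the labels matched, the means with third function e determine the joint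
    weights of two consecutive states, since the outer factors \<open>Oms\<close> cancel.\<close>
  define X where "X = (\<chi> i j. \<nu> (\<sigma> i) * Q$(\<sigma> i)$(\<sigma> j))"
  define Xs where "Xs = (\<chi> i j. \<nu>s i * Qs$i$j)"
  have two: "(Oms ** Z ** transpose Oms)$a$b = (\<Sum>x\<in>UNIV. vs (\<phi> a) x * (\<Sum>y\<in>UNIV. Z$x$y * vs (\<phi> b) y))" for Z a b
    by (simp add: matrix_mul_assoc[symmetric]) (simp add: matrix_matrix_mult_def transpose_def Oms_def)
  have "Oms ** X ** transpose Oms = Oms ** Xs ** transpose Oms"
    unfolding vec_eq_iff
  proof (intro allI)
    fix a b
    have "(Oms ** X ** transpose Oms)$a$b = (\<Sum>x\<in>UNIV. vs (\<phi> a) x * (\<Sum>y\<in>UNIV. \<nu> (\<sigma> x) * Q$(\<sigma> x)$(\<sigma> y) * vs (\<phi> b) y))"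
      by (simp add: two X_def)
    also have "\<dots> = (\<Sum>x\<in>UNIV. v (\<phi> a) (\<sigma> x) * (\<Sum>y\<in>UNIV. \<nu> (\<sigma> x) * Q$(\<sigma> x)$(\<sigma> y) * v (\<phi> b) (\<sigma> y)))"
      by (simp add: v\<sigma> \<phi>)
    also have "\<dots> = (\<Sum>x\<in>UNIV. v (\<phi> a) (\<sigma> x) * (\<Sum>y\<in>UNIV. \<nu> (\<sigma> x) * Q$(\<sigma> x)$y * v (\<phi> b) y))"
      by (intro sum.cong refl arg_cong2[of _ _ _ _ "(*)"] sum.reindex_bij_betw[OF bij])
    also have "\<dots> = (\<Sum>x\<in>UNIV. v (\<phi> a) x * (\<Sum>y\<in>UNIV. \<nu> x * Q$x$y * v (\<phi> b) y))"
      by (rule sum.reindex_bij_betw[OF bij, of "\<lambda>x. v (\<phi> a) x * (\<Sum>y\<in>UNIV. \<nu> x * Q$x$y * v (\<phi> b) y)"])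
    also have "\<dots> = tri_mean Q \<nu> (v (\<phi> a)) (v (\<phi> b)) (v e)"
      unfolding tri_mean_def by (simp add: e row sum_distrib_left mult_ac)
    also have "\<dots> = tri_mean Qs \<nu>s (vs (\<phi> a)) (vs (\<phi> b)) (vs e)" by (intro eq \<phi> e)
    also have "\<dots> = (Oms ** Xs ** transpose Oms)$a$b"
      unfolding tri_mean_def two by (simp add: e rows sum_distrib_left mult_ac Xs_def)
    finally show "(Oms ** X ** transpose Oms)$a$b = (Oms ** Xs ** transpose Oms)$a$b" .
  qed
  then have X: "X = Xs"
  proof -
    assume h: "Oms ** X ** transpose Oms = Oms ** Xs ** transpose Oms"
    obtain O1 where O1: "O1 ** Oms = mat 1" using iO invertible_inverse_obtain by blast
    obtain O2 where O2: "transpose Oms ** O2 = mat 1" using iOt invertible_inverse_obtain by blast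
    have "O1 ** (Oms ** X ** transpose Oms) ** O2 = O1 ** (Oms ** Xs ** transpose Oms) ** O2" by (simp only: h)
    then have "(O1 ** Oms) ** X ** (transpose Oms ** O2) = (O1 ** Oms) ** Xs ** (transpose Oms ** O2)"
      by (simp only: matrix_mul_assoc)
    then show ?thesis by (simp add: O1 O2)
  qed
  have comp: "\<nu> (\<sigma> i) * Q$(\<sigma> i)$(\<sigma> j) = \<nu>s i * Qs$i$j" for i j
    using X by (simp add: X_def Xs_def vec_eq_iff)
  \<comment> \<open>Summing the joint weights over the second state isolates the initial weight by
    the unit row sums; dividing by it, which is positive, then gives Q.\<close>
  have "\<nu> (\<sigma> i) = \<nu>s i" for i
  proof -
    have "\<nu> (\<sigma> i) = \<nu> (\<sigma> i) * (\<Sum>j\<in>UNIV. Q$(\<sigma> i)$(\<sigma> j))"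
      using sum.reindex_bij_betw[OF bij, of "\<lambda>j. Q$(\<sigma> i)$j"] by (simp add: row)
    also have "\<dots> = \<nu>s i * (\<Sum>j\<in>UNIV. Qs$i$j)" by (simp only: sum_distrib_left comp)
    finally show ?thesis by (simp add: rows)
  qed
  then have "Q$(\<sigma> i)$(\<sigma> j) = Qs$i$j" for i j using comp[of i j] \<nu>s[of i] by simp
  then show ?thesis using perm v\<sigma> by blast
qed

text \<open>The total deviation is continuous on the compact set of parameters that are not r-close
  to the reference after any relabelling, and positive there by the exact statement, so it has a
  positive lower bound. Keeping the initial laws as arbitrary vectors with entries in [q, 1] makes
  one \<eta> valid for all of them.\<close>

lemma tri_mean_separation:
  fixes Qs :: "real^'k::finite^'k" and vs :: "'h \<Rightarrow> 'k \<Rightarrow> real" and e :: 'h and \<phi> :: "'k \<Rightarrow> 'h"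
  assumes H: "finite H" and q: "q > 0" and r: "r > 0"
    and e: "e \<in> H" "\<And>x. vs e x = 1"
    and \<phi>: "\<And>a. \<phi> a \<in> H" and Os: "invertible (\<chi> a i. vs (\<phi> a) i)"
    and Qs: "invertible Qs" "trans_mat Qs"
  shows "\<exists>\<eta>>0. \<forall>Q \<nu> \<nu>s v. trans_mat Q \<longrightarrow> (\<forall>x. q \<le> \<nu> x \<and> \<nu> x \<le> 1) \<longrightarrow> (\<forall>x. q \<le> \<nu>s x \<and> \<nu>s x \<le> 1) \<longrightarrow>
      (\<forall>h x. 0 \<le> v h x \<and> v h x \<le> 1) \<longrightarrow> (\<forall>x. v e x = 1) \<longrightarrow>
      (\<forall>h1\<in>H. \<forall>h2\<in>H. \<forall>h3\<in>H. \<bar>tri_mean Q \<nu> (v h1) (v h2) (v h3) - tri_mean Qs \<nu>s (vs h1) (vs h2) (vs h3)\<bar> < \<eta>) \<longrightarrow>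
      (\<exists>\<sigma>. \<sigma> permutes UNIV \<and> (\<forall>i j. \<bar>Q$(\<sigma> i)$(\<sigma> j) - Qs$i$j\<bar> < r) \<and> (\<forall>h\<in>H. \<forall>i. \<bar>v h (\<sigma> i) - vs h i\<bar> < r))"
proof -
  define KN :: "('k \<Rightarrow> real) set" where "KN = PiE UNIV (\<lambda>_. {q..1})"
  define KQ :: "(real^'k^'k) set" where "KQ = {Q. trans_mat Q}"
  \<comment> \<open>Values are recorded for the whole index type, possibly infinite, so this is a
    Tychonoff cube; the coordinate e is pinned to 1.\<close>
  define KV :: "('h \<Rightarrow> 'k \<Rightarrow> real) set" where "KV = PiE UNIV (\<lambda>h. PiE UNIV (\<lambda>_. if h = e then {1} else {0..1}))"
  define K where "K = KN \<times> KN \<times> KQ \<times> KV"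
  have cPiE: "compact (PiE UNIV S)" if "\<And>i. compact (S i)" for S :: "'i \<Rightarrow> 'b::topological_space set"
  proof -
    have "compactin (product_topology (\<lambda>_. euclidean) UNIV) (PiE UNIV S)"
      using that by (simp add: compactin_PiE)
    then show ?thesis by (simp add: euclidean_product_topology)
  qed
  have "compact KN" unfolding KN_def by (intro cPiE) simp
  moreover have "compact KV" unfolding KV_def by (intro cPiE) simp
  moreover have "compact KQ"
  proof -
    have "closed KQ"
      unfolding KQ_def trans_mat_def prob_vec_def
      by (intro closed_Collect_conj closed_Collect_all closed_Collect_le closed_Collect_eq continuous_intros)
    moreover have "KQ \<subseteq> cbox 0 (\<chi> i j. 1)"
    proof
      fix Q :: "real^'k^'k" assume "Q \<in> KQ"
      then have Q: "0 \<le> Q$i$j" "(\<Sum>j\<in>UNIV. Q$i$j) = 1" for i j by (auto simp: KQ_def trans_mat_def prob_vec_def)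
      have "Q$i$j \<le> (\<Sum>j\<in>UNIV. Q$i$j)" for i j by (intro member_le_sum) (auto simp: Q)
      then show "Q \<in> cbox 0 (\<chi> i j. 1)"
        using Q by (auto simp: mem_box Basis_vec_def inner_axis)
    qed
    ultimately show ?thesis using bounded_cbox bounded_subset compact_eq_bounded_closed by blast
  qed
  ultimately have K: "compact K" unfolding K_def by (intro compact_Times)
  have c1: "continuous_on S (\<lambda>p. fst p x)" and c2: "continuous_on S (\<lambda>p. fst (snd p) x)"
    and c3: "continuous_on S (\<lambda>p. fst (snd (snd p)) $ x $ y)" and c4: "continuous_on S (\<lambda>p. snd (snd (snd p)) h x)"
    for S :: "(('k \<Rightarrow> real) \<times> ('k \<Rightarrow> real) \<times> (real^'k^'k) \<times> ('h \<Rightarrow> 'k \<Rightarrow> real)) set" and x y h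
  proof -
    show "continuous_on S (\<lambda>p. fst p x)"
      by (rule continuous_on_product_then_coordinatewise) (intro continuous_intros)
    show "continuous_on S (\<lambda>p. fst (snd p) x)"
      by (rule continuous_on_product_then_coordinatewise) (intro continuous_intros)
    show "continuous_on S (\<lambda>p. fst (snd (snd p)) $ x $ y)" by (intro continuous_intros)
    have "continuous_on S (\<lambda>p. snd (snd (snd p)) h)"
      by (rule continuous_on_product_then_coordinatewise) (intro continuous_intros)
    then show "continuous_on S (\<lambda>p. snd (snd (snd p)) h x)"
      by (rule continuous_on_product_then_coordinatewise)
  qed
  define G where "G = (\<Union>\<sigma>\<in>{\<sigma>::'k \<Rightarrow> 'k. \<sigma> permutes UNIV}.
     (\<Inter>i\<in>UNIV. \<Inter>j\<in>UNIV. {p::('k \<Rightarrow> real) \<times> ('k \<Rightarrow> real) \<times> (real^'k^'k) \<times> ('h \<Rightarrow> 'k \<Rightarrow> real).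
         \<bar>fst (snd (snd p)) $ (\<sigma> i) $ (\<sigma> j) - Qs$i$j\<bar> < r}) \<inter>
     (\<Inter>h\<in>H. \<Inter>i\<in>UNIV. {p. \<bar>snd (snd (snd p)) h (\<sigma> i) - vs h i\<bar> < r}))"
  have "open G"
    unfolding G_def
    by (intro open_UN ballI open_Int open_INT H finite open_Collect_less continuous_intros c3 c4)
  then have KG: "compact (K - G)" by (rule compact_diff[OF K])
  define Dev where "Dev p = (\<Sum>h1\<in>H. \<Sum>h2\<in>H. \<Sum>h3\<in>H.
     \<bar>tri_mean (fst (snd (snd p))) (fst p) (snd (snd (snd p)) h1) (snd (snd (snd p)) h2) (snd (snd (snd p)) h3)
        - tri_mean Qs (fst (snd p)) (vs h1) (vs h2) (vs h3)\<bar>)"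
    for p :: "('k \<Rightarrow> real) \<times> ('k \<Rightarrow> real) \<times> (real^'k^'k) \<times> ('h \<Rightarrow> 'k \<Rightarrow> real)"
  have cD: "continuous_on (K - G) Dev"
    unfolding Dev_def tri_mean_def by (intro continuous_intros c1 c2 c3 c4)
  have pos: "Dev p > 0" if p: "p \<in> K - G" for p
  proof (rule ccontr)
    assume "\<not> Dev p > 0"
    moreover have "Dev p \<ge> 0" unfolding Dev_def by (intro sum_nonneg) auto
    ultimately have D0: "Dev p = 0" by simp
    obtain \<nu> \<nu>s Q v where p4: "p = (\<nu>, \<nu>s, Q, v)" by (metis prod_cases4)
    have "\<nexists>\<sigma>. \<sigma> permutes UNIV \<and> (\<forall>i j. Q$(\<sigma> i)$(\<sigma> j) = Qs$i$j) \<and> (\<forall>h\<in>H. \<forall>i. v h (\<sigma> i) = vs h i)"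
      using p r by (fastforce simp: G_def p4)
    moreover have "\<exists>\<sigma>. \<sigma> permutes UNIV \<and> (\<forall>i j. Q$(\<sigma> i)$(\<sigma> j) = Qs$i$j) \<and> (\<forall>h\<in>H. \<forall>i. v h (\<sigma> i) = vs h i)"
    proof (rule tri_mean_identifiable)
      show "tri_mean Q \<nu> (v h1) (v h2) (v h3) = tri_mean Qs \<nu>s (vs h1) (vs h2) (vs h3)"
        if "h1 \<in> H" "h2 \<in> H" "h3 \<in> H" for h1 h2 h3
        using D0 that unfolding Dev_def p4 fst_conv snd_conv
        by (simp add: sum_nonneg_eq_0_iff H sum_nonneg)
      show "v e x = 1" for x using p by (auto simp: K_def p4 KV_def PiE_iff split: if_splits)
      show "trans_mat Q" using p by (auto simp: K_def p4 KQ_def)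
      show "\<nu>s i > 0" for i
      proof -
        have "q \<le> \<nu>s i" using p by (auto simp: K_def p4 KN_def PiE_iff)
        then show ?thesis using q by linarith
      qed
    qed (use e \<phi> Os Qs in auto)
    ultimately show False by blast
  qed
  have "\<exists>d>0. \<forall>p\<in>K - G. d \<le> Dev p"
  proof (cases "K - G = {}")
    case True
    then show ?thesis by (intro exI[of _ 1]) auto
  next
    case False
    then obtain p0 where "p0 \<in> K - G" "\<And>p. p \<in> K - G \<Longrightarrow> Dev p0 \<le> Dev p"
      using continuous_attains_inf[OF KG False cD] by blast
    then show ?thesis using pos by blast
  qed
  then obtain d where d: "d > 0" "\<And>p. p \<in> K - G \<Longrightarrow> d \<le> Dev p" by blast
  define c where "c = real (card H)"
  \<comment> \<open>There are c^3 deviations, so if each is below \<eta> their sum is at most c^3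
    \<eta>; the added 1 makes this strictly less than d.\<close>
  define \<eta> where "\<eta> = d / (c * (c * c) + 1)"
  have c0: "0 \<le> c * (c * c)" by (simp add: c_def)
  have \<eta>: "\<eta> > 0" using d c0 by (simp add: \<eta>_def)
  have "c * (c * c) * \<eta> < d"
    using d c0 by (simp add: \<eta>_def field_simps)
  show ?thesis
  proof (intro exI[of _ \<eta>] conjI \<eta> allI impI)
    fix Q :: "real^'k^'k" and \<nu> \<nu>s :: "'k \<Rightarrow> real" and v :: "'h \<Rightarrow> 'k \<Rightarrow> real"
    assume a: "trans_mat Q" "\<forall>x. q \<le> \<nu> x \<and> \<nu> x \<le> 1" "\<forall>x. q \<le> \<nu>s x \<and> \<nu>s x \<le> 1" "\<forall>h x. 0 \<le> v h x \<and> v h x \<le> 1" "\<forall>x. v e x = 1"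
      and s: "\<forall>h1\<in>H. \<forall>h2\<in>H. \<forall>h3\<in>H. \<bar>tri_mean Q \<nu> (v h1) (v h2) (v h3) - tri_mean Qs \<nu>s (vs h1) (vs h2) (vs h3)\<bar> < \<eta>"
    have "Dev (\<nu>, \<nu>s, Q, v) \<le> (\<Sum>h1\<in>H. \<Sum>h2\<in>H. \<Sum>h3\<in>H. \<eta>)"
      unfolding Dev_def fst_conv snd_conv using s by (intro sum_mono) (simp add: less_imp_le)
    also have "\<dots> = c * (c * c) * \<eta>" by (simp add: c_def)
    also have "\<dots> < d" by fact
    finally have "(\<nu>, \<nu>s, Q, v) \<notin> K - G" using d(2) by force
    moreover have "(\<nu>, \<nu>s, Q, v) \<in> K" using a by (auto simp: K_def KN_def KQ_def KV_def PiE_iff)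
    ultimately show "\<exists>\<sigma>. \<sigma> permutes UNIV \<and> (\<forall>i j. \<bar>Q$(\<sigma> i)$(\<sigma> j) - Qs$i$j\<bar> < r) \<and> (\<forall>h\<in>H. \<forall>i. \<bar>v h (\<sigma> i) - vs h i\<bar> < r)"
      by (auto simp: G_def)
  qed
qed

text \<open>The vectors of masses of A under all F i, with A ranging over the family, span the whole
  space: a nonzero vector orthogonal to all of them would be a forbidden linear relation. A basis
  chosen among them supplies the sets.\<close>

lemma linear_independent_measures_invertible:
  fixes F :: "'k::finite \<Rightarrow> 'y measure"
  assumes indep: "\<forall>c :: 'k \<Rightarrow> real. (\<forall>A\<in>\<A>. (\<Sum>i\<in>UNIV. c i * measure (F i) A) = 0) \<longrightarrow> (\<forall>i. c i = 0)"
  shows "\<exists>S :: 'k \<Rightarrow> 'y set. (\<forall>a. S a \<in> \<A>) \<and> invertible (\<chi> a i. measure (F i) (S a))"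
proof -
  let ?w = "\<lambda>A. (\<chi> i. measure (F i) A) :: real^'k"
  define W where "W = ?w ` \<A>"
  have sp: "span W = UNIV"
  proof (rule ccontr)
    assume "span W \<noteq> UNIV"
    then obtain c where c: "c \<noteq> 0" "\<forall>x\<in>span W. c \<bullet> x = 0" using span_not_UNIV_orthogonal by blast
    have "(\<Sum>i\<in>UNIV. c$i * measure (F i) A) = 0" if "A \<in> \<A>" for A
    proof -
      have "?w A \<in> span W" using that by (auto simp: W_def intro: span_base)
      then have "c \<bullet> ?w A = 0" using c by blast
      then show ?thesis by (simp add: inner_vec_def)
    qed
    then have "\<forall>i. c$i = 0" using indep[rule_format, of "\<lambda>i. c$i"] by blast
    then show False using c by (simp add: vec_eq_iff)
  qed
  obtain B where B: "B \<subseteq> W" "independent B" "W \<subseteq> span B" "card B = dim W"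
    using basis_exists by blast
  have spB: "span B = UNIV" using sp B(3) by (metis span_minimal subspace_span top.extremum_uniqueI)
  have "finite B" using B(2) by (rule finiteI_independent)
  moreover have "card B = CARD('k)"
    using B(4) sp by (metis dim_UNIV dim_span DIM_cart DIM_real mult.right_neutral)
  ultimately obtain b where b: "bij_betw b (UNIV::'k set) B"
    using finite_same_card_bij[of "UNIV::'k set" B] by auto
  have "\<forall>a. \<exists>A\<in>\<A>. b a = ?w A"
    using b B(1) by (auto simp: W_def bij_betw_def)
  then obtain S where S: "\<And>a. S a \<in> \<A>" "\<And>a. b a = ?w (S a)" by metis
  have "rows (\<chi> a i. measure (F i) (S a)) = B"
  proof -
    have "row a (\<chi> a i. measure (F i) (S a)) = b a" for a by (simp add: row_def S vec_eq_iff)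
    then show ?thesis using b by (auto simp: rows_def bij_betw_def image_def)
  qed
  then have "\<exists>B'. B' ** (\<chi> a i. measure (F i) (S a)) = mat 1"
    by (simp add: matrix_left_invertible_span_rows spB)
  then have "invertible (\<chi> a i. measure (F i) (S a))" by (simp add: invertible_left_inverse)
  then show ?thesis using S by blast
qed

section \<open>A one-sided law of large numbers\<close>

lemma (in finite_measure) borel_cantelli_ennreal:
  assumes "\<And>n. A n \<in> sets M" "(\<Sum>n. emeasure M (A n)) < \<infinity>"
  shows "AE x in M. \<forall>\<^sub>F n in sequentially. x \<notin> A n"
proof -
  have "(\<Sum>n. ennreal (measure M (A n))) \<noteq> top"
    using assms(2) by (simp add: emeasure_eq_measure)
  then have "summable (\<lambda>n. measure M (A n))" by (intro summable_suminf_not_top) auto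
  from borel_cantelli_AE1[OF assms(1) _ this] have "AE x in M. \<forall>\<^sub>F n in sequentially. x \<in> space M - A n"
    by (simp add: emeasure_eq_measure)
  then show ?thesis by (rule AE_mp) (intro AE_I2 impI, auto elim: eventually_mono)
qed

text \<open>The nonzero terms form a geometric series of ratio 1/2 with first term at most g. Hence
  truncated second moments, weighted over dyadic scales, cost only a first moment.\<close>

lemma dyadic_square_sum_bound:
  fixes g :: real assumes g: "0 \<le> g"
  shows "(\<Sum>j. ennreal ((if g \<le> 2 ^ j then g else 0)\<^sup>2 / 2 ^ j)) \<le> ennreal (2 * g)"
proof -
  \<comment> \<open>The remainder of the geometric series is 2 g^2 / 2^J; the maximum with 0 covers
    the scales below g, where all terms vanish.\<close>
  have *: "(\<Sum>j<J. (if g \<le> 2 ^ j then g else 0)\<^sup>2 / 2 ^ j) \<le> max 0 (2 * g - 2 * g\<^sup>2 / 2 ^ J)" for J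
  proof (induction J)
    case 0
    then show ?case by simp
  next
    case (Suc J)
    show ?case
    proof (cases "g \<le> 2 ^ J")
      case True
      have "g * g \<le> g * 2 ^ J" using True g by (intro mult_left_mono)
      then have "2 * g\<^sup>2 / 2 ^ J \<le> 2 * g" by (simp add: field_simps power2_eq_square)
      then have "(\<Sum>j<J. (if g \<le> 2 ^ j then g else 0)\<^sup>2 / 2 ^ j) \<le> 2 * g - 2 * g\<^sup>2 / 2 ^ J" using Suc by simp
      then have "(\<Sum>j<Suc J. (if g \<le> 2 ^ j then g else 0)\<^sup>2 / 2 ^ j) \<le> 2 * g - 2 * g\<^sup>2 / 2 ^ J + g\<^sup>2 / 2 ^ J"
        using True by simp
      also have "\<dots> = 2 * g - 2 * g\<^sup>2 / 2 ^ Suc J" by (simp add: field_simps)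
      finally show ?thesis by linarith
    next
      case False
      have "g * 2 ^ J \<le> g * g" using False g by (intro mult_left_mono) auto
      then have "2 * g \<le> 2 * g\<^sup>2 / 2 ^ J" by (simp add: field_simps power2_eq_square)
      then have "max 0 (2 * g - 2 * g\<^sup>2 / 2 ^ J) = 0" by (simp add: max_def)
      moreover have "(\<Sum>j<Suc J. (if g \<le> 2 ^ j then g else 0)\<^sup>2 / 2 ^ j) = (\<Sum>j<J. (if g \<le> 2 ^ j then g else 0)\<^sup>2 / 2 ^ j)"
        using False by simp
      ultimately show ?thesis using Suc by linarith
    qed
  qed
  have "(\<Sum>j<J. ennreal ((if g \<le> 2 ^ j then g else 0)\<^sup>2 / 2 ^ j)) \<le> ennreal (2 * g)" for J
  proof -
    have "(\<Sum>j<J. (if g \<le> 2 ^ j then g else 0)\<^sup>2 / 2 ^ j) \<le> 2 * g"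
      using *[of J] g by (smt (verit) divide_nonneg_nonneg zero_le_power zero_le_power2)
    then show ?thesis by (subst sum_ennreal) (auto intro: ennreal_leI)
  qed
  then show ?thesis unfolding suminf_eq_SUP by (intro SUP_least)
qed

text \<open>The powers of 2 below g add up to less than twice the largest of them. This bounds the
  total cost of truncating 2^j observations at level 2^j.\<close>

lemma dyadic_tail_sum_bound:
  fixes g :: real assumes g: "0 \<le> g"
  shows "(\<Sum>j. ennreal (2 ^ j * (if 2 ^ j < g then 1 else 0))) \<le> ennreal (2 * g)"
proof -
  have 1: "(\<Sum>j<J. 2 ^ j * (if 2 ^ j < g then 1 else 0)) \<le> (2 ^ J - 1 :: real)" for J
  proof (induction J)
    case (Suc J)
    moreover have "(2::real) ^ J * (if 2 ^ J < g then 1 else 0) \<le> 2 ^ J" by simp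
    ultimately show ?case unfolding sum.lessThan_Suc power_Suc by linarith
  qed simp
  have "(\<Sum>j<J. 2 ^ j * (if 2 ^ j < g then 1 else 0)) \<le> 2 * g" for J
  proof (induction J)
    case 0
    then show ?case using g by simp
  next
    case (Suc J)
    show ?case
    proof (cases "2 ^ J < g")
      case True
      then show ?thesis using 1[of "Suc J"] by simp
    next
      case False
      then show ?thesis using Suc by simp
    qed
  qed
  then have "(\<Sum>j<J. ennreal (2 ^ j * (if 2 ^ j < g then 1 else 0))) \<le> ennreal (2 * g)" for J
    by (subst sum_ennreal) (auto intro: ennreal_leI)
  then show ?thesis unfolding suminf_eq_SUP by (intro SUP_least)
qed

section \<open>The observed process: conditional bounds and linear growth of sums\<close>

locale hmm_process = hmm_model lam Q f \<nu> + M: prob_space M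
  for lam :: "'y measure" and Q :: "real^'k::finite^'k" and f :: "'k \<Rightarrow> 'y \<Rightarrow> real" and \<nu> :: "'k \<Rightarrow> real"
    and M :: "'w measure" +
  fixes Y :: "nat \<Rightarrow> 'w \<Rightarrow> 'y"
  assumes Y_measurable [measurable]: "\<And>t. Y t \<in> measurable M lam"
    and Y_distr: "\<And>n. distr M (obs n) (\<lambda>\<omega>. \<lambda>t\<in>{..<n}. Y t \<omega>) = law n"
begin

lemma Y_tuple_measurable [measurable]: "(\<lambda>\<omega>. \<lambda>t\<in>{..<n}. Y t \<omega>) \<in> measurable M (obs n)"
  by (intro measurable_restrict) simp

lemma nn_expectation:
  assumes "depends_below n F" and [measurable]: "F \<in> borel_measurable (obs n)"
  shows "(\<integral>\<^sup>+ \<omega>. F (\<lambda>t. Y t \<omega>) \<partial>M) = lik_exp n F"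
proof -
  have "lik_exp n F = (\<integral>\<^sup>+ ys. F ys \<partial>distr M (obs n) (\<lambda>\<omega>. \<lambda>t\<in>{..<n}. Y t \<omega>))"
    by (simp add: Y_distr nn_integral_law)
  also have "\<dots> = (\<integral>\<^sup>+ \<omega>. F (\<lambda>t\<in>{..<n}. Y t \<omega>) \<partial>M)" by (intro nn_integral_distr) auto
  finally show ?thesis by (simp add: depends_below_restrict[OF assms(1)])
qed

lemma measurable_of_Y:
  assumes "depends_below n F" and [measurable]: "F \<in> borel_measurable (obs n)"
  shows "(\<lambda>\<omega>. F (\<lambda>t. Y t \<omega>)) \<in> borel_measurable M"
proof -
  have "(\<lambda>\<omega>. F (\<lambda>t\<in>{..<n}. Y t \<omega>)) \<in> borel_measurable M" by measurable
  then show ?thesis by (simp add: depends_below_restrict[OF assms(1)])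
qed

text \<open>A bound on the mean of w in every hidden state also bounds its conditional mean given
  any past, because the past acts only through the law of the current state.\<close>

lemma nn_expectation_next:
  assumes F: "depends_below n F" and Fm [measurable]: "F \<in> borel_measurable (obs n)"
    and w [measurable]: "w \<in> borel_measurable lam" and c: "\<And>x. emis x w \<le> c"
  shows "(\<integral>\<^sup>+ \<omega>. F (\<lambda>t. Y t \<omega>) * w (Y n \<omega>) \<partial>M) \<le> c * (\<integral>\<^sup>+ \<omega>. F (\<lambda>t. Y t \<omega>) \<partial>M)"
proof -
  have [measurable]: "(\<lambda>ys. ys n) \<in> measurable (obs (Suc n)) lam"
    by (intro measurable_component_singleton) auto
  note [measurable] = depends_below_measurable[OF F Fm, of "Suc n", simplified]
  have "(\<integral>\<^sup>+ \<omega>. F (\<lambda>t. Y t \<omega>) * w (Y n \<omega>) \<partial>M) = lik_exp (Suc n) (\<lambda>ys. F ys * w (ys n))"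
  proof (rule nn_expectation[of "Suc n" "\<lambda>ys. F ys * w (ys n)"])
    show "depends_below (Suc n) (\<lambda>ys. F ys * w (ys n))"
      using F unfolding depends_below_def by (metis less_Suc_eq)
  qed measurable
  also have "\<dots> = (\<Sum>z\<in>UNIV. fwd_exp n z F * emis z w)" by (rule lik_exp_Suc[OF F Fm w])
  also have "\<dots> \<le> (\<Sum>z\<in>UNIV. fwd_exp n z F * c)" by (intro sum_mono mult_left_mono c) auto
  also have "\<dots> = c * lik_exp n F" by (simp add: lik_exp_eq sum_distrib_left mult.commute)
  also have "lik_exp n F = (\<integral>\<^sup>+ \<omega>. F (\<lambda>t. Y t \<omega>) \<partial>M)" by (rule nn_expectation[OF F Fm, symmetric])
  finally show ?thesis .
qed

lemma nn_expectation_Y_le: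
  assumes "w \<in> borel_measurable lam" "\<And>x. emis x w \<le> c"
  shows "(\<integral>\<^sup>+ \<omega>. w (Y n \<omega>) \<partial>M) \<le> c"
  using nn_expectation_next[of n "\<lambda>_. 1" w c] assms by (simp add: depends_below_def M.emeasure_space_1)

lemma AE_Y:
  assumes [measurable]: "Measurable.pred lam P" and "\<And>x. AE y in lam. f x y > 0 \<longrightarrow> P y"
  shows "AE \<omega> in M. P (Y t \<omega>)"
proof -
  let ?w = "\<lambda>y. indicator {y\<in>space lam. \<not> P y} y :: ennreal"
  have "emis x ?w = 0" for x
  proof -
    have "AE y in lam. ennreal (f x y) * ?w y = 0"
      using assms(2)[of x] by eventually_elim (auto simp: indicator_def ennreal_eq_0_iff)
    then show ?thesis unfolding emis_def by (subst nn_integral_0_iff_AE) auto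
  qed
  then have "(\<integral>\<^sup>+ \<omega>. ?w (Y t \<omega>) \<partial>M) \<le> 0" by (intro nn_expectation_Y_le) auto
  then have "(\<integral>\<^sup>+ \<omega>. ?w (Y t \<omega>) \<partial>M) = 0" by simp
  then have "AE \<omega> in M. ?w (Y t \<omega>) = 0" by (subst (asm) nn_integral_0_iff_AE) auto
  then show ?thesis
    by (rule AE_mp) (intro AE_I2 impI, auto simp: indicator_def measurable_space[OF Y_measurable] split: if_splits)
qed

text \<open>The positive part matters: nonnegative and determined by the past, it may multiply the
  next increment z - c, whose conditional mean is only known to be at most 0.\<close>

definition exceed :: "('y \<Rightarrow> real) \<Rightarrow> real \<Rightarrow> nat \<Rightarrow> (nat \<Rightarrow> 'y) \<Rightarrow> real" where
  "exceed z c n ys = max 0 ((\<Sum>t<n. z (ys t)) - real n * c)"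

lemma exceed_nonneg: "0 \<le> exceed z c n ys"
  by (simp add: exceed_def)

lemma exceed_depends: "depends_below n (exceed z c n)"
  by (auto simp: depends_below_def exceed_def)

lemma exceed_measurable [measurable]:
  assumes [measurable]: "z \<in> borel_measurable lam"
  shows "exceed z c n \<in> borel_measurable (obs n)"
proof -
  have [measurable]: "(\<lambda>ys. ys t) \<in> measurable (obs n) lam" if "t \<in> {..<n}" for t
    using that by (intro measurable_component_singleton) auto
  show ?thesis unfolding exceed_def
    by (intro borel_measurable_max borel_measurable_const borel_measurable_diff borel_measurable_sum) measurable
qed

text \<open>The excess at time n + 1 is at most the positive part of R + z - c, with R the excess at
  time n. On squaring, the cross term 2 R (z - c) has nonpositive expectation, so second moments
  grow linearly without independence.\<close>

lemma exceed_second_moment: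
  assumes z [measurable]: "z \<in> borel_measurable lam" and z0: "\<And>y. 0 \<le> z y" "\<And>y. z y \<le> b" and c: "0 \<le> c"
    and m1: "\<And>x. emis x (\<lambda>y. ennreal (z y)) \<le> ennreal c"
    and m2: "\<And>x. emis x (\<lambda>y. ennreal ((z y)\<^sup>2)) \<le> B"
  shows "(\<integral>\<^sup>+ \<omega>. ennreal ((exceed z c n (\<lambda>t. Y t \<omega>))\<^sup>2) \<partial>M) \<le> of_nat n * (B + ennreal (c\<^sup>2))"
proof (induction n)
  case 0
  then show ?case by (simp add: exceed_def)
next
  case (Suc n)
  let ?R = "\<lambda>n \<omega>. exceed z c n (\<lambda>t. Y t \<omega>)"
  have [measurable]: "?R n \<in> borel_measurable M" for n
    by (rule measurable_of_Y[OF exceed_depends]) measurable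
  have dep: "depends_below n (\<lambda>ys. ennreal (exceed z c n ys))"
    using exceed_depends[of n z c] unfolding depends_below_def by metis
  \<comment> \<open>The subtracted part 2 c R of the cross term is moved to the left so that all
    quantities are nonnegative. It is cancelled at the end, using the finiteness \<open>fin\<close>
    that follows from the bound b on z.\<close>
  have pt: "(?R (Suc n) \<omega>)\<^sup>2 + 2 * c * ?R n \<omega> \<le> (?R n \<omega>)\<^sup>2 + 2 * (?R n \<omega> * z (Y n \<omega>)) + (z (Y n \<omega>))\<^sup>2 + c\<^sup>2" for \<omega>
  proof -
    let ?a = "?R n \<omega>" and ?z = "z (Y n \<omega>)"
    have "?R (Suc n) \<omega> \<le> max 0 (?a + ?z - c)" by (auto simp: exceed_def algebra_simps)
    then have "?R (Suc n) \<omega> \<le> \<bar>?a + ?z - c\<bar>" by linarith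
    then have "(?R (Suc n) \<omega>)\<^sup>2 \<le> (?a + ?z - c)\<^sup>2"
      using exceed_nonneg by (metis abs_le_square_iff abs_of_nonneg)
    moreover have "0 \<le> ?z * c" using z0 c by simp
    ultimately show ?thesis by (simp add: power2_eq_square algebra_simps)
  qed
  have "?R n \<omega> \<le> real n * b" for \<omega>
  proof -
    have "(\<Sum>t<n. z (Y t \<omega>)) \<le> (\<Sum>t<n. b)" by (intro sum_mono z0)
    moreover have "0 \<le> b" using z0 order_trans by blast
    ultimately show ?thesis using c by (auto simp: exceed_def intro: order_trans[rotated])
  qed
  then have "(\<integral>\<^sup>+ \<omega>. ennreal (?R n \<omega>) \<partial>M) \<le> (\<integral>\<^sup>+ \<omega>. ennreal (real n * b) \<partial>M)"
    by (intro nn_integral_mono ennreal_leI)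
  then have fin: "(\<integral>\<^sup>+ \<omega>. ennreal (?R n \<omega>) \<partial>M) < top"
    by (simp add: M.emeasure_space_1 order.strict_trans1)
  let ?X = "2 * ennreal c * (\<integral>\<^sup>+ \<omega>. ennreal (?R n \<omega>) \<partial>M)"
  have "?X + (\<integral>\<^sup>+ \<omega>. ennreal ((?R (Suc n) \<omega>)\<^sup>2) \<partial>M) = (\<integral>\<^sup>+ \<omega>. 2 * ennreal c * ennreal (?R n \<omega>) + ennreal ((?R (Suc n) \<omega>)\<^sup>2) \<partial>M)"
    by (subst nn_integral_add) (auto simp: nn_integral_cmult)
  also have "\<dots> \<le> (\<integral>\<^sup>+ \<omega>. (ennreal ((?R n \<omega>)\<^sup>2) + 2 * (ennreal (?R n \<omega>) * ennreal (z (Y n \<omega>)))) + (ennreal ((z (Y n \<omega>))\<^sup>2) + ennreal (c\<^sup>2)) \<partial>M)"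
  proof (intro nn_integral_mono)
    fix \<omega>
    have "2 * ennreal c * ennreal (?R n \<omega>) + ennreal ((?R (Suc n) \<omega>)\<^sup>2) = ennreal ((?R (Suc n) \<omega>)\<^sup>2 + 2 * c * ?R n \<omega>)"
      using c by (simp add: ennreal_mult exceed_nonneg add.commute)
    also have "\<dots> \<le> ennreal ((?R n \<omega>)\<^sup>2 + 2 * (?R n \<omega> * z (Y n \<omega>)) + (z (Y n \<omega>))\<^sup>2 + c\<^sup>2)"
      by (rule ennreal_leI[OF pt])
    also have "\<dots> = (ennreal ((?R n \<omega>)\<^sup>2) + 2 * (ennreal (?R n \<omega>) * ennreal (z (Y n \<omega>)))) + (ennreal ((z (Y n \<omega>))\<^sup>2) + ennreal (c\<^sup>2))"
      by (simp add: ennreal_mult exceed_nonneg z0 add.assoc)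
    finally show "2 * ennreal c * ennreal (?R n \<omega>) + ennreal ((?R (Suc n) \<omega>)\<^sup>2) \<le> \<dots>" .
  qed
  also have "\<dots> = (\<integral>\<^sup>+ \<omega>. ennreal ((?R n \<omega>)\<^sup>2) \<partial>M) + 2 * (\<integral>\<^sup>+ \<omega>. ennreal (?R n \<omega>) * ennreal (z (Y n \<omega>)) \<partial>M)
       + ((\<integral>\<^sup>+ \<omega>. ennreal ((z (Y n \<omega>))\<^sup>2) \<partial>M) + ennreal (c\<^sup>2))"
    by (simp add: nn_integral_add nn_integral_cmult M.emeasure_space_1)
  also have "\<dots> \<le> of_nat n * (B + ennreal (c\<^sup>2)) + 2 * (ennreal c * (\<integral>\<^sup>+ \<omega>. ennreal (?R n \<omega>) \<partial>M)) + (B + ennreal (c\<^sup>2))"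
    by (intro add_mono mult_left_mono Suc.IH order_refl nn_expectation_next[OF dep _ _ m1, simplified]
        nn_expectation_Y_le m2) auto
  also have "\<dots> = ?X + of_nat (Suc n) * (B + ennreal (c\<^sup>2))"
    by (simp add: algebra_simps)
  finally show ?case using fin by (auto simp: ennreal_add_left_cancel_le ennreal_mult_eq_top_iff)
qed

text \<open>At time 2^j the observations are truncated at 2^j, and the failure events are summable
  by the first moment of g alone. Otherwise the sum up to 2^j is at most 2 c 2^j, one c for the mean
  and one for the excess; times between two powers of 2 cost another factor 2.\<close>

lemma eventually_sum_le:
  assumes g [measurable]: "g \<in> borel_measurable lam" and g0: "\<And>y. 0 \<le> g y" and c: "0 < c"
    and m: "\<And>x. emis x (\<lambda>y. ennreal (g y)) \<le> ennreal c"
  shows "AE \<omega> in M. \<forall>\<^sub>F n in sequentially. (\<Sum>t<n. g (Y t \<omega>)) \<le> 4 * c * real n"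
proof -
  define z where "z j y = (if g y \<le> 2 ^ j then g y else 0)" for j y
  define u where "u j y = (if 2 ^ j < g y then 1 else 0 :: real)" for j :: nat and y
  have [measurable]: "z j \<in> borel_measurable lam" "u j \<in> borel_measurable lam" for j
    unfolding z_def u_def by measurable
  have z0: "0 \<le> z j y" "z j y \<le> 2 ^ j" "z j y \<le> g y" for j y using g0 by (auto simp: z_def)
  define B where "B j = (\<Sum>x\<in>UNIV. emis x (\<lambda>y. ennreal ((z j y)\<^sup>2)))" for j
  define D where "D j = (\<Sum>x\<in>UNIV. emis x (\<lambda>y. ennreal (u j y)))" for j
  let ?R = "\<lambda>j \<omega>. exceed (z j) c (2 ^ j) (\<lambda>t. Y t \<omega>)"
  have [measurable]: "?R j \<in> borel_measurable M" for j
    by (rule measurable_of_Y[OF exceed_depends]) measurable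
  \<comment> \<open>Failure at scale j: a large excess of the truncated sum, handled by Chebyshev,
    or an observation above the truncation level, handled by a union bound.\<close>
  define A where "A j = {\<omega>\<in>space M. c * 2 ^ j < ?R j \<omega> \<or> (\<exists>t<2^j. 2 ^ j < g (Y t \<omega>))}" for j
  have [measurable]: "A j \<in> sets M" for j unfolding A_def by measurable
  have member: "emis x w \<le> (\<Sum>x\<in>UNIV. emis x w)" for x w
    by (intro member_le_sum) auto
  have A: "emeasure M (A j) \<le> (ennreal (1 / c\<^sup>2) * (ennreal (1 / 2 ^ j) * B j) + ennreal ((1/2) ^ j)) + ennreal (2 ^ j) * D j" for j
  proof -
    let ?r = "1 / (c * 2 ^ j)\<^sup>2"
    have "emeasure M (A j) = (\<integral>\<^sup>+ \<omega>. indicator (A j) \<omega> \<partial>M)" by simp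
    also have "\<dots> \<le> (\<integral>\<^sup>+ \<omega>. ennreal ?r * ennreal ((?R j \<omega>)\<^sup>2) + (\<Sum>t<2^j. ennreal (u j (Y t \<omega>))) \<partial>M)"
    proof (intro nn_integral_mono)
      fix \<omega>
      show "indicator (A j) \<omega> \<le> ennreal ?r * ennreal ((?R j \<omega>)\<^sup>2) + (\<Sum>t<2^j. ennreal (u j (Y t \<omega>)))"
      proof (cases "\<omega> \<in> A j")
        case True
        then consider "c * 2 ^ j < ?R j \<omega>" | t where "t < 2^j" "2 ^ j < g (Y t \<omega>)" by (auto simp: A_def)
        then show ?thesis
        proof cases
          case 1
          then have "(c * 2 ^ j)\<^sup>2 \<le> (?R j \<omega>)\<^sup>2" using c by (intro power_mono) auto
          then have "1 \<le> ?r * (?R j \<omega>)\<^sup>2" using c by (simp add: field_simps)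
          then have "1 \<le> ennreal ?r * ennreal ((?R j \<omega>)\<^sup>2)" by (simp add: ennreal_mult[symmetric])
          then show ?thesis using True by (simp add: add_increasing2)
        next
          case 2
          then have "1 \<le> ennreal (u j (Y t \<omega>))" by (simp add: u_def)
          also have "\<dots> \<le> (\<Sum>t<2^j. ennreal (u j (Y t \<omega>)))" using 2 by (intro member_le_sum) auto
          finally show ?thesis using True by (simp add: add_increasing)
        qed
      qed simp
    qed
    also have "\<dots> = ennreal ?r * (\<integral>\<^sup>+ \<omega>. ennreal ((?R j \<omega>)\<^sup>2) \<partial>M) + (\<Sum>t<2^j. \<integral>\<^sup>+ \<omega>. ennreal (u j (Y t \<omega>)) \<partial>M)"
      by (simp add: nn_integral_add nn_integral_cmult nn_integral_sum)
    also have "\<dots> \<le> ennreal ?r * (of_nat (2 ^ j) * (B j + ennreal (c\<^sup>2))) + (\<Sum>t<(2::nat)^j. D j)"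
    proof (intro add_mono mult_left_mono sum_mono)
      show "(\<integral>\<^sup>+ \<omega>. ennreal ((?R j \<omega>)\<^sup>2) \<partial>M) \<le> of_nat (2 ^ j) * (B j + ennreal (c\<^sup>2))"
      proof (rule exceed_second_moment)
        show "emis x (\<lambda>y. ennreal (z j y)) \<le> ennreal c" for x
          by (rule order_trans[OF _ m[of x]]) (auto simp: emis_def intro!: nn_integral_mono mult_left_mono ennreal_leI z0)
        show "emis x (\<lambda>y. ennreal ((z j y)\<^sup>2)) \<le> B j" for x unfolding B_def by (rule member)
      qed (use c z0 in auto)
      show "(\<integral>\<^sup>+ \<omega>. ennreal (u j (Y t \<omega>)) \<partial>M) \<le> D j" for t
        unfolding D_def by (intro nn_expectation_Y_le member) auto
    qed auto
    also have "ennreal ?r * (of_nat (2 ^ j) * (B j + ennreal (c\<^sup>2))) = ennreal (1 / c\<^sup>2) * (ennreal (1 / 2 ^ j) * B j) + ennreal ((1/2) ^ j)"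
    proof -
      have "ennreal ?r * of_nat (2 ^ j) = ennreal (1 / c\<^sup>2) * ennreal (1 / 2 ^ j)"
        using c by (simp add: ennreal_of_nat_eq_real_of_nat ennreal_mult[symmetric] field_simps power2_eq_square)
      moreover have "ennreal (1 / c\<^sup>2) * ennreal (1 / 2 ^ j) * ennreal (c\<^sup>2) = ennreal ((1/2) ^ j)"
        using c by (simp add: ennreal_mult[symmetric] power_one_over)
      ultimately show ?thesis by (simp add: distrib_left mult.assoc[symmetric])
    qed
    also have "(\<Sum>t<(2::nat)^j. D j) = ennreal (2 ^ j) * D j"
      by (simp add: ennreal_of_nat_eq_real_of_nat)
    finally show ?thesis .
  qed
  have emis_g: "emis x (\<lambda>y. ennreal (2 * g y)) \<le> ennreal (2 * c)" for x
  proof -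
    have "emis x (\<lambda>y. ennreal (2 * g y)) = 2 * emis x (\<lambda>y. ennreal (g y))"
      unfolding emis_def using g0 by (subst nn_integral_cmult[symmetric]) (auto simp: ennreal_mult mult_ac)
    also have "\<dots> \<le> 2 * ennreal c" by (intro mult_left_mono m) auto
    finally show ?thesis using c by (simp add: ennreal_mult)
  qed
  have sum_emis: "(\<Sum>j. \<Sum>x\<in>UNIV. emis x (w j)) < top"
    if [measurable]: "\<And>j. w j \<in> borel_measurable lam" and le: "\<And>y. (\<Sum>j. w j y) \<le> ennreal (2 * g y)" for w :: "nat \<Rightarrow> 'y \<Rightarrow> ennreal"
  proof -
    have "(\<Sum>j. \<Sum>x\<in>UNIV. emis x (w j)) = (\<Sum>x\<in>UNIV. \<Sum>j. emis x (w j))" by (rule suminf_sum) auto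
    also have "\<dots> = (\<Sum>x\<in>UNIV. emis x (\<lambda>y. \<Sum>j. w j y))"
      unfolding emis_def by (subst nn_integral_suminf[symmetric]) auto
    also have "\<dots> \<le> (\<Sum>x\<in>(UNIV::'k set). ennreal (2 * c))"
      by (intro sum_mono order_trans[OF _ emis_g]) (auto simp: emis_def intro!: nn_integral_mono mult_left_mono le)
    also have "\<dots> < top" by (simp add: ennreal_mult_less_top of_nat_less_top)
    finally show ?thesis .
  qed
  have emis_scale: "ennreal a * (\<Sum>x\<in>UNIV. emis x w) = (\<Sum>x\<in>UNIV. emis x (\<lambda>y. ennreal a * w y))"
    if [measurable]: "w \<in> borel_measurable lam" for a w
    unfolding emis_def sum_distrib_left by (subst nn_integral_cmult[symmetric]) (auto simp: mult_ac)
  have sB: "(\<Sum>j. ennreal (1 / 2 ^ j) * B j) < top"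
    unfolding B_def
  proof (subst emis_scale)
    show "(\<Sum>j. \<Sum>x\<in>UNIV. emis x (\<lambda>y. ennreal (1 / 2 ^ j) * ennreal ((z j y)\<^sup>2))) < top"
    proof (rule sum_emis)
      show "(\<Sum>j. ennreal (1 / 2 ^ j) * ennreal ((z j y)\<^sup>2)) \<le> ennreal (2 * g y)" for y
        using dyadic_square_sum_bound[OF g0[of y]] by (simp add: z_def ennreal_mult[symmetric])
    qed measurable
  qed measurable
  have sD: "(\<Sum>j. ennreal (2 ^ j) * D j) < top"
    unfolding D_def
  proof (subst emis_scale)
    show "(\<Sum>j. \<Sum>x\<in>UNIV. emis x (\<lambda>y. ennreal (2 ^ j) * ennreal (u j y))) < top"
    proof (rule sum_emis)
      show "(\<Sum>j. ennreal (2 ^ j) * ennreal (u j y)) \<le> ennreal (2 * g y)" for y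
        using dyadic_tail_sum_bound[OF g0[of y]] by (simp add: u_def ennreal_mult[symmetric])
    qed measurable
  qed measurable
  have sg: "(\<Sum>j. ennreal ((1/2) ^ j)) < top"
    by (subst suminf_ennreal2) (auto simp: summable_geometric)
  have "(\<Sum>j. emeasure M (A j)) \<le> (\<Sum>j. (ennreal (1 / c\<^sup>2) * (ennreal (1 / 2 ^ j) * B j) + ennreal ((1/2) ^ j)) + ennreal (2 ^ j) * D j)"
    by (intro suminf_le A) auto
  also have "\<dots> = (ennreal (1 / c\<^sup>2) * (\<Sum>j. ennreal (1 / 2 ^ j) * B j) + (\<Sum>j. ennreal ((1/2) ^ j))) + (\<Sum>j. ennreal (2 ^ j) * D j)"
    by (simp add: suminf_add[symmetric])
  also have "\<dots> < top" using sB sD sg by (simp add: ennreal_mult_less_top)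
  finally have "AE \<omega> in M. \<forall>\<^sub>F j in sequentially. \<omega> \<notin> A j"
    by (intro M.borel_cantelli_ennreal) auto
  moreover have "AE \<omega> in M. \<omega> \<in> space M" by simp
  ultimately show ?thesis
  proof eventually_elim
    case (elim \<omega>)
    then obtain J where J: "\<And>j. j \<ge> J \<Longrightarrow> \<omega> \<notin> A j" by (auto simp: eventually_sequentially)
    have dy: "(\<Sum>t<2^j. g (Y t \<omega>)) \<le> 2 * c * 2 ^ j" if "j \<ge> J" for j
    proof -
      have nA: "?R j \<omega> \<le> c * 2 ^ j" "\<And>t. t < 2^j \<Longrightarrow> g (Y t \<omega>) \<le> 2 ^ j"
        using J[OF that] elim(2) by (auto simp: A_def not_less[symmetric])
      have "(\<Sum>t<2^j. g (Y t \<omega>)) = (\<Sum>t<2^j. z j (Y t \<omega>))"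
        using nA(2) by (intro sum.cong) (auto simp: z_def)
      also have "\<dots> \<le> ?R j \<omega> + 2 ^ j * c" by (simp add: exceed_def)
      finally show ?thesis using nA(1) by (simp add: algebra_simps)
    qed
    have "(\<Sum>t<n. g (Y t \<omega>)) \<le> 4 * c * real n" if n: "n \<ge> Suc (2 ^ J)" for n
    proof -
      \<comment> \<open>Here 2^(j-1) < n \<le> 2^j, and since g is nonnegative the sum up to n is
        bounded by the one up to 2^j \<le> 2 n.\<close>
      define j where "j = (LEAST j. n \<le> 2 ^ j)"
      have ex: "n \<le> 2 ^ n" by (simp add: less_imp_le)
      have j1: "n \<le> 2 ^ j" unfolding j_def by (rule LeastI[of _ n]) (rule ex)
      have "J < j"
      proof (rule ccontr)
        assume "\<not> J < j"
        then have "(2::nat) ^ j \<le> 2 ^ J" by (intro power_increasing) auto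
        then show False using j1 n by linarith
      qed
      then have "\<not> n \<le> 2 ^ (j - 1)" unfolding j_def by (intro not_less_Least) simp
      then have "2 ^ (j - 1) < n" by simp
      moreover have "(2::nat) ^ j = 2 * 2 ^ (j - 1)" using \<open>J < j\<close> by (cases j) auto
      ultimately have "2 ^ j \<le> 2 * n" by simp
      then have j2: "2 ^ j \<le> 2 * real n" by (metis of_nat_le_iff of_nat_mult of_nat_numeral of_nat_power)
      have "(\<Sum>t<n. g (Y t \<omega>)) \<le> (\<Sum>t<2^j. g (Y t \<omega>))"
        using j1 g0 by (intro sum_mono2) auto
      also have "\<dots> \<le> 2 * c * 2 ^ j" using dy \<open>J < j\<close> by simp
      also have "\<dots> \<le> 2 * c * (2 * real n)" using j2 c by (intro mult_left_mono) auto
      finally show ?thesis by simp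
    qed
    then show ?case by (auto simp: eventually_sequentially)
  qed
qed

end

section \<open>Kullback--Leibler lower bound for the likelihood ratio\<close>

text \<open>A Pinsker-type inequality. If m = -u < 0, then t \<ge> s exp u \<ge> s (1 + u + u^2 /
  2), and u \<le> a + u^2 / a turns the quadratic gain into a bound for s u, the negative part of s
  m. After integration the masses of s and t cancel, leaving N \<le> a + (2 / a) (P - N) for the
  integrals P, N of the positive and negative part. The additive form is needed because these may be
  infinite.\<close>

lemma KL_pointwise:
  fixes s t a :: real and m :: ereal
  assumes s: "0 \<le> s" and t: "0 \<le> t" and a: "0 < a" and m: "log_ratio s t \<le> m"
  shows "e2ennreal (- (ereal s * m)) + ennreal (2 / a) * (ennreal s + e2ennreal (- (ereal s * m)))
     \<le> ennreal (a * s) + ennreal (2 / a) * (ennreal t + e2ennreal (ereal s * m))"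
proof (cases "s = 0")
  case True
  then show ?thesis by (simp add: zero_ereal_def[symmetric])
next
  case False
  then have s: "0 < s" using s by simp
  show ?thesis
  proof (cases "m = \<infinity>")
    case True
    then show ?thesis using s a by (simp add: ennreal_mult_top)
  next
    case False
    have t: "0 < t" using False s t m by (cases "t = 0") (auto simp: log_ratio_def)
    have l: "ereal (ln (s / t)) \<le> m" using m s t by (simp add: log_ratio_def)
    then obtain r where r: "m = ereal r" using False by (cases m) auto
    have "ln (s / t) \<le> r" using l r by simp
    then have "s / t \<le> exp r" using s t by (metis divide_pos_pos exp_le_cancel_iff exp_ln)
    then have ts: "s * exp (- r) \<le> t" using s t by (simp add: exp_minus field_simps)
    show ?thesis
    proof (cases "r \<ge> 0")
      case True
      have "1 - r \<le> exp (- r)" using exp_ge_add_one_self[of "- r"] by simp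
      then have "s * (1 - r) \<le> s * exp (- r)" using s by (intro mult_left_mono) auto
      then have "s \<le> t + s * r" using ts by (simp add: algebra_simps)
      then have "2 / a * s \<le> 2 / a * (t + s * r)" using a by (intro mult_left_mono) auto
      moreover have "0 \<le> a * s" using a s by simp
      ultimately have "2 / a * s \<le> a * s + 2 / a * (t + s * r)" by linarith
      then have "ennreal (2 / a * s) \<le> ennreal (a * s + 2 / a * (t + s * r))" by (rule ennreal_leI)
      moreover have "e2ennreal (- (ereal s * m)) = 0" using True s unfolding r by (simp add: ennreal_neg)
      moreover have "e2ennreal (ereal s * m) = ennreal (s * r)" unfolding r by (simp add: e2ennreal_ereal)
      ultimately show ?thesis
        using True s t a by (simp add: ennreal_mult[symmetric] ennreal_plus[symmetric] del: ennreal_plus)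
    next
      case F: False
      define u where "u = - r"
      have u: "0 < u" using F by (simp add: u_def)
      have "1 + u + u\<^sup>2 / 2 \<le> exp u" using u by (intro exp_lower_Taylor_quadratic) auto
      then have "s * (1 + u + u\<^sup>2 / 2) \<le> s * exp u" using s by (intro mult_left_mono) auto
      then have 1: "s * (1 + u + u\<^sup>2 / 2) \<le> t" using ts by (simp add: u_def)
      have "a * u \<le> a\<^sup>2 + u\<^sup>2"
        using sum_squares_bound[of a u] mult_pos_pos[OF a u] by linarith
      then have "u \<le> a + u\<^sup>2 / a" using a by (simp add: field_simps power2_eq_square)
      then have "s * u \<le> s * (a + u\<^sup>2 / a)" using s by (intro mult_left_mono) auto
      moreover have "2 / a * (s * (1 + u + u\<^sup>2 / 2)) \<le> 2 / a * t" using 1 a by (intro mult_left_mono) auto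
      ultimately have "s * u + 2 / a * (s + s * u) \<le> a * s + 2 / a * t"
      proof -
        have "2 / a * (s * (1 + u + u\<^sup>2 / 2)) = 2 / a * (s + s * u) + s * (u\<^sup>2 / a)"
          by (simp add: algebra_simps add_divide_distrib)
        moreover have "s * (a + u\<^sup>2 / a) = a * s + s * (u\<^sup>2 / a)" by (simp add: algebra_simps)
        ultimately show "s * u \<le> s * (a + u\<^sup>2 / a) \<Longrightarrow> 2 / a * (s * (1 + u + u\<^sup>2 / 2)) \<le> 2 / a * t \<Longrightarrow> ?thesis"
          by linarith
      qed
      then have "ennreal (s * u + 2 / a * (s + s * u)) \<le> ennreal (a * s + 2 / a * t)" by (rule ennreal_leI)
      moreover have "e2ennreal (ereal s * m) = 0" using F s unfolding r by (simp add: ennreal_neg mult_nonneg_nonpos)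
      moreover have "e2ennreal (- (ereal s * m)) = ennreal (s * u)" unfolding r u_def by (simp add: e2ennreal_ereal)
      ultimately show ?thesis
        using u s t a by (simp add: ennreal_mult[symmetric] ennreal_plus[symmetric] del: ennreal_plus)
    qed
  qed
qed

text \<open>The hypothesis controls only the difference of the integrals of \<open>P i\<close> and
  \<open>N i\<close>; \<open>KL_pointwise\<close> bounds the second by a + 2 \<epsilon> / a and
  hence the first. The auxiliary a is meant to be chosen small first and \<epsilon>
  afterwards.\<close>

lemma KL_dominating_function:
  fixes lam :: "'y measure" and fs f :: "'k::finite \<Rightarrow> 'y \<Rightarrow> real"
  assumes fs: "fs \<in> dens_tuples lam" and f: "f \<in> dens_tuples lam" and a: "0 < a"
    and KL: "\<And>i. ext_integral lam (\<lambda>y. ereal (fs i y) * Max (range (\<lambda>j. log_ratio (fs j y) (f j y)))) < ereal \<epsilon>"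
  obtains g where "g \<in> borel_measurable lam" "\<And>y. (0::real) \<le> g y"
    "\<And>i. (\<integral>\<^sup>+ y. ennreal (fs i y) * ennreal (g y) \<partial>lam) \<le> ennreal (\<epsilon> + a + 2 * \<epsilon> / a)"
    "AE y in lam. \<forall>j. exp (- g y) * fs j y \<le> f j y"
proof -
  have [measurable]: "fs j \<in> borel_measurable lam" "f j \<in> borel_measurable lam" for j
    using fs f by (auto simp: dens_tuples_def is_density_def)
  have nn: "0 \<le> fs j y" "0 \<le> f j y" for j y
    using fs f by (auto simp: dens_tuples_def is_density_def)
  have int1: "(\<integral>\<^sup>+ y. ennreal (fs j y) \<partial>lam) = 1" "(\<integral>\<^sup>+ y. ennreal (f j y) \<partial>lam) = 1" for j
    using fs f by (auto simp: dens_tuples_def is_density_def)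
  define m where "m y = Max (range (\<lambda>j. log_ratio (fs j y) (f j y)))" for y
  have m_ge: "log_ratio (fs j y) (f j y) \<le> m y" for j y unfolding m_def by (intro Max_ge) auto
  have [measurable]: "(\<lambda>y. log_ratio (fs j y) (f j y)) \<in> borel_measurable lam" for j
    unfolding log_ratio_def by measurable
  have m_meas [measurable]: "m \<in> borel_measurable lam"
    unfolding m_def by (intro borel_measurable_Max) auto
  define P where "P i y = e2ennreal (ereal (fs i y) * m y)" for i y
  define N where "N i y = e2ennreal (- (ereal (fs i y) * m y))" for i y
  have [measurable]: "P i \<in> borel_measurable lam" "N i \<in> borel_measurable lam" for i
    unfolding P_def N_def by measurable
  have KL': "enn2ereal (\<integral>\<^sup>+ y. P i y \<partial>lam) - enn2ereal (\<integral>\<^sup>+ y. N i y \<partial>lam) < ereal \<epsilon>" for i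
    using KL[of i] by (simp add: ext_integral_def P_def N_def m_def)
  \<comment> \<open>In \<open>ereal\<close>, \<infinity> minus anything is \<infinity>, so a
    difference below \<epsilon> excludes an infinite positive part.\<close>
  have finP: "(\<integral>\<^sup>+ y. P i y \<partial>lam) \<noteq> top" for i
    using KL'[of i] by (auto simp: top_ennreal.rep_eq)
  have bound: "(\<integral>\<^sup>+ y. P i y \<partial>lam) \<le> ennreal (\<epsilon> + a + 2 * \<epsilon> / a)" for i
  proof -
    have "(\<integral>\<^sup>+ y. N i y + ennreal (2 / a) * (ennreal (fs i y) + N i y) \<partial>lam)
      \<le> (\<integral>\<^sup>+ y. ennreal (a * fs i y) + ennreal (2 / a) * (ennreal (f i y) + P i y) \<partial>lam)"
      unfolding N_def P_def by (intro nn_integral_mono KL_pointwise nn a m_ge)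
    also have "\<dots> = ennreal a + ennreal (2 / a) * (1 + (\<integral>\<^sup>+ y. P i y \<partial>lam))"
      using a nn by (simp add: nn_integral_add nn_integral_cmult int1 ennreal_mult)
    also have "(\<integral>\<^sup>+ y. N i y + ennreal (2 / a) * (ennreal (fs i y) + N i y) \<partial>lam)
       = (\<integral>\<^sup>+ y. N i y \<partial>lam) + ennreal (2 / a) * (1 + (\<integral>\<^sup>+ y. N i y \<partial>lam))"
      by (simp add: nn_integral_add nn_integral_cmult int1)
    finally have le: "(\<integral>\<^sup>+ y. N i y \<partial>lam) + ennreal (2 / a) * (1 + (\<integral>\<^sup>+ y. N i y \<partial>lam)) \<le> ennreal a + ennreal (2 / a) * (1 + (\<integral>\<^sup>+ y. P i y \<partial>lam))" .
    obtain p where p: "(\<integral>\<^sup>+ y. P i y \<partial>lam) = ennreal p" "0 \<le> p" using finP[of i] by (cases "\<integral>\<^sup>+ y. P i y \<partial>lam") auto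
    have "(\<integral>\<^sup>+ y. N i y \<partial>lam) \<noteq> top"
      using le p by (auto simp: top_unique ennreal_mult_eq_top_iff)
    then obtain n where n: "(\<integral>\<^sup>+ y. N i y \<partial>lam) = ennreal n" "0 \<le> n" by (cases "\<integral>\<^sup>+ y. N i y \<partial>lam") auto
    have 1: "n + 2 / a * (1 + n) \<le> a + 2 / a * (1 + p)"
    proof -
      have e: "ennreal (2 / a) * (1 + ennreal x) = ennreal (2 / a * (1 + x))" if "0 \<le> x" for x
      proof -
        have "1 + ennreal x = ennreal (1 + x)" using that by simp
        then show ?thesis using a that by (subst ennreal_mult) auto
      qed
      have "ennreal (n + 2 / a * (1 + n)) = ennreal n + ennreal (2 / a * (1 + n))"
        "ennreal (a + 2 / a * (1 + p)) = ennreal a + ennreal (2 / a * (1 + p))"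
        using a n p by (auto intro!: ennreal_plus)
      then have "ennreal (n + 2 / a * (1 + n)) \<le> ennreal (a + 2 / a * (1 + p))"
        using le unfolding n(1) p(1) e[OF n(2)] e[OF p(2)] by (simp only:)
      then show ?thesis using a p by (subst (asm) ennreal_le_iff) auto
    qed
    have "p - n < \<epsilon>" using KL'[of i] p n by (simp add: enn2ereal_ennreal)
    then have "2 / a * (p - n) \<le> 2 / a * \<epsilon>" using a by (intro mult_left_mono) auto
    moreover have "n \<le> a + 2 / a * (p - n)"
      unfolding right_diff_distrib using 1[unfolded distrib_left] by linarith
    moreover have "2 / a * \<epsilon> = 2 * \<epsilon> / a" by simp
    ultimately have "p \<le> \<epsilon> + a + 2 * \<epsilon> / a" using \<open>p - n < \<epsilon>\<close> by linarith
    then show ?thesis unfolding p(1) by (rule ennreal_leI)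
  qed
  \<comment> \<open>Where m is infinite this real value defaults to 0 and need not dominate. At such
    a point some fs j y is positive and P j y is infinite, which the finite integral confines to a
    null set.\<close>
  define g where "g y = real_of_ereal (max 0 (m y))" for y
  have g0: "0 \<le> g y" for y unfolding g_def by (intro real_of_ereal_pos) auto
  show ?thesis
  proof (rule that[of g])
    show "g \<in> borel_measurable lam" unfolding g_def by measurable
    show "0 \<le> g y" for y by (rule g0)
    show "(\<integral>\<^sup>+ y. ennreal (fs i y) * ennreal (g y) \<partial>lam) \<le> ennreal (\<epsilon> + a + 2 * \<epsilon> / a)" for i
    proof (rule order_trans[OF nn_integral_mono bound[of i]])
      fix y
      show "ennreal (fs i y) * ennreal (g y) \<le> P i y"
      proof (cases "m y")
        case (real r)
        have "fs i y * max 0 r = max 0 (fs i y * r)" using nn by (simp add: max_mult_distrib_left)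
        then show ?thesis using nn real g0 by (simp add: ennreal_mult[symmetric] P_def g_def e2ennreal_ereal ennreal_max_0 max_def ennreal_neg mult_nonneg_nonpos)
      qed (auto simp: g_def max_def)
    qed
    have "AE y in lam. \<forall>i. P i y \<noteq> top"
    proof (subst AE_all_countable, rule allI)
      show "AE y in lam. P i y \<noteq> top" for i
        using nn_integral_noteq_infinite[of "P i" lam] finP[of i] by simp
    qed
    then show "AE y in lam. \<forall>j. exp (- g y) * fs j y \<le> f j y"
    proof (eventually_elim, intro allI)
      fix y j assume fin: "\<forall>i. P i y \<noteq> top"
      show "exp (- g y) * fs j y \<le> f j y"
      proof (cases "fs j y = 0")
        case True
        then show ?thesis using nn by simp
      next
        case False
        then have s: "0 < fs j y" using nn[of j y] by simp
        have "m y \<noteq> \<infinity>" using fin[rule_format, of j] s by (auto simp: P_def)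
        then have t: "0 < f j y" using m_ge[of j y] s nn[of _ y] by (cases "f j y = 0") (auto simp: log_ratio_def less_le)
        have l: "ereal (ln (fs j y / f j y)) \<le> m y" using m_ge[of j y] s t by (simp add: log_ratio_def)
        then obtain r where r: "m y = ereal r" using \<open>m y \<noteq> \<infinity>\<close> by (cases "m y") auto
        have "ln (fs j y / f j y) \<le> g y" using l r by (simp add: g_def max_def)
        then have "fs j y / f j y \<le> exp (g y)" using s t by (metis divide_pos_pos exp_le_cancel_iff exp_ln)
        then show ?thesis using s t by (simp add: exp_minus field_simps)
      qed
    qed
  qed
qed

context hmm_process
begin

text \<open>Here the primed model is the nearby parameter and the unprimed one the truth. Its
  transitions are at least Q - \<epsilon> \<ge> (1 - \<epsilon> / q) Q since Q \<ge> q, the initial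
  law loses at most a factor q, and each emission loses exp (- g).\<close>

lemma eventually_lik_ratio:
  fixes Q' :: "real^'k^'k" and f' :: "'k \<Rightarrow> 'y \<Rightarrow> real"
  assumes Q': "trans_mat Q'" and f': "f' \<in> dens_tuples lam" and \<mu>: "prob_vec \<mu>" "\<And>i. q \<le> \<mu> i"
    and q: "0 < q" and lb: "trans_mat_lb q Q" and \<epsilon>: "0 < \<epsilon>" "\<epsilon> < q" and a: "0 < a"
    and close: "\<And>i j. \<bar>Q'$i$j - Q$i$j\<bar> \<le> \<epsilon>"
    and KL: "\<And>i. ext_integral lam (\<lambda>y. ereal (f i y) * Max (range (\<lambda>j. log_ratio (f j y) (f' j y)))) < ereal \<epsilon>"
    and \<beta>: "4 * (\<epsilon> + a + 2 * \<epsilon> / a) - ln (1 - \<epsilon> / q) < \<beta>"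
  shows "AE \<omega> in M. \<forall>\<^sub>F n in sequentially. exp (- \<beta> * real n) * lik n Q f \<nu> (\<lambda>t. Y t \<omega>) \<le> lik n Q' f' \<mu> (\<lambda>t. Y t \<omega>)"
proof -
  let ?c = "\<epsilon> + a + 2 * \<epsilon> / a" and ?r = "1 - \<epsilon> / q"
  have c: "0 < ?c" using \<epsilon> a by (simp add: add_pos_pos)
  have r: "0 < ?r" using \<epsilon> q by simp
  obtain g where g [measurable]: "g \<in> borel_measurable lam" and g0: "\<And>y. (0::real) \<le> g y"
    and gi: "\<And>i. (\<integral>\<^sup>+ y. ennreal (f i y) * ennreal (g y) \<partial>lam) \<le> ennreal ?c"
    and gd: "AE y in lam. \<forall>j. exp (- g y) * f j y \<le> f' j y"
    using KL_dominating_function[OF dens f' a KL] by blast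
  have [measurable]: "f' j \<in> borel_measurable lam" for j
    using f' by (auto simp: dens_tuples_def is_density_def)
  have "AE \<omega> in M. \<forall>j. exp (- g (Y t \<omega>)) * f j (Y t \<omega>) \<le> f' j (Y t \<omega>)" for t
    by (rule AE_Y) (use gd in auto)
  then have "AE \<omega> in M. \<forall>t j. exp (- g (Y t \<omega>)) * f j (Y t \<omega>) \<le> f' j (Y t \<omega>)"
    by (simp add: AE_all_countable)
  moreover have "AE \<omega> in M. \<forall>\<^sub>F n in sequentially. (\<Sum>t<n. g (Y t \<omega>)) \<le> 4 * ?c * real n"
    by (rule eventually_sum_le[OF g g0 c]) (use gi in \<open>simp add: emis_def\<close>)
  ultimately show ?thesis
  proof eventually_elim
    case (elim \<omega>)
    \<comment> \<open>Spare slope in the exponent: it eventually absorbs the constant factor q from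
      the initial laws.\<close>
    let ?d = "\<beta> + ln ?r - 4 * ?c"
    have "0 < ?d" using \<beta> by simp
    moreover have "filterlim real at_top sequentially" by (rule filterlim_real_sequentially)
    ultimately have "filterlim (\<lambda>n. ?d * real n) at_top sequentially"
      by (intro filterlim_tendsto_pos_mult_at_top[OF tendsto_const])
    then have "\<forall>\<^sub>F n in sequentially. - ln q \<le> ?d * real n" by (simp add: filterlim_at_top)
    with elim(2) show ?case
    proof eventually_elim
      case (elim n)
      let ?ys = "\<lambda>t. Y t \<omega>"
      have "fwd Q' f' \<mu> n x ?ys \<ge> q * ?r ^ n * exp (- (\<Sum>t<n. g (?ys t))) * fwd Q f \<nu> n x ?ys" for x
      proof (rule fwd_lower_bound)
        have "\<nu> x \<le> 1" for x
          using init_nonneg init_sum by (metis UNIV_I finite member_le_sum)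
        then have "q * \<nu> x \<le> q" for x using q by (simp add: mult_left_le)
        then show "q * \<nu> x \<le> \<mu> x" for x using \<mu>(2)[of x] order_trans by blast
        show "?r * Q$i$j \<le> Q'$i$j" for i j
        proof -
          have "q \<le> Q$i$j" using lb by (simp add: trans_mat_lb_def)
          then have "\<epsilon> * q \<le> \<epsilon> * Q$i$j" using \<epsilon> by (intro mult_left_mono) auto
          then have "\<epsilon> \<le> \<epsilon> / q * Q$i$j" using q by (simp add: field_simps)
          then show ?thesis using close[of i j] by (simp add: algebra_simps)
        qed
        show "exp (- g (?ys t)) * f i (?ys t) \<le> f' i (?ys t)" for i t using \<open>\<forall>t j. exp (- g (Y t \<omega>)) * f j (Y t \<omega>) \<le> f' j (Y t \<omega>)\<close> by blast
      qed (use q r in \<open>auto simp: init_nonneg Q_nonneg f_nonneg\<close>)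
      then have "(\<Sum>x\<in>UNIV. q * ?r ^ n * exp (- (\<Sum>t<n. g (?ys t))) * fwd Q f \<nu> n x ?ys) \<le> (\<Sum>x\<in>UNIV. fwd Q' f' \<mu> n x ?ys)"
        by (intro sum_mono)
      then have *: "q * ?r ^ n * exp (- (\<Sum>t<n. g (?ys t))) * lik n Q f \<nu> ?ys \<le> lik n Q' f' \<mu> ?ys"
        by (simp add: lik_eq lik_eq_sum_fwd[OF Q' \<mu>(1)] sum_distrib_left)
      have "exp (- \<beta> * real n) \<le> exp (ln q + real n * ln ?r - 4 * ?c * real n)"
        using elim(2) by (simp add: algebra_simps)
      also have "\<dots> \<le> exp (ln q + real n * ln ?r - (\<Sum>t<n. g (?ys t)))" using elim(1) by simp
      also have "\<dots> = q * ?r ^ n * exp (- (\<Sum>t<n. g (?ys t)))"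
        using q r by (simp add: exp_add exp_diff exp_of_nat_mult exp_minus field_simps)
      finally have "exp (- \<beta> * real n) * lik n Q f \<nu> ?ys \<le> q * ?r ^ n * exp (- (\<Sum>t<n. g (?ys t))) * lik n Q f \<nu> ?ys"
        by (intro mult_right_mono lik_nonneg)
      with * show ?case by linarith
    qed
  qed
qed

end

section \<open>Bounds for the evidence\<close>

lemma lik_cong: "(\<And>t. t < n \<Longrightarrow> ys t = ys' t) \<Longrightarrow> lik n Q f \<nu> ys = lik n Q f \<nu> ys'"
  unfolding lik_def by (intro sum.cong arg_cong2[of _ _ _ _ "(*)"] prod.cong refl) auto

lemma matrix_entry_measurable [measurable]: "(\<lambda>Q::real^'k::finite^'k. Q$i$j) \<in> borel_measurable borel"
  by (intro borel_measurable_continuous_onI continuous_intros)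

lemma mat_entry_le_maxnorm: "\<bar>A$i$j\<bar> \<le> mat_maxnorm A"
  unfolding mat_maxnorm_def by (intro Max_ge) (auto intro: image_eqI[of _ _ "(i, j)"])

lemma mat_maxnorm_less: "(\<And>i j. \<bar>A$i$j\<bar> < e) \<Longrightarrow> mat_maxnorm A < e"
  unfolding mat_maxnorm_def by (subst Max_less_iff) auto

locale hmm_bayes = hmm_process lam Qs fs \<nu>s M Y
  for lam :: "'y measure" and Qs :: "real^'k::finite^'k" and fs :: "'k \<Rightarrow> 'y \<Rightarrow> real" and \<nu>s :: "'k \<Rightarrow> real"
    and M :: "'w measure" and Y +
  fixes piQ :: "(real^'k^'k) measure" and pif :: "('k \<Rightarrow> 'y \<Rightarrow> real) measure" and \<mu> :: "'k \<Rightarrow> real" and q :: real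
  assumes piQ: "prob_space piQ" "sets piQ = sets borel" and pif: "prob_space pif"
    and pif_measurable: "\<And>j. (\<lambda>(y, f). f j y) \<in> borel_measurable (lam \<Otimes>\<^sub>M pif)"
    and support: "AE \<theta> in piQ \<Otimes>\<^sub>M pif. \<theta> \<in> Theta_lb lam q"
    and \<mu>: "prob_vec \<mu>" "\<And>i. q \<le> \<mu> i" and q: "0 < q" and lb: "trans_mat_lb q Qs"
begin

abbreviation "prior \<equiv> piQ \<Otimes>\<^sub>M pif"
abbreviation "L n \<theta> ys \<equiv> lik n (fst \<theta>) (snd \<theta>) \<mu> ys"
abbreviation "LY n \<omega> \<theta> \<equiv> L n \<theta> (\<lambda>t. Y t \<omega>)"
abbreviation "Ls n \<omega> \<equiv> lik n Qs fs \<nu>s (\<lambda>t. Y t \<omega>)"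

sublocale Prior: prob_space prior
proof -
  interpret piQ: prob_space piQ by (rule piQ)
  interpret pif: prob_space pif by (rule pif)
  interpret pair_prob_space piQ pif by unfold_locales
  show "prob_space prior" by unfold_locales
qed

lemma piQ_measurable_cong [measurable_cong]: "sets piQ = sets borel" by (rule piQ)

text \<open>Joint measurability of evaluation is what is known about the sigma-algebra of
  \<open>pif\<close>; measurability of likelihoods and emission means in the parameter passes
  through it.\<close>

lemma emission_measurable:
  assumes "fm \<in> measurable N pif" "y \<in> measurable N lam"
  shows "(\<lambda>z. fm z j (y z)) \<in> borel_measurable N"
proof -
  have "(\<lambda>z. (y z, fm z)) \<in> measurable N (lam \<Otimes>\<^sub>M pif)" using assms by measurable
  from measurable_compose[OF this pif_measurable[of j]] show ?thesis by simp
qed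

lemma lik_param_measurable:
  assumes Qm [measurable]: "Qm \<in> borel_measurable N" and fm: "fm \<in> measurable N pif"
    and y: "\<And>t. t < n \<Longrightarrow> y t \<in> measurable N lam"
  shows "(\<lambda>z. lik n (Qm z) (fm z) \<mu> (\<lambda>t. y t z)) \<in> borel_measurable N"
proof -
  have "(\<lambda>z. Qm z $ i $ j) \<in> borel_measurable N" for i j by measurable
  moreover have "(\<lambda>z. fm z j (y t z)) \<in> borel_measurable N" if "t < n" for t j
    by (rule emission_measurable[OF fm y[OF that]])
  ultimately show ?thesis
    unfolding lik_def
    by (intro borel_measurable_sum borel_measurable_times borel_measurable_prod borel_measurable_const) auto
qed

lemma L_measurable_Y: "(\<lambda>z. L n (snd z) (\<lambda>t. Y t (fst z))) \<in> borel_measurable (M \<Otimes>\<^sub>M prior)"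
  by (rule lik_param_measurable) measurable

lemma L_measurable_section:
  assumes "\<omega> \<in> space M"
  shows "(\<lambda>\<theta>. LY n \<omega> \<theta>) \<in> borel_measurable prior"
  by (rule lik_param_measurable) (use assms in \<open>auto intro!: measurable_const measurable_space[OF Y_measurable]\<close>)

lemma L_measurable_pair: "(\<lambda>z. L n (snd z) (fst z)) \<in> borel_measurable (obs n \<Otimes>\<^sub>M prior)"
proof -
  have "(\<lambda>z. L n (snd z) (\<lambda>t. fst z t)) \<in> borel_measurable (obs n \<Otimes>\<^sub>M prior)"
  proof (rule lik_param_measurable)
    show "(\<lambda>z. fst z t) \<in> measurable (obs n \<Otimes>\<^sub>M prior) lam" if "t < n" for t
      using that by (intro measurable_compose[OF measurable_fst] measurable_component_singleton) auto
  qed measurable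
  then show ?thesis by simp
qed

lemma L_measurable_section_pair:
  assumes "ys \<in> space (obs n)"
  shows "(\<lambda>\<theta>. L n \<theta> ys) \<in> borel_measurable prior"
  using measurable_compose[OF measurable_Pair1'[OF assms, of prior] L_measurable_pair[of n]] by simp

lemma lik_Y_measurable: "(\<lambda>\<omega>. Ls n \<omega>) \<in> borel_measurable M"
  by (rule measurable_of_Y[OF _ lik_measurable]) (auto simp: depends_below_def intro!: lik_cong)

lemma model: "\<theta> \<in> Theta_lb lam q \<Longrightarrow> hmm_model lam (fst \<theta>) (snd \<theta>) \<mu>"
  using sigma_finite \<mu> by (auto simp: hmm_model_def Theta_lb_def trans_mat_lb_def)

text \<open>Data drawn from a density avoid its zero set almost surely. Positivity matters because
  the evidence bounds are relative to the true likelihood.\<close>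

lemma lik_pos_AE: "AE \<omega> in M. \<forall>n. 0 < Ls n \<omega>"
proof (subst AE_all_countable, rule allI)
  fix n :: nat
  let ?F = "\<lambda>ys. indicator {ys. lik n Qs fs \<nu>s ys = 0} ys :: ennreal"
  have [measurable]: "?F \<in> borel_measurable (obs n)"
  proof -
    have "(\<lambda>ys. if lik n Qs fs \<nu>s ys = 0 then 1 else 0 :: ennreal) \<in> borel_measurable (obs n)"
      by measurable
    then show ?thesis by (simp add: indicator_def cong: if_cong)
  qed
  have dep: "depends_below n ?F"
    unfolding depends_below_def
  proof (intro allI impI)
    fix ys ys' :: "nat \<Rightarrow> 'y" assume "\<forall>t<n. ys t = ys' t"
    then have "lik n Qs fs \<nu>s ys = lik n Qs fs \<nu>s ys'" by (intro lik_cong) auto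
    then show "?F ys = ?F ys'" by (simp add: indicator_def)
  qed
  have "(\<integral>\<^sup>+ \<omega>. ?F (\<lambda>t. Y t \<omega>) \<partial>M) = lik_exp n ?F" by (rule nn_expectation[OF dep]) measurable
  also have "\<dots> = (\<integral>\<^sup>+ ys. 0 \<partial>obs n)"
    unfolding lik_exp_def by (intro nn_integral_cong) (auto simp: indicator_def)
  finally have "(\<integral>\<^sup>+ \<omega>. ?F (\<lambda>t. Y t \<omega>) \<partial>M) = 0" by simp
  moreover have "(\<lambda>\<omega>. ?F (\<lambda>t. Y t \<omega>)) \<in> borel_measurable M"
    by (rule measurable_of_Y[OF dep]) measurable
  ultimately have "AE \<omega> in M. ?F (\<lambda>t. Y t \<omega>) = 0" by (subst (asm) nn_integral_0_iff_AE) auto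
  then show "AE \<omega> in M. 0 < Ls n \<omega>"
    by eventually_elim (use lik_nonneg in \<open>auto simp: indicator_def less_le split: if_splits\<close>)
qed

text \<open>The evidence is the marginal density of the data under the prior: by Fubini it
  integrates to 1, so it is finite almost everywhere, also under the true law, which has a density.
  This makes the quotient in \<open>posterior\<close> meaningful.\<close>

lemma evidence_finite_AE: "AE \<omega> in M. \<forall>n. (\<integral>\<^sup>+ \<theta>. ennreal (LY n \<omega> \<theta>) \<partial>prior) < top"
proof (subst AE_all_countable, rule allI)
  fix n :: nat
  interpret sigma_finite_measure lam by (rule sigma_finite)
  interpret PS: product_sigma_finite "\<lambda>_::nat. lam" by unfold_locales
  interpret PM: sigma_finite_measure "obs n" by (rule PS.sigma_finite[OF finite_lessThan])
  interpret PP: pair_sigma_finite "obs n" prior by unfold_locales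
  note [measurable] = L_measurable_pair[of n]
  let ?D = "\<lambda>ys. \<integral>\<^sup>+ \<theta>. ennreal (L n \<theta> ys) \<partial>prior"
  have Dm [measurable]: "?D \<in> borel_measurable (obs n)" by measurable
  have "(\<integral>\<^sup>+ ys. ?D ys \<partial>obs n) = (\<integral>\<^sup>+ \<theta>. \<integral>\<^sup>+ ys. ennreal (L n \<theta> ys) \<partial>obs n \<partial>prior)"
    by (rule PP.Fubini'[symmetric]) (simp add: split_beta')
  also have "\<dots> = (\<integral>\<^sup>+ \<theta>. 1 \<partial>prior)"
  proof (rule nn_integral_cong_AE)
    show "AE \<theta> in prior. (\<integral>\<^sup>+ ys. ennreal (L n \<theta> ys) \<partial>obs n) = 1"
      using support
    proof eventually_elim
      case (elim \<theta>)
      interpret th: hmm_model lam "fst \<theta>" "snd \<theta>" \<mu> by (rule model[OF elim])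
      show ?case using th.lik_exp_const[of n] by (simp add: th.lik_exp_def)
    qed
  qed
  finally have "(\<integral>\<^sup>+ ys. ?D ys \<partial>obs n) \<noteq> \<infinity>" by (simp add: Prior.emeasure_space_1)
  then have "AE ys in obs n. ?D ys \<noteq> \<infinity>" by (rule nn_integral_noteq_infinite[OF Dm])
  then have "AE ys in law n. ?D ys \<noteq> \<infinity>"
    unfolding law_def by (subst AE_density) auto
  then have "AE ys in distr M (obs n) (\<lambda>\<omega>. \<lambda>t\<in>{..<n}. Y t \<omega>). ?D ys \<noteq> \<infinity>"
    by (simp only: Y_distr)
  then have "AE \<omega> in M. ?D (\<lambda>t\<in>{..<n}. Y t \<omega>) \<noteq> \<infinity>"
    by (subst (asm) AE_distr_iff) auto
  moreover have "L n \<theta> (\<lambda>t\<in>{..<n}. Y t \<omega>) = LY n \<omega> \<theta>" for \<theta> \<omega> by (rule lik_cong) simp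
  ultimately show "AE \<omega> in M. ?D (\<lambda>t. Y t \<omega>) < top" by (simp add: less_top)
qed

text \<open>The likelihood bound holds from a time that depends on both \<omega> and \<theta>.
  Fubini exchanges the two almost-sure quantifiers, and for fixed \<omega> one common time works on
  a part of \<open>Th\<close> of positive prior mass \<kappa>; hence \<kappa> depends on
  \<omega>.\<close>

lemma evidence_lower_bound:
  assumes A1: "assumption_A1 lam prior q Qs fs" and \<beta>: "0 < \<beta>"
  shows "AE \<omega> in M. \<exists>\<kappa>>0. \<forall>\<^sub>F n in sequentially.
     ennreal (\<kappa> * exp (- \<beta> * real n) * Ls n \<omega>) \<le> (\<integral>\<^sup>+ \<theta>. ennreal (LY n \<omega> \<theta>) \<partial>prior)"
proof -
  \<comment> \<open>As \<epsilon> tends to 0 the loss rate in \<open>eventually_lik_ratio\<close>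
    tends to 4 a, here \<beta> / 2 < \<beta>.\<close>
  define a where "a = \<beta> / 8"
  have a: "0 < a" using \<beta> by (simp add: a_def)
  obtain \<epsilon>0 where \<epsilon>0: "\<epsilon>0 > 0" and A1': "\<And>\<epsilon>. 0 < \<epsilon> \<Longrightarrow> \<epsilon> < \<epsilon>0 \<Longrightarrow>
     \<exists>Th. Th \<in> sets prior \<and> Th \<subseteq> Theta_lb lam q \<and> emeasure prior Th > 0 \<and> (\<forall>(Q, f)\<in>Th. A1_cond lam q Qs fs \<epsilon> Q f)"
    using A1 unfolding assumption_A1_def by blast
  have "((\<lambda>\<epsilon>. 4 * (\<epsilon> + a + 2 * \<epsilon> / a) - ln (1 - \<epsilon> / q)) \<longlongrightarrow> 4 * (0 + a + 2 * 0 / a) - ln (1 - 0 / q)) (at_right 0)"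
    using a q by (intro tendsto_intros) auto
  then have "\<forall>\<^sub>F \<epsilon> in at_right 0. 4 * (\<epsilon> + a + 2 * \<epsilon> / a) - ln (1 - \<epsilon> / q) < \<beta>"
    by (rule order_tendstoD(2)) (use \<beta> in \<open>simp add: a_def\<close>)
  moreover have "\<forall>\<^sub>F \<epsilon> in at_right 0. \<epsilon> \<in> {0<..<min \<epsilon>0 q}"
    using \<epsilon>0 q by (intro eventually_at_right_real) auto
  ultimately have "\<forall>\<^sub>F \<epsilon> in at_right (0::real). 4 * (\<epsilon> + a + 2 * \<epsilon> / a) - ln (1 - \<epsilon> / q) < \<beta> \<and> \<epsilon> \<in> {0<..<min \<epsilon>0 q}"
    by (rule eventually_conj)
  then obtain \<epsilon> where \<epsilon>: "4 * (\<epsilon> + a + 2 * \<epsilon> / a) - ln (1 - \<epsilon> / q) < \<beta>" "0 < \<epsilon>" "\<epsilon> < \<epsilon>0" "\<epsilon> < q"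
    using eventually_happens[of _ "at_right (0::real)"] by (auto simp: trivial_limit_at_right_real)
  obtain Th where Th [measurable]: "Th \<in> sets prior" and Th': "Th \<subseteq> Theta_lb lam q" "emeasure prior Th > 0"
    and cond: "\<forall>(Q, f)\<in>Th. A1_cond lam q Qs fs \<epsilon> Q f"
    using A1'[OF \<epsilon>(2,3)] by blast
  let ?ok = "\<lambda>\<omega> \<theta> n. exp (- \<beta> * real n) * Ls n \<omega> \<le> LY n \<omega> \<theta>"
  let ?P = "\<lambda>\<omega> \<theta>. \<theta> \<in> Th \<longrightarrow> (\<exists>m. \<forall>n\<ge>m. ?ok \<omega> \<theta> n)"
  have "AE \<omega> in M. ?P \<omega> \<theta>" for \<theta>
  proof (cases "\<theta> \<in> Th")
    case True
    obtain Q f where \<theta>: "\<theta> = (Q, f)" by fastforce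
    have tl: "trans_mat Q" "f \<in> dens_tuples lam" using True Th' by (auto simp: \<theta> Theta_lb_def trans_mat_lb_def)
    have c: "A1_cond lam q Qs fs \<epsilon> Q f" using cond True \<theta> by blast
    have close: "\<bar>Q$i$j - Qs$i$j\<bar> \<le> \<epsilon>" for i j
      using mat_entry_le_maxnorm[of "Q - Qs" i j] c by (simp add: A1_cond_def)
    have KL: "ext_integral lam (\<lambda>y. ereal (fs i y) * Max (range (\<lambda>j. log_ratio (fs j y) (f j y)))) < ereal \<epsilon>" for i
      using c by (simp add: A1_cond_def)
    have "AE \<omega> in M. \<forall>\<^sub>F n in sequentially. ?ok \<omega> \<theta> n"
      unfolding \<theta> fst_conv snd_conv
      by (rule eventually_lik_ratio[OF tl \<mu> q lb \<epsilon>(2,4) a close KL \<epsilon>(1)])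
    then show ?thesis by (simp add: eventually_sequentially)
  qed simp
  then have "AE \<theta> in prior. AE \<omega> in M. ?P \<omega> \<theta>" by simp
  moreover interpret PP: pair_sigma_finite M prior by unfold_locales
  have "{x \<in> space (M \<Otimes>\<^sub>M prior). ?P (fst x) (snd x)} \<in> sets (M \<Otimes>\<^sub>M prior)"
  proof -
    note [measurable] = L_measurable_Y measurable_compose[OF measurable_fst lik_Y_measurable]
    show ?thesis by measurable
  qed
  ultimately have "AE \<omega> in M. AE \<theta> in prior. ?P \<omega> \<theta>" using PP.AE_commute[of ?P] by blast
  moreover have "AE \<omega> in M. \<omega> \<in> space M" by simp
  ultimately show ?thesis
  proof eventually_elim
    case (elim \<omega>)
    note [measurable] = L_measurable_section[OF elim(2)]
    \<comment> \<open>These sets increase with m and exhaust \<open>Th\<close> up to a null set, so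
      they cannot all be null.\<close>
    define Tm where "Tm m = {\<theta>\<in>space prior. \<theta> \<in> Th \<and> (\<forall>n\<ge>m. ?ok \<omega> \<theta> n)}" for m
    have [measurable]: "Tm m \<in> sets prior" for m unfolding Tm_def by measurable
    have "\<exists>m. emeasure prior (Tm m) \<noteq> 0"
    proof (rule ccontr)
      assume "\<nexists>m. emeasure prior (Tm m) \<noteq> 0"
      then have "AE \<theta> in prior. \<theta> \<notin> Tm m" for m by (intro AE_not_in) (auto simp: null_sets_def)
      then have "AE \<theta> in prior. \<forall>m. \<theta> \<notin> Tm m" by (simp add: AE_all_countable)
      moreover have "AE \<theta> in prior. \<theta> \<in> space prior" by simp
      ultimately have "AE \<theta> in prior. \<theta> \<notin> Th" using elim(1) by eventually_elim (auto simp: Tm_def)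
      then have "emeasure prior Th = 0" by (simp add: AE_iff_measurable[OF Th] sets.sets_into_space[OF Th] Int_absorb1 flip: Int_def)
      then show False using Th'(2) by simp
    qed
    then obtain m where m: "emeasure prior (Tm m) \<noteq> 0" by blast
    define \<kappa> where "\<kappa> = measure prior (Tm m)"
    have \<kappa>: "0 < \<kappa>" using m by (simp add: \<kappa>_def Prior.emeasure_eq_measure less_le)
    have "ennreal (\<kappa> * exp (- \<beta> * real n) * Ls n \<omega>) \<le> (\<integral>\<^sup>+ \<theta>. ennreal (LY n \<omega> \<theta>) \<partial>prior)" if "n \<ge> m" for n
    proof -
      let ?b = "exp (- \<beta> * real n) * Ls n \<omega>"
      have "ennreal (\<kappa> * ?b) = ennreal ?b * emeasure prior (Tm m)"
        using \<kappa> lik_nonneg by (simp add: \<kappa>_def Prior.emeasure_eq_measure ennreal_mult mult.commute)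
      also have "\<dots> = (\<integral>\<^sup>+ \<theta>. ennreal ?b * indicator (Tm m) \<theta> \<partial>prior)" by (simp add: nn_integral_cmult_indicator)
      also have "\<dots> \<le> (\<integral>\<^sup>+ \<theta>. ennreal (LY n \<omega> \<theta>) \<partial>prior)"
        using that by (intro nn_integral_mono) (auto simp: indicator_def Tm_def intro!: ennreal_leI)
      finally show ?thesis by (simp add: mult.assoc)
    qed
    then show ?case using \<kappa> by (auto simp: eventually_sequentially)
  qed
qed

text \<open>Markov's inequality for the ratio of restricted evidence to true likelihood. In the
  expectation under the truth the true likelihood cancels, and Fubini leaves a prior average over B
  of probabilities of C, each at most \<delta>.\<close>

lemma restricted_evidence_tail:
  assumes B [measurable]: "B \<in> sets prior" and C [measurable]: "C \<in> sets (obs n)" and \<gamma>: "0 < \<gamma>" and \<delta>: "0 \<le> \<delta>"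
    and test: "\<And>\<theta>. \<theta> \<in> B \<Longrightarrow> \<theta> \<in> Theta_lb lam q \<Longrightarrow>
      (\<integral>\<^sup>+ ys. ennreal (L n \<theta> ys) * indicator C ys \<partial>obs n) \<le> ennreal \<delta>"
  shows "emeasure M {\<omega>\<in>space M. (\<lambda>t\<in>{..<n}. Y t \<omega>) \<in> C \<and>
      ennreal (\<gamma> * Ls n \<omega>) < (\<integral>\<^sup>+ \<theta>. ennreal (LY n \<omega> \<theta>) * indicator B \<theta> \<partial>prior)} \<le> ennreal (\<delta> / \<gamma>)"
    and "{\<omega>\<in>space M. (\<lambda>t\<in>{..<n}. Y t \<omega>) \<in> C \<and>
      ennreal (\<gamma> * Ls n \<omega>) < (\<integral>\<^sup>+ \<theta>. ennreal (LY n \<omega> \<theta>) * indicator B \<theta> \<partial>prior)} \<in> sets M"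
proof -
  let ?E = "{\<omega>\<in>space M. (\<lambda>t\<in>{..<n}. Y t \<omega>) \<in> C \<and>
      ennreal (\<gamma> * Ls n \<omega>) < (\<integral>\<^sup>+ \<theta>. ennreal (LY n \<omega> \<theta>) * indicator B \<theta> \<partial>prior)}"
  interpret sigma_finite_measure lam by (rule sigma_finite)
  interpret PS: product_sigma_finite "\<lambda>_::nat. lam" by unfold_locales
  interpret PM: sigma_finite_measure "obs n" by (rule PS.sigma_finite[OF finite_lessThan])
  interpret PP: pair_sigma_finite "obs n" prior by unfold_locales
  note [measurable] = L_measurable_pair[of n]
  let ?P = "obs n"
  let ?N = "\<lambda>ys. \<integral>\<^sup>+ \<theta>. ennreal (L n \<theta> ys) * indicator B \<theta> \<partial>prior"
  have [measurable]: "?N \<in> borel_measurable ?P" by measurable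
  let ?S = "{ys\<in>space ?P. ys \<in> C \<and> ennreal (\<gamma> * lik n Qs fs \<nu>s ys) < ?N ys}"
  have S [measurable]: "?S \<in> sets ?P" by measurable
  have eq: "?E = (\<lambda>\<omega>. \<lambda>t\<in>{..<n}. Y t \<omega>) -` ?S \<inter> space M"
  proof -
    have "L n \<theta> (\<lambda>t\<in>{..<n}. Y t \<omega>) = LY n \<omega> \<theta>"
      "lik n Qs fs \<nu>s (\<lambda>t\<in>{..<n}. Y t \<omega>) = Ls n \<omega>" for \<theta> \<omega> by (rule lik_cong; simp)+
    then show ?thesis using measurable_space[OF Y_tuple_measurable[of n]] by auto
  qed
  show "?E \<in> sets M" unfolding eq by measurable
  have "(\<integral>\<^sup>+ ys. ?N ys * indicator C ys \<partial>?P) = (\<integral>\<^sup>+ ys. \<integral>\<^sup>+ \<theta>. ennreal (L n \<theta> ys) * indicator B \<theta> * indicator C ys \<partial>prior \<partial>?P)"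
  proof (rule nn_integral_cong)
    fix ys assume "ys \<in> space ?P"
    note [measurable] = L_measurable_section_pair[OF this]
    show "?N ys * indicator C ys = (\<integral>\<^sup>+ \<theta>. ennreal (L n \<theta> ys) * indicator B \<theta> * indicator C ys \<partial>prior)"
      by (subst nn_integral_multc) auto
  qed
  also have "\<dots> = (\<integral>\<^sup>+ \<theta>. \<integral>\<^sup>+ ys. ennreal (L n \<theta> ys) * indicator B \<theta> * indicator C ys \<partial>?P \<partial>prior)"
    by (rule PP.Fubini'[symmetric]) (simp add: split_beta')
  also have "\<dots> \<le> (\<integral>\<^sup>+ \<theta>. ennreal \<delta> \<partial>prior)"
  proof (rule nn_integral_mono_AE)
    show "AE \<theta> in prior. (\<integral>\<^sup>+ ys. ennreal (L n \<theta> ys) * indicator B \<theta> * indicator C ys \<partial>?P) \<le> ennreal \<delta>"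
      using support
    proof eventually_elim
      case (elim \<theta>)
      then show ?case using test[of \<theta>] by (cases "\<theta> \<in> B") auto
    qed
  qed
  also have "\<dots> = ennreal \<delta>" by (simp add: Prior.emeasure_space_1)
  finally have N: "(\<integral>\<^sup>+ ys. ?N ys * indicator C ys \<partial>?P) \<le> ennreal \<delta>" .
  have "emeasure M ?E = emeasure (distr M ?P (\<lambda>\<omega>. \<lambda>t\<in>{..<n}. Y t \<omega>)) ?S"
    unfolding eq by (intro emeasure_distr[symmetric]) measurable
  also have "\<dots> = (\<integral>\<^sup>+ ys. ennreal (lik n Qs fs \<nu>s ys) * indicator ?S ys \<partial>?P)"
    unfolding Y_distr law_def by (subst emeasure_density) auto
  also have "\<dots> \<le> (\<integral>\<^sup>+ ys. ennreal (1 / \<gamma>) * (?N ys * indicator C ys) \<partial>?P)"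
  proof (intro nn_integral_mono)
    fix ys
    show "ennreal (lik n Qs fs \<nu>s ys) * indicator ?S ys \<le> ennreal (1 / \<gamma>) * (?N ys * indicator C ys)"
    proof (cases "ys \<in> ?S")
      case True
      then have "ennreal (1 / \<gamma>) * ennreal (\<gamma> * lik n Qs fs \<nu>s ys) \<le> ennreal (1 / \<gamma>) * ?N ys"
        by (intro mult_left_mono) auto
      moreover have "ennreal (1 / \<gamma>) * ennreal (\<gamma> * lik n Qs fs \<nu>s ys) = ennreal (lik n Qs fs \<nu>s ys)"
        using \<gamma> lik_nonneg by (subst ennreal_mult[symmetric]) auto
      ultimately show ?thesis using True by simp
    qed simp
  qed
  also have "\<dots> = ennreal (1 / \<gamma>) * (\<integral>\<^sup>+ ys. ?N ys * indicator C ys \<partial>?P)" by (subst nn_integral_cmult) auto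
  also have "\<dots> \<le> ennreal (1 / \<gamma>) * ennreal \<delta>" by (intro mult_left_mono N) simp
  also have "\<dots> = ennreal (\<delta> / \<gamma>)" using \<gamma> \<delta> by (subst ennreal_mult[symmetric]) auto
  finally show "emeasure M ?E \<le> ennreal (\<delta> / \<gamma>)" .
qed

text \<open>A may fail to be measurable, so its mass is estimated from below through the measurable
  complement of B, which lies in A up to a prior null set. Relative to the true likelihood the
  evidence decays at most at rate \<rho> / 2 and its part in B at rate \<rho>, so their ratio
  vanishes.\<close>

lemma posterior_tendsto_1:
  assumes A1: "assumption_A1 lam prior q Qs fs" and \<rho>: "0 < \<rho>" and B [measurable]: "B \<in> sets prior"
    and good: "\<And>\<theta>. \<theta> \<in> Theta_lb lam q \<Longrightarrow> \<theta> \<notin> B \<Longrightarrow> \<theta> \<in> space prior \<Longrightarrow> \<theta> \<in> A"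
    and num: "AE \<omega> in M. \<forall>\<^sub>F n in sequentially.
       (\<integral>\<^sup>+ \<theta>. ennreal (LY n \<omega> \<theta>) * indicator B \<theta> \<partial>prior) \<le> ennreal (c * exp (- \<rho> * real n) * Ls n \<omega>)"
    and c: "0 < c"
  shows "AE \<omega> in M. (\<lambda>n. posterior prior \<mu> n (\<lambda>t. Y t \<omega>) A) \<longlonglongrightarrow> 1"
proof -
  have "AE \<omega> in M. \<exists>\<kappa>>0. \<forall>\<^sub>F n in sequentially.
     ennreal (\<kappa> * exp (- (\<rho> / 2) * real n) * Ls n \<omega>) \<le> (\<integral>\<^sup>+ \<theta>. ennreal (LY n \<omega> \<theta>) \<partial>prior)"
    using evidence_lower_bound[OF A1, of "\<rho> / 2"] \<rho> by simp
  moreover have "AE \<omega> in M. \<omega> \<in> space M" by simp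
  ultimately show ?thesis using num lik_pos_AE evidence_finite_AE
  proof eventually_elim
    case (elim \<omega>)
    note [measurable] = L_measurable_section[OF elim(2)]
    let ?l = "\<lambda>n. Ls n \<omega>"
    let ?D = "\<lambda>n. \<integral>\<^sup>+ \<theta>. ennreal (LY n \<omega> \<theta>) \<partial>prior"
    let ?N = "\<lambda>n. \<integral>\<^sup>+ \<theta>. ennreal (LY n \<omega> \<theta>) * indicator B \<theta> \<partial>prior"
    let ?X = "\<lambda>n. \<integral>\<^sup>+ \<theta>. ennreal (LY n \<omega> \<theta>) * indicator A \<theta> \<partial>prior"
    obtain \<kappa> where \<kappa>: "\<kappa> > 0" "\<forall>\<^sub>F n in sequentially. ennreal (\<kappa> * exp (- (\<rho> / 2) * real n) * ?l n) \<le> ?D n"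
      using elim(1) by blast
    have "\<forall>\<^sub>F n in sequentially. 1 - c / \<kappa> * exp (- (\<rho> / 2) * real n) \<le> posterior prior \<mu> n (\<lambda>t. Y t \<omega>) A \<and> posterior prior \<mu> n (\<lambda>t. Y t \<omega>) A \<le> 1"
      using \<kappa>(2) elim(3)
    proof eventually_elim
      case (elim n)
      have D: "?D n \<noteq> top" using \<open>\<forall>n. ?D n < top\<close> by (auto simp: less_top)
      then obtain d where d: "?D n = ennreal d" "0 \<le> d" by (cases "?D n") auto
      have l: "0 < ?l n" using \<open>\<forall>n. 0 < ?l n\<close> by blast
      have lo: "\<kappa> * exp (- (\<rho> / 2) * real n) * ?l n \<le> d" using elim(1) d by (simp add: ennreal_le_iff)
      moreover have "0 < \<kappa> * exp (- (\<rho> / 2) * real n) * ?l n" using \<kappa>(1) l by simp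
      ultimately have d0: "0 < d" by linarith
      have "?X n \<le> ?D n" by (intro nn_integral_mono) (auto simp: indicator_def)
      then obtain x where x: "?X n = ennreal x" "0 \<le> x" "x \<le> d" using d by (cases "?X n") (auto simp: top_unique)
      let ?\<delta> = "c / \<kappa> * exp (- (\<rho> / 2) * real n)"
      have "c * exp (- \<rho> * real n) * ?l n = ?\<delta> * (\<kappa> * exp (- (\<rho> / 2) * real n) * ?l n)"
      proof -
        have "exp (- \<rho> * real n) = exp (- (\<rho> / 2) * real n) * exp (- (\<rho> / 2) * real n)" by (simp add: exp_add[symmetric])
        then show ?thesis using \<kappa>(1) by simp
      qed
      also have "\<dots> \<le> ?\<delta> * d" using lo \<kappa>(1) c by (intro mult_left_mono) auto
      finally have "?N n \<le> ennreal (?\<delta> * d)" using elim(2) by (meson ennreal_leI order_trans)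
      moreover have "?D n \<le> ?X n + ?N n"
      proof -
        have "?D n = (\<integral>\<^sup>+ \<theta>. ennreal (LY n \<omega> \<theta>) * indicator (space prior - B) \<theta> + ennreal (LY n \<omega> \<theta>) * indicator B \<theta> \<partial>prior)"
          by (intro nn_integral_cong) (auto simp: indicator_def)
        also have "\<dots> = (\<integral>\<^sup>+ \<theta>. ennreal (LY n \<omega> \<theta>) * indicator (space prior - B) \<theta> \<partial>prior) + ?N n"
          by (subst nn_integral_add) auto
        also have "\<dots> \<le> ?X n + ?N n"
        proof (intro add_right_mono nn_integral_mono_AE)
          show "AE \<theta> in prior. ennreal (LY n \<omega> \<theta>) * indicator (space prior - B) \<theta> \<le> ennreal (LY n \<omega> \<theta>) * indicator A \<theta>"
            using support
          proof eventually_elim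
            case (elim \<theta>)
            then show ?case using good[of \<theta>] by (simp add: indicator_def)
          qed
        qed
        finally show ?thesis .
      qed
      ultimately have "?D n \<le> ?X n + ennreal (?\<delta> * d)" by (meson add_left_mono order_trans)
      then have "ennreal d \<le> ennreal x + ennreal (?\<delta> * d)" unfolding d(1) x(1) .
      moreover have "0 \<le> ?\<delta> * d" using c \<kappa>(1) d0 by simp
      ultimately have "d \<le> x + ?\<delta> * d" using x by (simp add: ennreal_plus[symmetric] del: ennreal_plus)
      then have "1 - ?\<delta> \<le> x / d" using d0 by (simp add: field_simps)
      moreover have "posterior prior \<mu> n (\<lambda>t. Y t \<omega>) A = x / d"
        unfolding posterior_def using d x d0 by (simp add: divide_ennreal)
      moreover have "x / d \<le> 1" using x d0 by simp
      ultimately show ?case by simp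
    qed
    then have ev: "\<forall>\<^sub>F n in sequentially. 1 - c / \<kappa> * exp (- (\<rho> / 2) * real n) \<le> posterior prior \<mu> n (\<lambda>t. Y t \<omega>) A"
      "\<forall>\<^sub>F n in sequentially. posterior prior \<mu> n (\<lambda>t. Y t \<omega>) A \<le> 1"
      by (auto elim: eventually_mono)
    have "(\<lambda>n. exp (- (\<rho> / 2)) ^ n) \<longlonglongrightarrow> 0" using \<rho> by (intro LIMSEQ_realpow_zero) auto
    then have "(\<lambda>n. exp (- (\<rho> / 2) * real n)) \<longlonglongrightarrow> 0"
      by (simp add: exp_of_nat_mult[symmetric] mult.commute)
    then have "(\<lambda>n. 1 - c / \<kappa> * exp (- (\<rho> / 2) * real n)) \<longlonglongrightarrow> 1 - c / \<kappa> * 0" by (intro tendsto_intros)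
    then have "(\<lambda>n. 1 - c / \<kappa> * exp (- (\<rho> / 2) * real n)) \<longlonglongrightarrow> 1" by simp
    then show ?case by (rule tendsto_sandwich[OF ev _ tendsto_const])
  qed
qed

end

section \<open>Posterior consistency\<close>

context hmm_bayes
begin

text \<open>C n is the acceptance region of a test: its complement is unlikely under the truth and C
  n itself is unlikely under every parameter in B. The rate 2 \<rho> leaves \<rho> after division by
  the threshold exp (- \<rho> n), so both kinds of failure are summable.\<close>

lemma restricted_evidence_small:
  assumes B [measurable]: "B \<in> sets prior" and C [measurable]: "\<And>n. C n \<in> sets (obs n)"
    and \<rho>: "0 < \<rho>" and K: "0 \<le> K"
    and test: "\<And>n \<theta>. \<theta> \<in> B \<Longrightarrow> \<theta> \<in> Theta_lb lam q \<Longrightarrow>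
      (\<integral>\<^sup>+ ys. ennreal (L n \<theta> ys) * indicator (C n) ys \<partial>obs n) \<le> ennreal (K * exp (- 2 * \<rho> * real n))"
    and truth: "\<And>n. emeasure (law n) (space (law n) - C n) \<le> ennreal (K * exp (- 2 * \<rho> * real n))"
  shows "AE \<omega> in M. \<forall>\<^sub>F n in sequentially.
       (\<integral>\<^sup>+ \<theta>. ennreal (LY n \<omega> \<theta>) * indicator B \<theta> \<partial>prior) \<le> ennreal (exp (- \<rho> * real n) * Ls n \<omega>)"
proof -
  have geo: "(\<Sum>n. ennreal (K * exp (- c * real n))) < \<infinity>" if "0 < c" for c
  proof -
    have "summable (\<lambda>n. K * exp (- c) ^ n)" using that by (intro summable_mult summable_geometric) auto
    then have "summable (\<lambda>n. K * exp (- c * real n))"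
      by (simp add: exp_of_nat_mult[symmetric] mult.commute)
    then show ?thesis using K by (subst suminf_ennreal2) auto
  qed
  have C_def: "{\<omega>\<in>space M. (\<lambda>t\<in>{..<n}. Y t \<omega>) \<notin> C n} = (\<lambda>\<omega>. \<lambda>t\<in>{..<n}. Y t \<omega>) -` (space (law n) - C n) \<inter> space M" for n
    using measurable_space[OF Y_tuple_measurable[of n]] by (auto simp: space_law)
  have Cm [measurable]: "{\<omega>\<in>space M. (\<lambda>t\<in>{..<n}. Y t \<omega>) \<notin> C n} \<in> sets M" for n
    unfolding C_def space_law by measurable
  have "emeasure M {\<omega>\<in>space M. (\<lambda>t\<in>{..<n}. Y t \<omega>) \<notin> C n} \<le> ennreal (K * exp (- (2 * \<rho>) * real n))" for n
  proof -
    have "emeasure M {\<omega>\<in>space M. (\<lambda>t\<in>{..<n}. Y t \<omega>) \<notin> C n} = emeasure (law n) (space (law n) - C n)"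
      unfolding C_def Y_distr[symmetric] by (intro emeasure_distr[symmetric]) auto
    then show ?thesis using truth[of n] by simp
  qed
  then have "(\<Sum>n. emeasure M {\<omega>\<in>space M. (\<lambda>t\<in>{..<n}. Y t \<omega>) \<notin> C n}) \<le> (\<Sum>n. ennreal (K * exp (- (2 * \<rho>) * real n)))"
    by (intro suminf_le) auto
  also have "\<dots> < \<infinity>" using \<rho> by (intro geo) auto
  finally have 1: "AE \<omega> in M. \<forall>\<^sub>F n in sequentially. \<omega> \<notin> {\<omega>\<in>space M. (\<lambda>t\<in>{..<n}. Y t \<omega>) \<notin> C n}"
    by (intro M.borel_cantelli_ennreal Cm)
  let ?E = "\<lambda>n. {\<omega>\<in>space M. (\<lambda>t\<in>{..<n}. Y t \<omega>) \<in> C n \<and>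
      ennreal (exp (- \<rho> * real n) * Ls n \<omega>) < (\<integral>\<^sup>+ \<theta>. ennreal (LY n \<omega> \<theta>) * indicator B \<theta> \<partial>prior)}"
  have "0 \<le> K * exp (- 2 * \<rho> * real n)" for n using K by simp
  note tail = restricted_evidence_tail[OF B C exp_gt_zero this test]
  have "emeasure M (?E n) \<le> ennreal (K * exp (- \<rho> * real n))" for n
  proof -
    have "K * exp (- 2 * \<rho> * real n) / exp (- \<rho> * real n) = K * exp (- \<rho> * real n)"
      by (simp add: exp_diff[symmetric] exp_minus[symmetric] field_simps exp_add[symmetric])
    then show ?thesis using tail(1)[of n "- \<rho> * real n"] by (simp only:)
  qed
  then have "(\<Sum>n. emeasure M (?E n)) \<le> (\<Sum>n. ennreal (K * exp (- \<rho> * real n)))" by (intro suminf_le) auto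
  also have "\<dots> < \<infinity>" by (rule geo[OF \<rho>])
  finally have 2: "AE \<omega> in M. \<forall>\<^sub>F n in sequentially. \<omega> \<notin> ?E n"
    by (intro M.borel_cantelli_ennreal tail(2))
  have "AE \<omega> in M. \<omega> \<in> space M" by simp
  with 1 2 show ?thesis
  proof eventually_elim
    case (elim \<omega>)
    from elim(1,2) show ?case
      by eventually_elim (use elim(3) in \<open>simp add: not_less\<close>)
  qed
qed

text \<open>The state i stands in for the unknown state before the gap; by mixing, another choice
  changes the value by at most the mixing error.\<close>

definition block_mean :: "nat \<Rightarrow> 'k \<Rightarrow> ('y \<Rightarrow> real) \<Rightarrow> ('y \<Rightarrow> real) \<Rightarrow> ('y \<Rightarrow> real) \<Rightarrow> (real^'k^'k) \<times> ('k \<Rightarrow> 'y \<Rightarrow> real) \<Rightarrow> real" where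
  "block_mean m i h1 h2 h3 \<theta> = tri_mean (fst \<theta>) (mpow (fst \<theta>) m i)
     (emis_mean lam (snd \<theta>) h1) (emis_mean lam (snd \<theta>) h2) (emis_mean lam (snd \<theta>) h3)"

lemma emis_mean_measurable:
  assumes [measurable]: "h \<in> borel_measurable lam"
  shows "(\<lambda>\<theta>. emis_mean lam (snd \<theta>) h x) \<in> borel_measurable prior"
proof -
  interpret sigma_finite_measure lam by (rule sigma_finite)
  have [measurable]: "(\<lambda>z. snd (fst z) x (snd z)) \<in> borel_measurable (prior \<Otimes>\<^sub>M lam)"
    by (rule emission_measurable) measurable
  show ?thesis unfolding emis_mean_def by measurable
qed

lemma mpow_measurable: "(\<lambda>\<theta>. mpow (fst \<theta>) m i j) \<in> borel_measurable prior"
proof (induction m arbitrary: j)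
  case (Suc m)
  note [measurable] = Suc
  show ?case unfolding mpow.simps by measurable
qed simp

lemma block_mean_measurable:
  assumes "h1 \<in> borel_measurable lam" "h2 \<in> borel_measurable lam" "h3 \<in> borel_measurable lam"
  shows "block_mean m i h1 h2 h3 \<in> borel_measurable prior"
proof -
  note [measurable] = emis_mean_measurable[OF assms(1)] emis_mean_measurable[OF assms(2)] emis_mean_measurable[OF assms(3)] mpow_measurable
  show ?thesis unfolding block_mean_def tri_mean_def by measurable
qed

text \<open>Rounding n down to complete blocks loses less than one block, which costs the constant
  exp (\<eta>^2 / 4). The exponent is written as 2 \<rho> to fit the testing lemma.\<close>

lemma block_rate:
  fixes \<eta> :: real
  shows "exp (- real (n div (m + 3)) * \<eta>\<^sup>2 / 4) \<le> exp (\<eta>\<^sup>2 / 4) * exp (- 2 * (\<eta>\<^sup>2 / (8 * real (m + 3))) * real n)"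
proof -
  have "n < (n div (m + 3) + 1) * (m + 3)"
    using dividend_less_div_times[of "m + 3" n] by (simp add: algebra_simps)
  then have "real n \<le> real ((n div (m + 3) + 1) * (m + 3))" by (simp only: of_nat_le_iff less_imp_le)
  then have "real n \<le> (real (n div (m + 3)) + 1) * real (m + 3)" by (simp only: of_nat_mult of_nat_add of_nat_1)
  then have "real n / real (m + 3) \<le> real (n div (m + 3)) + 1" by (simp add: divide_le_eq)
  then have "\<eta>\<^sup>2 / 4 * (real n / real (m + 3)) \<le> \<eta>\<^sup>2 / 4 * (real (n div (m + 3)) + 1)" by (intro mult_left_mono) auto
  moreover have "2 * (\<eta>\<^sup>2 / (8 * real (m + 3))) * real n = \<eta>\<^sup>2 / 4 * (real n / real (m + 3))" by (simp add: field_simps)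
  ultimately have "- real (n div (m + 3)) * \<eta>\<^sup>2 / 4 \<le> \<eta>\<^sup>2 / 4 + - 2 * (\<eta>\<^sup>2 / (8 * real (m + 3))) * real n"
    by (simp add: algebra_simps)
  then show ?thesis unfolding exp_add[symmetric] by simp
qed

text \<open>Up to exponentially small probability, the sample average of the blocks lies within 2
  \<eta> of the block mean under every admissible parameter, so means at distance 4 \<eta> are
  separated by a threshold halfway. The two signs of the difference are tested separately, which
  gives the factor 2.\<close>

lemma block_mean_test:
  assumes h [measurable]: "h1 \<in> borel_measurable lam" "h2 \<in> borel_measurable lam" "h3 \<in> borel_measurable lam"
    and h01: "\<And>y. 0 \<le> h1 y" "\<And>y. h1 y \<le> 1" "\<And>y. 0 \<le> h2 y" "\<And>y. h2 y \<le> 1" "\<And>y. 0 \<le> h3 y" "\<And>y. h3 y \<le> 1"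
    and \<eta>: "0 < \<eta>" "\<eta> \<le> 1" and \<epsilon>: "2 * (1 - real CARD('k) * q) ^ m \<le> \<eta>"
    and B: "B = {\<theta>\<in>space prior. 4 * \<eta> \<le> \<bar>block_mean m i h1 h2 h3 \<theta> - block_mean m i h1 h2 h3 (Qs, fs)\<bar>}"
  shows "AE \<omega> in M. \<forall>\<^sub>F n in sequentially.
       (\<integral>\<^sup>+ \<theta>. ennreal (LY n \<omega> \<theta>) * indicator B \<theta> \<partial>prior)
        \<le> ennreal (2 * exp (- (\<eta>\<^sup>2 / (8 * real (m + 3))) * real n) * Ls n \<omega>)"
proof -
  let ?T = "block_mean m i h1 h2 h3" and ?Ts = "block_mean m i h1 h2 h3 (Qs, fs)"
  let ?\<rho> = "\<eta>\<^sup>2 / (8 * real (m + 3))"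
  let ?N = "\<lambda>n. n div (m + 3)"
  let ?S = "\<lambda>n ys. \<Sum>j<?N n. blk m h1 h2 h3 j ys"
  let ?P = "\<lambda>n. obs n"
  have \<rho>: "0 < ?\<rho>" using \<eta> by simp
  have nN: "?N n * (m + 3) \<le> n" for n by (simp add: div_times_less_eq_dividend)
  note [measurable] = block_mean_measurable[OF h, of m i]
  have Sm [measurable]: "?S n \<in> borel_measurable (?P n)" for n
  proof (intro borel_measurable_sum blk_measurable h)
    fix j assume "j \<in> {..<?N n}"
    then have "Suc j * (m + 3) \<le> ?N n * (m + 3)" by (intro mult_le_mono1) auto
    then show "Suc j * (m + 3) \<le> n" using nN[of n] by linarith
  qed
  define Bp where "Bp = {\<theta>\<in>space prior. ?Ts + 4 * \<eta> \<le> ?T \<theta>}"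
  define Bm where "Bm = {\<theta>\<in>space prior. ?T \<theta> \<le> ?Ts - 4 * \<eta>}"
  have [measurable]: "Bp \<in> sets prior" "Bm \<in> sets prior" unfolding Bp_def Bm_def by measurable
  define Cp where "Cp n = {ys\<in>space (?P n). ?S n ys < real (?N n) * (?Ts + 2 * \<eta>)}" for n
  define Cm where "Cm n = {ys\<in>space (?P n). real (?N n) * (?Ts - 2 * \<eta>) < ?S n ys}" for n
  have [measurable]: "Cp n \<in> sets (?P n)" "Cm n \<in> sets (?P n)" for n unfolding Cp_def Cm_def by measurable
  have Ts: "?Ts = tri_mean Qs (mpow Qs m i) (emis_mean lam fs h1) (emis_mean lam fs h2) (emis_mean lam fs h3)"
    by (simp add: block_mean_def)
  note dev = blk_sum_deviation[OF h h01 nN lb Ts \<eta> \<epsilon>]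
  have dev': "emeasure (hmm_model.law lam (fst \<theta>) (snd \<theta>) \<mu> n) {ys\<in>space (?P n). real (?N n) * (?T \<theta> + 2 * \<eta>) \<le> ?S n ys} \<le> ennreal (exp (- real (?N n) * \<eta>\<^sup>2 / 4))"
    "emeasure (hmm_model.law lam (fst \<theta>) (snd \<theta>) \<mu> n) {ys\<in>space (?P n). ?S n ys \<le> real (?N n) * (?T \<theta> - 2 * \<eta>)} \<le> ennreal (exp (- real (?N n) * \<eta>\<^sup>2 / 4))"
    and law': "(\<integral>\<^sup>+ ys. ennreal (L n \<theta> ys) * indicator A ys \<partial>?P n) \<le> emeasure (hmm_model.law lam (fst \<theta>) (snd \<theta>) \<mu> n) A'"
    if "\<theta> \<in> Theta_lb lam q" "A \<subseteq> A'" "A' \<in> sets (?P n)" for \<theta> n A A'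
  proof -
    interpret th: hmm_model lam "fst \<theta>" "snd \<theta>" \<mu> by (rule model[OF that(1)])
    have lb': "trans_mat_lb q (fst \<theta>)" using that(1) by (auto simp: Theta_lb_def)
    show "emeasure (th.law n) {ys\<in>space (?P n). real (?N n) * (?T \<theta> + 2 * \<eta>) \<le> ?S n ys} \<le> ennreal (exp (- real (?N n) * \<eta>\<^sup>2 / 4))"
      "emeasure (th.law n) {ys\<in>space (?P n). ?S n ys \<le> real (?N n) * (?T \<theta> - 2 * \<eta>)} \<le> ennreal (exp (- real (?N n) * \<eta>\<^sup>2 / 4))"
      using th.blk_sum_deviation[OF h h01 nN lb' block_mean_def \<eta> \<epsilon>] by (simp_all only: th.space_law)
    have "(\<integral>\<^sup>+ ys. ennreal (L n \<theta> ys) * indicator A ys \<partial>?P n) \<le> (\<integral>\<^sup>+ ys. ennreal (L n \<theta> ys) * indicator A' ys \<partial>?P n)"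
      using that(2) by (intro nn_integral_mono mult_left_mono) (auto simp: indicator_def)
    also have "\<dots> = emeasure (th.law n) A'" unfolding th.law_def using that(3) by (subst emeasure_density) auto
    finally show "(\<integral>\<^sup>+ ys. ennreal (L n \<theta> ys) * indicator A ys \<partial>?P n) \<le> emeasure (th.law n) A'" .
  qed
  have rate: "x \<le> ennreal (exp (\<eta>\<^sup>2 / 4) * exp (- 2 * ?\<rho> * real n))" if "x \<le> ennreal (exp (- real (?N n) * \<eta>\<^sup>2 / 4))" for x n
    by (rule order_trans[OF that ennreal_leI[OF block_rate]])
  have "AE \<omega> in M. \<forall>\<^sub>F n in sequentially.
       (\<integral>\<^sup>+ \<theta>. ennreal (LY n \<omega> \<theta>) * indicator Bp \<theta> \<partial>prior) \<le> ennreal (exp (- ?\<rho> * real n) * Ls n \<omega>)"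
  proof (rule restricted_evidence_small[where C = Cp and K = "exp (\<eta>\<^sup>2 / 4)"])
    fix n \<theta> assume \<theta>: "\<theta> \<in> Bp" "\<theta> \<in> Theta_lb lam q"
    have "real (?N n) * (?Ts + 2 * \<eta>) \<le> real (?N n) * (?T \<theta> - 2 * \<eta>)" using \<theta>(1) by (intro mult_left_mono) (auto simp: Bp_def)
    then have sub: "Cp n \<subseteq> {ys\<in>space (?P n). ?S n ys \<le> real (?N n) * (?T \<theta> - 2 * \<eta>)}" by (auto simp: Cp_def)
    show "(\<integral>\<^sup>+ ys. ennreal (L n \<theta> ys) * indicator (Cp n) ys \<partial>?P n) \<le> ennreal (exp (\<eta>\<^sup>2 / 4) * exp (- 2 * ?\<rho> * real n))"
      by (rule rate, rule order_trans[OF law'[OF \<theta>(2) sub] dev'(2)[OF \<theta>(2) sub]]) measurable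
  next
    fix n
    have "space (law n) - Cp n = {ys\<in>space (law n). real (?N n) * (?Ts + 2 * \<eta>) \<le> ?S n ys}"
      by (auto simp: Cp_def space_law)
    then show "emeasure (law n) (space (law n) - Cp n) \<le> ennreal (exp (\<eta>\<^sup>2 / 4) * exp (- 2 * ?\<rho> * real n))"
      using rate[OF dev(1)[of n]] by simp
  qed (use \<rho> in auto)
  moreover have "AE \<omega> in M. \<forall>\<^sub>F n in sequentially.
       (\<integral>\<^sup>+ \<theta>. ennreal (LY n \<omega> \<theta>) * indicator Bm \<theta> \<partial>prior) \<le> ennreal (exp (- ?\<rho> * real n) * Ls n \<omega>)"
  proof (rule restricted_evidence_small[where C = Cm and K = "exp (\<eta>\<^sup>2 / 4)"])
    fix n \<theta> assume \<theta>: "\<theta> \<in> Bm" "\<theta> \<in> Theta_lb lam q"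
    have "real (?N n) * (?T \<theta> + 2 * \<eta>) \<le> real (?N n) * (?Ts - 2 * \<eta>)" using \<theta>(1) by (intro mult_left_mono) (auto simp: Bm_def)
    then have sub: "Cm n \<subseteq> {ys\<in>space (?P n). real (?N n) * (?T \<theta> + 2 * \<eta>) \<le> ?S n ys}" by (auto simp: Cm_def)
    show "(\<integral>\<^sup>+ ys. ennreal (L n \<theta> ys) * indicator (Cm n) ys \<partial>?P n) \<le> ennreal (exp (\<eta>\<^sup>2 / 4) * exp (- 2 * ?\<rho> * real n))"
      by (rule rate, rule order_trans[OF law'[OF \<theta>(2) sub] dev'(1)[OF \<theta>(2) sub]]) measurable
  next
    fix n
    have "space (law n) - Cm n = {ys\<in>space (law n). ?S n ys \<le> real (?N n) * (?Ts - 2 * \<eta>)}"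
      by (auto simp: Cm_def space_law)
    then show "emeasure (law n) (space (law n) - Cm n) \<le> ennreal (exp (\<eta>\<^sup>2 / 4) * exp (- 2 * ?\<rho> * real n))"
      using rate[OF dev(2)[of n]] by simp
  qed (use \<rho> in auto)
  moreover have "AE \<omega> in M. \<omega> \<in> space M" by simp
  ultimately show ?thesis
  proof eventually_elim
    case (elim \<omega>)
    note [measurable] = L_measurable_section[OF elim(3)]
    from elim(1,2) show ?case
    proof eventually_elim
      case (elim n)
      let ?l = "\<lambda>\<theta>. ennreal (LY n \<omega> \<theta>)"
      let ?b = "exp (- ?\<rho> * real n) * Ls n \<omega>"
      have b: "0 \<le> ?b" using lik_nonneg by simp
      have "(\<integral>\<^sup>+ \<theta>. ?l \<theta> * indicator B \<theta> \<partial>prior) \<le> (\<integral>\<^sup>+ \<theta>. ?l \<theta> * indicator Bp \<theta> + ?l \<theta> * indicator Bm \<theta> \<partial>prior)"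
        by (intro nn_integral_mono) (auto simp: indicator_def B Bp_def Bm_def)
      also have "\<dots> = (\<integral>\<^sup>+ \<theta>. ?l \<theta> * indicator Bp \<theta> \<partial>prior) + (\<integral>\<^sup>+ \<theta>. ?l \<theta> * indicator Bm \<theta> \<partial>prior)"
        by (intro nn_integral_add) measurable
      also have "\<dots> \<le> ennreal ?b + ennreal ?b" by (intro add_mono elim)
      also have "\<dots> = ennreal (2 * ?b)" using ennreal_plus[OF b b] by (simp only: mult_2)
      finally show ?case by (simp add: mult.assoc)
    qed
  qed
qed

text \<open>Everything specific to the weak topology is hidden in A and H: it suffices that A
  contains all admissible parameters whose matrix and finitely many emission means are r-close to
  the truth under one common relabelling.\<close>

lemma posterior_consistent:
  fixes H :: "('y \<Rightarrow> real) set" and \<phi> :: "'k \<Rightarrow> 'y \<Rightarrow> real"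
  assumes A1: "assumption_A1 lam prior q Qs fs" and Qs: "invertible Qs"
    and H: "finite H" "\<And>h. h \<in> H \<Longrightarrow> h \<in> borel_measurable lam" "\<And>h y. h \<in> H \<Longrightarrow> 0 \<le> h y" "\<And>h y. h \<in> H \<Longrightarrow> h y \<le> 1"
    and one: "(\<lambda>_. 1) \<in> H" and \<phi>: "\<And>a. \<phi> a \<in> H" and Os: "invertible (\<chi> a i. emis_mean lam fs (\<phi> a) i)"
    and r: "0 < r"
    and A: "\<And>Q f \<sigma>. (Q, f) \<in> Theta_lb lam q \<Longrightarrow> \<sigma> permutes UNIV \<Longrightarrow> (\<And>i j. \<bar>Q$(\<sigma> i)$(\<sigma> j) - Qs$i$j\<bar> < r) \<Longrightarrow>
       (\<And>h i. h \<in> H \<Longrightarrow> \<bar>emis_mean lam f h (\<sigma> i) - emis_mean lam fs h i\<bar> < r) \<Longrightarrow> (Q, f) \<in> A"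
  shows "AE \<omega> in M. (\<lambda>n. posterior prior \<mu> n (\<lambda>t. Y t \<omega>) A) \<longlonglongrightarrow> 1"
proof -
  obtain i :: 'k where True by blast
  have one_mean: "emis_mean lam f (\<lambda>_. 1) x = 1" if "f \<in> dens_tuples lam" for f and x :: 'k
    using that by (simp add: emis_mean_def dens_tuples_def is_density_def)
  obtain \<eta>0 where \<eta>0: "\<eta>0 > 0" and sep: "\<And>Q \<nu> \<nu>' v. trans_mat Q \<Longrightarrow> (\<forall>x. q \<le> \<nu> x \<and> \<nu> x \<le> 1) \<Longrightarrow> (\<forall>x. q \<le> \<nu>' x \<and> \<nu>' x \<le> 1) \<Longrightarrow>
      (\<forall>h x. 0 \<le> v h x \<and> v h x \<le> 1) \<Longrightarrow> (\<forall>x. v (\<lambda>_. 1) x = 1) \<Longrightarrow>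
      (\<forall>h1\<in>H. \<forall>h2\<in>H. \<forall>h3\<in>H. \<bar>tri_mean Q \<nu> (v h1) (v h2) (v h3) - tri_mean Qs \<nu>' (emis_mean lam fs h1) (emis_mean lam fs h2) (emis_mean lam fs h3)\<bar> < \<eta>0) \<Longrightarrow>
      (\<exists>\<sigma>. \<sigma> permutes UNIV \<and> (\<forall>i j. \<bar>Q$(\<sigma> i)$(\<sigma> j) - Qs$i$j\<bar> < r) \<and> (\<forall>h\<in>H. \<forall>i. \<bar>v h (\<sigma> i) - emis_mean lam fs h i\<bar> < r))"
    using tri_mean_separation[where H = H and vs = "emis_mean lam fs" and Qs = Qs and e = "\<lambda>_. 1" and \<phi> = \<phi> and q = q and r = r,
        OF H(1) q r one one_mean[OF dens] \<phi> Os Qs trans_mat] by metis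
  \<comment> \<open>Parameters outside all bad sets have block means within 4 \<eta> \<le> \<eta>0
    of the truth, as the separation requires.\<close>
  define \<eta> where "\<eta> = min 1 (\<eta>0 / 4)"
  have \<eta>: "0 < \<eta>" "\<eta> \<le> 1" "4 * \<eta> \<le> \<eta>0" using \<eta>0 by (auto simp: \<eta>_def)
  have kq: "0 \<le> 1 - real CARD('k) * q" "1 - real CARD('k) * q < 1"
    using card_times_lb_le_1[OF lb] q by auto
  obtain m0 where m0: "(1 - real CARD('k) * q) ^ m0 < \<eta> / 2"
    using real_arch_pow_inv[of "\<eta> / 2" "1 - real CARD('k) * q"] \<eta> kq by auto
  \<comment> \<open>The extra step makes every entry of row i at least q, so that both block laws
    satisfy the bounds demanded by the separation.\<close>
  define m where "m = Suc m0"
  have "(1 - real CARD('k) * q) ^ m \<le> (1 - real CARD('k) * q) ^ m0"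
    unfolding m_def using kq by (intro power_decreasing) auto
  then have \<epsilon>: "2 * (1 - real CARD('k) * q) ^ m \<le> \<eta>" using m0 by simp
  define Bad where "Bad p = {\<theta>\<in>space prior. 4 * \<eta> \<le> \<bar>block_mean m i (fst p) (fst (snd p)) (snd (snd p)) \<theta>
      - block_mean m i (fst p) (fst (snd p)) (snd (snd p)) (Qs, fs)\<bar>}" for p
  let ?I = "H \<times> H \<times> H"
  have finI: "finite ?I" using H by auto
  have Bad_sets: "Bad p \<in> sets prior" if "p \<in> ?I" for p
  proof -
    have [measurable]: "block_mean m i (fst p) (fst (snd p)) (snd (snd p)) \<in> borel_measurable prior"
      using that H by (intro block_mean_measurable) auto
    show ?thesis unfolding Bad_def by measurable
  qed
  let ?\<rho> = "\<eta>\<^sup>2 / (8 * real (m + 3))"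
  let ?l = "\<lambda>n \<omega> \<theta>. ennreal (LY n \<omega> \<theta>)"
  have "AE \<omega> in M. \<forall>\<^sub>F n in sequentially.
       (\<integral>\<^sup>+ \<theta>. ?l n \<omega> \<theta> * indicator (Bad p) \<theta> \<partial>prior) \<le> ennreal (2 * exp (- ?\<rho> * real n) * Ls n \<omega>)"
    if "p \<in> ?I" for p
    by (rule block_mean_test[OF _ _ _ _ _ _ _ _ _ \<eta>(1,2) \<epsilon> Bad_def]) (use that H in auto)
  then have "AE \<omega> in M. \<forall>p\<in>?I. \<forall>\<^sub>F n in sequentially.
       (\<integral>\<^sup>+ \<theta>. ?l n \<omega> \<theta> * indicator (Bad p) \<theta> \<partial>prior) \<le> ennreal (2 * exp (- ?\<rho> * real n) * Ls n \<omega>)"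
    by (intro AE_finite_allI finI)
  moreover have "AE \<omega> in M. \<omega> \<in> space M" by simp
  ultimately have num: "AE \<omega> in M. \<forall>\<^sub>F n in sequentially.
       (\<integral>\<^sup>+ \<theta>. ?l n \<omega> \<theta> * indicator (\<Union>p\<in>?I. Bad p) \<theta> \<partial>prior)
         \<le> ennreal ((2 * real (card ?I)) * exp (- ?\<rho> * real n) * Ls n \<omega>)"
  proof eventually_elim
    case (elim \<omega>)
    note [measurable] = L_measurable_section[OF elim(2)]
    from elim(1) have "\<forall>\<^sub>F n in sequentially. \<forall>p\<in>?I.
       (\<integral>\<^sup>+ \<theta>. ?l n \<omega> \<theta> * indicator (Bad p) \<theta> \<partial>prior) \<le> ennreal (2 * exp (- ?\<rho> * real n) * Ls n \<omega>)"
      by (simp only: eventually_ball_finite_distrib[OF finI])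
    then show ?case
    proof eventually_elim
      case (elim n)
      have "(\<integral>\<^sup>+ \<theta>. ?l n \<omega> \<theta> * indicator (\<Union>p\<in>?I. Bad p) \<theta> \<partial>prior) \<le> (\<integral>\<^sup>+ \<theta>. (\<Sum>p\<in>?I. ?l n \<omega> \<theta> * indicator (Bad p) \<theta>) \<partial>prior)"
      proof (rule nn_integral_mono)
        fix \<theta>
        show "?l n \<omega> \<theta> * indicator (\<Union>p\<in>?I. Bad p) \<theta> \<le> (\<Sum>p\<in>?I. ?l n \<omega> \<theta> * indicator (Bad p) \<theta>)"
        proof (cases "\<theta> \<in> (\<Union>p\<in>?I. Bad p)")
          case True
          then obtain p where p: "p \<in> ?I" "\<theta> \<in> Bad p" by blast
          have "?l n \<omega> \<theta> * indicator (Bad p) \<theta> \<le> (\<Sum>p\<in>?I. ?l n \<omega> \<theta> * indicator (Bad p) \<theta>)"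
            by (rule member_le_sum[OF p(1) _ finI]) simp
          then show ?thesis using p(2) True by simp
        next
          case False
          then have z: "indicator (\<Union>p\<in>?I. Bad p) \<theta> = (0::ennreal)" by (simp only: indicator_simps not_False_eq_True)
          show ?thesis unfolding z by simp
        qed
      qed
      also have "\<dots> = (\<Sum>p\<in>?I. \<integral>\<^sup>+ \<theta>. ?l n \<omega> \<theta> * indicator (Bad p) \<theta> \<partial>prior)"
        using Bad_sets by (intro nn_integral_sum borel_measurable_times_ennreal borel_measurable_indicator) auto
      also have "\<dots> \<le> (\<Sum>p\<in>?I. ennreal (2 * exp (- ?\<rho> * real n) * Ls n \<omega>))"
        using elim by (intro sum_mono) blast
      also have "\<dots> = ennreal (real (card ?I) * (2 * exp (- ?\<rho> * real n) * Ls n \<omega>))"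
        using lik_nonneg by (simp only: sum_constant ennreal_of_nat_eq_real_of_nat, subst ennreal_mult) auto
      finally show ?case by (simp only: mult_ac)
    qed
  qed
  have card: "0 < 2 * real (card ?I)" using one finI by (auto simp: card_gt_0_iff simp del: card_cartesian_product)
  have \<rho>: "0 < ?\<rho>" using \<eta> by simp
  have UB: "(\<Union>p\<in>?I. Bad p) \<in> sets prior" using finI Bad_sets by (intro sets.finite_UN) auto
  show ?thesis
  proof (rule posterior_tendsto_1[OF A1 \<rho> _ _ _ card])
    show "(\<Union>p\<in>?I. Bad p) \<in> sets prior" using UB by simp
    show "AE \<omega> in M. \<forall>\<^sub>F n in sequentially.
       (\<integral>\<^sup>+ \<theta>. ?l n \<omega> \<theta> * indicator ((\<Union>p\<in>?I. Bad p)) \<theta> \<partial>prior)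
         \<le> ennreal ((2 * real (card ?I)) * exp (- ?\<rho> * real n) * Ls n \<omega>)"
      using num by simp
    fix \<theta> assume \<theta>: "\<theta> \<in> Theta_lb lam q" "\<theta> \<notin> (\<Union>p\<in>?I. Bad p)" "\<theta> \<in> space prior"
    obtain Q f where Qf: "\<theta> = (Q, f)" by fastforce
    have lbQ: "trans_mat_lb q Q" and df: "f \<in> dens_tuples lam" using \<theta>(1) by (auto simp: Qf Theta_lb_def)
    have tm: "trans_mat Q" using lbQ by (simp add: trans_mat_lb_def)
    interpret th: hmm_model lam Q f \<mu> using model[OF \<theta>(1)] by (simp add: Qf)
    \<comment> \<open>The value 0 outside H keeps v in [0, 1] for every index, since emission means
      are controlled only for functions in H.\<close>
    define v where "v h x = (if h \<in> H then emis_mean lam f h x else 0)" for h x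
    have close: "\<bar>tri_mean Q (mpow Q m i) (v h1) (v h2) (v h3) - tri_mean Qs (mpow Qs m i) (emis_mean lam fs h1) (emis_mean lam fs h2) (emis_mean lam fs h3)\<bar> < \<eta>0"
      if "h1 \<in> H" "h2 \<in> H" "h3 \<in> H" for h1 h2 h3
    proof -
      have "\<theta> \<notin> Bad (h1, h2, h3)" using \<theta>(2) that by blast
      then have "\<bar>block_mean m i h1 h2 h3 \<theta> - block_mean m i h1 h2 h3 (Qs, fs)\<bar> < 4 * \<eta>" using \<theta>(3) by (simp add: Bad_def)
      moreover have "v h = emis_mean lam f h" if "h \<in> H" for h using that by (auto simp: v_def)
      ultimately show ?thesis using \<eta>(3) that by (simp add: block_mean_def Qf)
    qed
    have "\<exists>\<sigma>. \<sigma> permutes UNIV \<and> (\<forall>i j. \<bar>Q$(\<sigma> i)$(\<sigma> j) - Qs$i$j\<bar> < r) \<and> (\<forall>h\<in>H. \<forall>i. \<bar>v h (\<sigma> i) - emis_mean lam fs h i\<bar> < r)"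
    proof (rule sep[OF tm])
      show "\<forall>x. q \<le> mpow Q m i x \<and> mpow Q m i x \<le> 1"
        unfolding m_def using mpow_lower_bound[OF lbQ] mpow_le_1[OF tm] by blast
      show "\<forall>x. q \<le> mpow Qs m i x \<and> mpow Qs m i x \<le> 1"
        unfolding m_def using mpow_lower_bound[OF lb] mpow_le_1[OF trans_mat] by blast
      show "\<forall>h x. 0 \<le> v h x \<and> v h x \<le> 1" using th.emis_mean H(4) by (auto simp: v_def)
      show "\<forall>x. v (\<lambda>_. 1) x = 1" using one one_mean[OF df] by (simp add: v_def)
    qed (use close in blast)
    then obtain \<sigma> where \<sigma>: "\<sigma> permutes UNIV" "\<And>i j. \<bar>Q$(\<sigma> i)$(\<sigma> j) - Qs$i$j\<bar> < r" "\<And>h i. h \<in> H \<Longrightarrow> \<bar>v h (\<sigma> i) - emis_mean lam fs h i\<bar> < r"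
      by blast
    show "\<theta> \<in> A" unfolding Qf
    proof (rule A[OF _ \<sigma>(1,2)])
      show "(Q, f) \<in> Theta_lb lam q" using \<theta>(1) by (simp add: Qf)
      show "\<bar>emis_mean lam f h (\<sigma> i) - emis_mean lam fs h i\<bar> < r" if "h \<in> H" for h i
        using \<sigma>(3)[OF that, of i] that by (simp add: v_def)
    qed
  qed
qed

end

section \<open>From test functions to weak neighbourhoods\<close>

lemma emis_mean_indicator:
  assumes "is_density lam (f x)" "S \<in> sets lam"
  shows "emis_mean lam f (indicator S) x = measure (density lam (\<lambda>y. ennreal (f x y))) S"
  using assms by (simp add: emis_mean_def measure_def emeasure_density is_density_def ennreal_indicator)

lemma prob_space_density: "is_density lam g \<Longrightarrow> prob_space (density lam (\<lambda>y. ennreal (g y)))"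
  by (intro prob_spaceI) (simp add: is_density_def emeasure_density cong: nn_integral_cong)

text \<open>Weak neighbourhoods use bounded functions of either sign, while blocks need values in
  [0, 1]; the affine map commutes with the mean because the density has mass 1.\<close>

lemma emis_mean_scaled:
  assumes f: "is_density lam (f x)" and g: "g \<in> borel_measurable lam" and b: "0 < b" "\<And>y. \<bar>g y\<bar> \<le> b"
  shows "emis_mean lam f (\<lambda>y. (g y + b) / (2 * b)) x = ((\<integral>y. g y \<partial>density lam (\<lambda>y. ennreal (f x y))) + b) / (2 * b)"
proof -
  let ?R = "density lam (\<lambda>y. ennreal (f x y))"
  interpret R: prob_space ?R by (rule prob_space_density[OF f])
  have [measurable]: "f x \<in> borel_measurable lam" using f by (simp add: is_density_def)
  note [measurable] = g
  have nn: "0 \<le> (g y + b) / (2 * b)" for y using b(1) b(2)[of y] by (simp add: abs_le_iff)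
  have ig: "integrable ?R g"
    by (rule R.integrable_const_bound[of _ b]) (use b g in auto)
  have "emis_mean lam f (\<lambda>y. (g y + b) / (2 * b)) x = enn2real (\<integral>\<^sup>+ y. ennreal ((g y + b) / (2 * b)) \<partial>?R)"
    unfolding emis_mean_def by (subst nn_integral_density) auto
  also have "\<dots> = (\<integral>y. (g y + b) / (2 * b) \<partial>?R)"
    using nn g by (intro integral_eq_nn_integral[symmetric]) auto
  also have "\<dots> = ((\<integral>y. g y \<partial>?R) + b) / (2 * b)"
    using ig R.prob_space by simp
  finally show ?thesis .
qed

text \<open>The sets in (A1) are nonempty, having positive prior mass, so they contain matrices with
  entries at least q arbitrarily close to \<open>Qs\<close>; the bound passes to the limit.\<close>

lemma A1_trans_mat_lb:
  fixes Qs :: "real^'k::finite^'k"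
  assumes A1: "assumption_A1 lam prior q Qs fs" and Qs: "trans_mat Qs"
  shows "trans_mat_lb q Qs"
proof -
  obtain \<epsilon>0 where \<epsilon>0: "\<epsilon>0 > 0" and A1': "\<And>\<epsilon>. 0 < \<epsilon> \<Longrightarrow> \<epsilon> < \<epsilon>0 \<Longrightarrow>
     \<exists>Th. Th \<subseteq> Theta_lb lam q \<and> emeasure prior Th > 0 \<and> (\<forall>(Q, f)\<in>Th. A1_cond lam q Qs fs \<epsilon> Q f)"
    using A1 unfolding assumption_A1_def by metis
  have "q \<le> Qs$i$j" for i j
  proof (rule field_le_epsilon)
    fix d :: real assume "0 < d"
    then have "0 < min d (\<epsilon>0 / 2)" "min d (\<epsilon>0 / 2) < \<epsilon>0" using \<epsilon>0 by auto
    then obtain Th where Th: "Th \<subseteq> Theta_lb lam q" "emeasure prior Th > 0"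
      "\<forall>(Q, f)\<in>Th. A1_cond lam q Qs fs (min d (\<epsilon>0 / 2)) Q f"
      using A1' by blast
    have "Th \<noteq> {}" using Th(2) by auto
    then obtain Q f where Qf: "(Q, f) \<in> Th" by auto
    then have "A1_cond lam q Qs fs (min d (\<epsilon>0 / 2)) Q f" using Th(3) by blast
    then have "\<bar>Q$i$j - Qs$i$j\<bar> < d"
      using mat_entry_le_maxnorm[of "Q - Qs" i j] by (simp add: A1_cond_def)
    moreover have "q \<le> Q$i$j" using Qf Th(1) by (auto simp: Theta_lb_def trans_mat_lb_def)
    ultimately show "q \<le> Qs$i$j + d" by linarith
  qed
  then show ?thesis using Qs by (simp add: trans_mat_lb_def)
qed

theorem theorem2:
  fixes lam :: "(real^'d) measure"
    and Qs :: "real^'k::finite^'k" and fs :: "'k \<Rightarrow> real^'d \<Rightarrow> real"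
    and piQ :: "(real^'k^'k) measure" and pif :: "('k \<Rightarrow> real^'d \<Rightarrow> real) measure"
    and \<mu> :: "'k \<Rightarrow> real" and q :: real and l :: nat
    and M :: "'\<omega> measure" and Y :: "nat \<Rightarrow> '\<omega> \<Rightarrow> real^'d"
  assumes lam: "sigma_finite_measure lam" "sets lam = sets borel"
    and Qs: "trans_mat Qs" and fs: "fs \<in> dens_tuples lam"
    and lin_indep: "\<forall>c :: 'k \<Rightarrow> real. (\<forall>A\<in>sets borel.
                 (\<Sum>i\<in>UNIV. c i * measure (density lam (\<lambda>y. ennreal (fs i y))) A) = 0)
               \<longrightarrow> (\<forall>i. c i = 0)"
    and full_rank: "rank Qs = CARD('k)"
    and q: "q > 0" and \<mu>: "prob_vec \<mu>" "\<forall>i. \<mu> i \<ge> q"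
    and piQ: "prob_space piQ" "sets piQ = sets borel"
    and pif: "prob_space pif"
    and pif_meas: "\<forall>j. (\<lambda>(y, f). f j y) \<in> borel_measurable (lam \<Otimes>\<^sub>M pif)"
    and support: "AE \<theta> in piQ \<Otimes>\<^sub>M pif. \<theta> \<in> Theta_lb lam q"
    and A1: "assumption_A1 lam (piQ \<Otimes>\<^sub>M pif) q Qs fs"
    and l: "l \<ge> 3" and A2: "assumption_A2 lam pif q l"
    and M: "prob_space M"
    and Y_meas: "\<forall>t. Y t \<in> borel_measurable M"
    and Y_law: "\<forall>n. distr M (PiM {..<n} (\<lambda>_. borel)) (\<lambda>\<omega>. \<lambda>t\<in>{..<n}. Y t \<omega>)
                    = density (PiM {..<n} (\<lambda>_. lam))
                        (\<lambda>ys. ennreal (lik n Qs fs (stat_dist Qs) ys))"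
    and UQ: "norm_nhd Qs UQ"
    and Uf: "\<forall>i. weak_nhd (density lam (\<lambda>y. ennreal (fs i y))) (Uf i)"
  shows "AE \<omega> in M. (\<lambda>n. posterior (piQ \<Otimes>\<^sub>M pif) \<mu> n (\<lambda>t. Y t \<omega>)
            {(Q, f). \<exists>\<sigma>. \<sigma> permutes (UNIV :: 'k set) \<and>
                 (\<chi> i j. Q$(\<sigma> i)$(\<sigma> j)) \<in> UQ \<and>
                 (\<forall>i. density lam (\<lambda>y. ennreal (f (\<sigma> i) y)) \<in> Uf i)})
          \<longlonglongrightarrow> 1"
proof -
  note [measurable_cong] = lam(2)
  have lb: "trans_mat_lb q Qs" by (rule A1_trans_mat_lb[OF A1 Qs])
  have init: "prob_vec (stat_dist Qs)" by (rule prob_vec_stat_dist[OF lb q])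
  interpret hmm_model lam Qs fs "stat_dist Qs" by (rule hmm_model.intro) fact+
  have Ym: "Y t \<in> measurable M lam" for t
    using Y_meas measurable_cong_sets[OF refl lam(2), of M] by simp
  \<comment> \<open>The hypothesis uses products of the Borel space and the locale products of
    \<open>lam\<close>; an image measure depends on its target only through the measurable
    sets.\<close>
  have Yd: "distr M (PiM {..<n} (\<lambda>_. lam)) (\<lambda>\<omega>. \<lambda>t\<in>{..<n}. Y t \<omega>) = law n" for n
  proof -
    have "sets (PiM {..<n} (\<lambda>_. lam)) = sets (PiM {..<n} (\<lambda>_. borel :: (real^'d) measure))"
      by (intro sets_PiM_cong) (auto simp: lam)
    then have "distr M (PiM {..<n} (\<lambda>_. lam)) (\<lambda>\<omega>. \<lambda>t\<in>{..<n}. Y t \<omega>) = distr M (PiM {..<n} (\<lambda>_. borel)) (\<lambda>\<omega>. \<lambda>t\<in>{..<n}. Y t \<omega>)"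
      by (intro distr_cong) auto
    then show ?thesis using Y_law by (simp only: law_def)
  qed
  interpret hmm_process lam Qs fs "stat_dist Qs" M Y
  proof (rule hmm_process.intro)
    show "hmm_model lam Qs fs (stat_dist Qs)" by (rule hmm_model_axioms)
    show "prob_space M" by (rule M)
    show "hmm_process_axioms lam Qs fs (stat_dist Qs) M Y" by (rule hmm_process_axioms.intro) (rule Ym Yd)+
  qed
  interpret hmm_bayes lam Qs fs "stat_dist Qs" M Y piQ pif \<mu> q
  proof (rule hmm_bayes.intro)
    show "hmm_process lam Qs fs (stat_dist Qs) M Y" by (rule hmm_process_axioms)
    show "hmm_bayes_axioms lam Qs piQ pif \<mu> q"
      by (rule hmm_bayes_axioms.intro) (use piQ pif pif_meas support \<mu> q lb in blast)+
  qed
  have "inj ((*v) Qs)" using full_rank by (simp add: full_rank_injective)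
  then have inv: "invertible Qs"
    by (simp add: invertible_left_inverse matrix_left_invertible_injective)
  obtain S where S: "\<And>a::'k. S a \<in> sets borel" "invertible (\<chi> a i. measure (density lam (\<lambda>y. ennreal (fs i y))) (S a))"
    using linear_independent_measures_invertible[OF lin_indep] by blast
  obtain eQ where eQ: "eQ > 0" "\<And>Q. mat_maxnorm (Q - Qs) < eQ \<Longrightarrow> Q \<in> UQ" using UQ unfolding norm_nhd_def by blast
  obtain G e where G: "\<And>i. finite (G i)" "\<And>i. e i > 0"
      "\<And>i g. g \<in> G i \<Longrightarrow> continuous_on UNIV g \<and> bounded (range (g :: real^'d \<Rightarrow> real))"
      "\<And>i R. prob_space R \<Longrightarrow> sets R = sets borel \<Longrightarrow>
        (\<forall>g\<in>G i. \<bar>(\<integral>y. g y \<partial>R) - (\<integral>y. g y \<partial>density lam (\<lambda>y. ennreal (fs i y)))\<bar> < e i) \<Longrightarrow> R \<in> Uf i"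
    using Uf unfolding weak_nhd_def by metis
  have finG: "finite (\<Union>i. G i)" using G(1) by auto
  have "bounded (\<Union>g\<in>(\<Union>i. G i). range g)" using finG G(3) by (intro bounded_UN) auto
  then obtain b where b: "0 < b" "\<And>g i y. g \<in> G i \<Longrightarrow> \<bar>g y\<bar> \<le> b"
    by (auto simp: bounded_pos)
  define sc where "sc g y = (g y + b) / (2 * b)" for g :: "real^'d \<Rightarrow> real" and y
  \<comment> \<open>The constant is the reference function for the conjugation, the indicators make
    the matrix of emission means invertible, and the rescaled functions generate the weak
    neighbourhoods.\<close>
  define H where "H = insert (\<lambda>_. 1) (range (\<lambda>a. indicator (S a)) \<union> sc ` (\<Union>i. G i))"
  have scH: "sc g \<in> H" if "g \<in> G i" for g i using that by (auto simp: H_def)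
  have gm: "g \<in> borel_measurable lam" if "g \<in> G i" for g i
  proof -
    have "g \<in> borel_measurable borel" using G(3)[OF that] by (intro borel_measurable_continuous_onI) auto
    then show ?thesis by measurable
  qed
  have sc_mean: "emis_mean lam f (sc g) x = ((\<integral>y. g y \<partial>density lam (\<lambda>y. ennreal (f x y))) + b) / (2 * b)"
    if "g \<in> G i" "f \<in> dens_tuples lam" for f g i and x :: 'k
    unfolding sc_def[abs_def] using that gm[OF that(1)] b by (intro emis_mean_scaled) (auto simp: dens_tuples_def)
  define em where "em = Min (range e)"
  have em: "0 < em" "\<And>i. em \<le> e i" using G(2) by (auto simp: em_def Min_gr_iff)
  \<comment> \<open>Rescaling by \<open>sc\<close> shrinks differences of integrals by the factor 2
    b, so closeness below em / (2 b) is what controls the originals by \<open>em\<close>.\<close>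
  define r where "r = min eQ (em / (2 * b))"
  have r: "0 < r" using eQ em b by (simp add: r_def)
  show ?thesis
  proof (rule posterior_consistent[OF A1 inv, where H = H and \<phi> = "\<lambda>a. indicator (S a)" and r = r])
    show "finite H" using finG by (simp add: H_def)
    show "h \<in> borel_measurable lam" if "h \<in> H" for h
    proof -
      have "sc g \<in> borel_measurable lam" if "g \<in> G i" for g i unfolding sc_def[abs_def] using gm[OF that] by measurable
      moreover have "indicator (S a) \<in> borel_measurable lam" for a using S(1) by measurable
      ultimately show ?thesis using that by (auto simp: H_def)
    qed
    have sc01: "0 \<le> sc g y \<and> sc g y \<le> 1" if "g \<in> G i" for g i y
      using b(1) b(2)[OF that, of y] by (simp add: sc_def abs_le_iff)
    show "0 \<le> h y" "h y \<le> 1" if "h \<in> H" for h y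
      using that sc01 by (auto simp: H_def indicator_def)
    show "(\<lambda>_. 1) \<in> H" by (simp add: H_def)
    show "indicator (S a) \<in> H" for a by (simp add: H_def)
    show "invertible (\<chi> a i. emis_mean lam fs (indicator (S a)) i)"
    proof -
      have "emis_mean lam fs (indicator (S a)) i = measure (density lam (\<lambda>y. ennreal (fs i y))) (S a)" for a i
        using fs S(1) lam(2) by (intro emis_mean_indicator) (auto simp: dens_tuples_def)
      then show ?thesis using S(2) by simp
    qed
    show "0 < r" by (rule r)
  next
    fix Q f \<sigma>
    assume Qf: "(Q, f) \<in> Theta_lb lam q" and \<sigma>: "\<sigma> permutes (UNIV :: 'k set)"
      and Qr: "\<And>i j. \<bar>Q$(\<sigma> i)$(\<sigma> j) - Qs$i$j\<bar> < r"
      and fr: "\<And>h i. h \<in> H \<Longrightarrow> \<bar>emis_mean lam f h (\<sigma> i) - emis_mean lam fs h i\<bar> < r"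
    have f: "f \<in> dens_tuples lam" using Qf by (simp add: Theta_lb_def)
    have "(\<chi> i j. Q$(\<sigma> i)$(\<sigma> j)) \<in> UQ"
    proof (rule eQ(2), rule mat_maxnorm_less)
      show "\<bar>((\<chi> i j. Q$(\<sigma> i)$(\<sigma> j)) - Qs)$i$j\<bar> < eQ" for i j using Qr[of i j] by (simp add: r_def)
    qed
    moreover have "density lam (\<lambda>y. ennreal (f (\<sigma> i) y)) \<in> Uf i" for i
    proof (rule G(4))
      show "prob_space (density lam (\<lambda>y. ennreal (f (\<sigma> i) y)))"
        using f by (intro prob_space_density) (simp add: dens_tuples_def)
      show "sets (density lam (\<lambda>y. ennreal (f (\<sigma> i) y))) = sets borel" by (simp add: lam)
      show "\<forall>g\<in>G i. \<bar>(\<integral>y. g y \<partial>density lam (\<lambda>y. ennreal (f (\<sigma> i) y))) - (\<integral>y. g y \<partial>density lam (\<lambda>y. ennreal (fs i y)))\<bar> < e i"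
      proof
        fix g assume g: "g \<in> G i"
        let ?x = "\<integral>y. g y \<partial>density lam (\<lambda>y. ennreal (f (\<sigma> i) y))" and ?y = "\<integral>y. g y \<partial>density lam (\<lambda>y. ennreal (fs i y))"
        have "\<bar>(?x + b) / (2 * b) - (?y + b) / (2 * b)\<bar> < r"
          using fr[OF scH[OF g], of i] by (simp only: sc_mean[OF g f] sc_mean[OF g fs])
        moreover have "(?x + b) / (2 * b) - (?y + b) / (2 * b) = (?x - ?y) / (2 * b)"
          by (simp only: diff_divide_distrib[symmetric] add_diff_cancel_right)
        ultimately have "\<bar>?x - ?y\<bar> / (2 * b) < r" using b(1) by (simp add: abs_divide)
        also have "r \<le> em / (2 * b)" by (simp add: r_def)
        finally have "\<bar>?x - ?y\<bar> < em" using b(1) by (simp add: divide_less_cancel)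
        then show "\<bar>?x - ?y\<bar> < e i" using em(2)[of i] by linarith
      qed
    qed
    ultimately show "(Q, f) \<in> {(Q, f). \<exists>\<sigma>. \<sigma> permutes (UNIV :: 'k set) \<and>
                 (\<chi> i j. Q$(\<sigma> i)$(\<sigma> j)) \<in> UQ \<and>
                 (\<forall>i. density lam (\<lambda>y. ennreal (f (\<sigma> i) y)) \<in> Uf i)}"
      using \<sigma> by blast
  qed
qed

end
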